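(* There is an absolute constant $C>0$ (in the paper $C(3)$, depending only on the dimension $3$) such that the following holds. Let $R>0$, let $\Theta\in\mathbb{R}$ with $|\Theta|\ge \pi/2$, and let $u$ be a smooth real-valued function on $B_R(0)\subset\mathbb{R}^3$ satisfying the special Lagrangian equation $\sum_{i=1}^{3}\arctan\lambda_i=\Theta$ on $B_R(0)$, where $\lambda_1,\lambda_2,\lambda_3$ are the eigenvalues of the Hessian $D^2u$. Then $$|D^2u(0)|\le C\exp\left[C\left(\cot\frac{|\Theta|-\pi/2}{3}\right)^2\frac{\max_{B_R(0)}|Du|^7}{R^7}\right],$$ and also $$|D^2u(0)|\le C\exp\left\{C\exp\left[C\,\frac{\max_{B_R(0)}|Du|^3}{R^3}\right]\right\}.$$
   Context: $B_R(0)$ is the Euclidean ball of radius $R$ centered at the origin. The constant $C$ does not depend on $u$, $R$ or $\Theta$. The maximum over $B_R(0)$ is understood as a supremum (the estimates being trivial when it is infinite). When $|\Theta|=\pi/2$, the cotangent is $\cot 0=+\infty$ and the first estimate is vacuous. *)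

theory Defs
  imports
    "HOL-Analysis.Analysis"
    "HOL-Computational_Algebra.Polynomial"
begin

definition partial_deriv :: "'n::finite \<Rightarrow> (real ^ 'n \<Rightarrow> real) \<Rightarrow> real ^ 'n \<Rightarrow> real" where
  "partial_deriv i f x = frechet_derivative f (at x) (axis i 1)"

(* Intended for open S, on which differentiable_on agrees with differentiability
   "at x" and hence with the derivative taken in partial_deriv. *)
primrec C_k_on :: "nat \<Rightarrow> (real ^ 'n::finite \<Rightarrow> real) \<Rightarrow> (real ^ 'n) set \<Rightarrow> bool" where
  "C_k_on 0 f S \<longleftrightarrow> continuous_on S f"
| "C_k_on (Suc k) f S \<longleftrightarrow> f differentiable_on S \<and> (\<forall>i. C_k_on k (partial_deriv i f) S)"

definition smooth_on :: "(real ^ 'n::finite \<Rightarrow> real) \<Rightarrow> (real ^ 'n) set \<Rightarrow> bool" where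
  "smooth_on f S \<longleftrightarrow> (\<forall>k. C_k_on k f S)"

definition gradient :: "(real ^ 'n::finite \<Rightarrow> real) \<Rightarrow> real ^ 'n \<Rightarrow> real ^ 'n" where
  "gradient f x = (\<chi> i. partial_deriv i f x)"

(* The norm of this matrix in real ^ 'n ^ 'n is the Frobenius (Hilbert-Schmidt) norm. *)
definition hessian :: "(real ^ 'n::finite \<Rightarrow> real) \<Rightarrow> real ^ 'n \<Rightarrow> real ^ 'n ^ 'n" where
  "hessian f x = (\<chi> i j. partial_deriv i (partial_deriv j f) x)"

definition charpoly :: "real ^ 'n ^ 'n::finite \<Rightarrow> real poly" where
  "charpoly A = det (\<chi> i j. (if i = j then [:0, 1:] else 0) - [:A $ i $ j:])"

(* Real eigenvalues with algebraic multiplicity. For a symmetric matrix, such as the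
   Hessian of a smooth function, these are all CARD('n) eigenvalues. *)
definition eigenvalues :: "real ^ 'n ^ 'n::finite \<Rightarrow> real multiset" where
  "eigenvalues A = proots (charpoly A)"

definition special_lagrangian_on :: "real \<Rightarrow> (real ^ 3 \<Rightarrow> real) \<Rightarrow> (real ^ 3) set \<Rightarrow> bool" where
  "special_lagrangian_on \<Theta> u S \<longleftrightarrow>
     (\<forall>x\<in>S. (\<Sum>l\<in>#eigenvalues (hessian u x). arctan l) = \<Theta>)"

end

(* Let A = D^2 u with eigenvalues l_i and g = I + A^2 the metric induced on the minimal graph (x, Du(x)).
   The equation reads c (sigma_1 - sigma_3) = s (1 - sigma_2) with c = cos Theta, s = sin Theta, and
   |Theta| >= pi/2 means (up to the sign of u) sigma_1 > 0 and sigma_2 >= 1. The volume density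
   V = c (1 - sigma_2) + s (sigma_1 - sigma_3) and the linearised operator L = V * (Laplacian of g) are polynomial
   in A, and L has divergence form.

   The function b = ln (Laplacian u) satisfies the Jacobi inequality L b >= 1/3 |grad b|^2 (in the metric
   V g^{-1}). Since the elementary symmetric functions of A are divergences, integration by parts against cutoffs
   bounds the integrals of sigma_1, sigma_2, |grad b|^2, b sigma_1 and b sigma_2 by powers of N = 1 + sup |Du|, and
   testing L b >= 0 with a cutoff times |Du|^2 then bounds the integral of b V by C N^7. As b is subharmonic on
   the minimal graph, the mean value inequality, obtained from the kernel 1/|X| of three-space restricted to the
   graph, gives b(0) <= C N^7. Finally |A| <= sigma_1 = exp b. *)

theory Submission
  imports Defs
begin

section \<open>Partial derivatives and integration by parts\<close>

text \<open>Both estimates come from one bound that is uniform in the phase. Three arctangents sum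
  to less than 3 pi / 2, so the squared cotangent in the first estimate is at least 1/3 and may be
  inserted into a bound that does without it. The second follows because a seventh power of the
  gradient ratio is dominated by an exponential of its cube. The obstacle is the cubic term sigma_3
  in V. From 1 - sigma_2 = V c one could bound V by sigma_2, but this degenerates as c tends to 0.
  The test function with |Du|^2 gives a bound that does not see c. The exponent 7 is an account of
  powers of N. Integrals of sigma_1 and sigma_2 cost N and N^2, and the gradient of b again N^2;
  passing from the trace of \<open>lin\<close> to V costs N^2 more, so V costs N^4. Young's
  inequality against V then gives N^4 for b sigma_1, one further integration by parts N^5 for b
  sigma_2, and the final passage to V gives N^7 for b V.\<close>

abbreviation D :: "'n::finite \<Rightarrow> (real ^ 'n \<Rightarrow> real) \<Rightarrow> real ^ 'n \<Rightarrow> real" where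
  "D \<equiv> partial_deriv"

lemma D_eqI: "(f has_derivative f') (at x) \<Longrightarrow> D i f x = f' (axis i 1)"
  unfolding partial_deriv_def by (metis frechet_derivative_at)

lemma D_has: "f differentiable at x \<Longrightarrow> (f has_derivative frechet_derivative f (at x)) (at x)"
  by (simp add: frechet_derivative_works)

lemma D_const [simp]: "D i (\<lambda>x. c) x = 0"
  by (rule D_eqI[where f' = "\<lambda>_. 0"]) (auto intro: derivative_eq_intros)

lemma D_add:
  assumes "f differentiable at x" "g differentiable at x"
  shows "D i (\<lambda>x. f x + g x) x = D i f x + D i g x"
  using D_eqI[OF has_derivative_add[OF D_has[OF assms(1)] D_has[OF assms(2)]]]
  by (simp add: partial_deriv_def)

lemma D_diff:
  assumes "f differentiable at x" "g differentiable at x"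
  shows "D i (\<lambda>x. f x - g x) x = D i f x - D i g x"
  using D_eqI[OF has_derivative_diff[OF D_has[OF assms(1)] D_has[OF assms(2)]]]
  by (simp add: partial_deriv_def)

lemma D_mult:
  assumes "f differentiable at x" "g differentiable at x"
  shows "D i (\<lambda>x. f x * g x) x = D i f x * g x + f x * D i g x"
  using D_eqI[OF has_derivative_mult[OF D_has[OF assms(1)] D_has[OF assms(2)]]]
  by (simp add: partial_deriv_def)

lemma D_cmult:
  assumes "f differentiable at x"
  shows "D i (\<lambda>x. c * f x) x = c * D i f x"
  using D_mult[of "\<lambda>_. c" x f i] assms by simp

lemma D_sum:
  assumes "finite I" "\<And>j. j \<in> I \<Longrightarrow> f j differentiable at x"
  shows "D i (\<lambda>x. \<Sum>j\<in>I. f j x) x = (\<Sum>j\<in>I. D i (f j) x)"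
  using assms
proof (induction I rule: finite_induct)
  case (insert a F)
  have "(\<lambda>x. \<Sum>j\<in>F. f j x) differentiable at x"
    using insert by (intro differentiable_sum) auto
  with insert show ?case by (simp add: D_add)
qed simp

lemma D_chain:
  assumes "f differentiable at x" "(h has_real_derivative d) (at (f x))"
  shows "D i (\<lambda>x. h (f x)) x = d * D i f x"
proof -
  have "((\<lambda>x. h (f x)) has_derivative (\<lambda>y. d * frechet_derivative f (at x) y)) (at x)"
    using has_derivative_compose[OF D_has[OF assms(1)], of h "(*) d"] assms(2)
    by (simp add: has_field_derivative_def)
  from D_eqI[OF this] show ?thesis by (simp add: partial_deriv_def)
qed

lemma differentiable_chain_real:
  fixes f :: "'a::real_normed_vector \<Rightarrow> real"
  assumes "f differentiable at x" "(h has_real_derivative d) (at (f x))"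
  shows "(\<lambda>x. h (f x)) differentiable at x"
  using assms has_derivative_compose[of f _ x UNIV h]
  by (auto simp: has_field_derivative_def differentiable_def)

lemma differentiable_cong_open:
  assumes "open S" "x \<in> S" "\<And>y. y \<in> S \<Longrightarrow> f y = g y" "f differentiable at x"
  shows "g differentiable at x"
  using assms(4) has_derivative_transform_within_open[OF _ assms(1,2), where f = f and g = g] assms(3)
  unfolding differentiable_def by blast

lemma D_cong_open:
  assumes "open S" "x \<in> S" "\<And>y. y \<in> S \<Longrightarrow> f y = g y"
  shows "D i f x = D i g x"
proof -
  have "(f has_derivative F) (at x) \<longleftrightarrow> (g has_derivative F) (at x)" for F
    using has_derivative_transform_within_open[OF _ assms(1,2), where f = f and g = g]
      has_derivative_transform_within_open[OF _ assms(1,2), where f = g and g = f] assms(3) by auto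
  then show ?thesis by (simp add: partial_deriv_def frechet_derivative_def)
qed

lemma D_component [simp]: "D (i::'n::finite)  (\<lambda>x. x $ j) x = (if i = j then 1 else 0)"
proof -
  have "((\<lambda>x::real^'n. x $ j) has_derivative (\<lambda>y. y $ j)) (at x)"
    by (rule bounded_linear_imp_has_derivative[OF bounded_linear_vec_nth])
  from D_eqI[OF this] show ?thesis by (auto simp: axis_def)
qed

lemma differentiable_component [simp]: "(\<lambda>x::real^'n. x $ j) differentiable at x"
  by (rule bounded_linear_imp_differentiable[OF bounded_linear_vec_nth])

lemma DERIV_along_axis:
  fixes y :: "real^'n"
  assumes "f differentiable at (y + s *\<^sub>R axis i 1)"
  shows "((\<lambda>s. f (y + s *\<^sub>R axis i 1)) has_real_derivative D i f (y + s *\<^sub>R axis i 1)) (at s)"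
proof -
  let ?F = "frechet_derivative f (at (y + s *\<^sub>R axis i 1))"
  have "((\<lambda>s. y + s *\<^sub>R axis i 1) has_derivative (\<lambda>t. t *\<^sub>R axis i 1)) (at s)"
    by (auto intro!: derivative_eq_intros)
  from has_derivative_compose[OF this D_has[OF assms]]
  have "((\<lambda>s. f (y + s *\<^sub>R axis i 1)) has_derivative (\<lambda>t. ?F (t *\<^sub>R axis i 1))) (at s)" .
  moreover have "?F (t *\<^sub>R axis i 1) = ?F (axis i 1) * t" for t
    using linear_frechet_derivative[OF assms] by (simp add: linear_cmul mult.commute)
  ultimately show ?thesis
    by (simp add: has_field_derivative_def partial_deriv_def mult_commute_abs)
qed

section \<open>Closure properties of k times continuously differentiable functions on open
  sets\<close>

lemma C_k_on_cong:
  assumes "open S" "\<And>x. x \<in> S \<Longrightarrow> f x = g x" "C_k_on k f S"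
  shows "C_k_on k g S"
  using assms(2,3)
proof (induction k arbitrary: f g)
  case 0
  then show ?case using continuous_on_cong by force
next
  case (Suc k)
  have "g differentiable_on S"
    using Suc.prems assms(1) differentiable_cong_open[OF assms(1), where f = f and g = g]
    by (auto simp: differentiable_on_eq_differentiable_at)
  moreover have "C_k_on k (D i g) S" for i
    by (rule Suc.IH[of "D i f"]) (use D_cong_open[OF assms(1) _ Suc.prems(1)] Suc.prems(2) in simp_all)
  ultimately show ?case by simp
qed

lemma C_k_on_SucD: "C_k_on (Suc k) f S \<Longrightarrow> C_k_on k f S"
  by (induction k arbitrary: f) (auto simp: differentiable_imp_continuous_on)

lemma C_k_on_mono: "C_k_on k f S \<Longrightarrow> j \<le> k \<Longrightarrow> C_k_on j f S"
  by (induction k) (auto simp del: C_k_on.simps dest: C_k_on_SucD simp: le_Suc_eq)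

lemma C_k_on_subset:
  assumes "C_k_on k f S" "T \<subseteq> S" shows "C_k_on k f T"
  using assms by (induction k arbitrary: f) (auto intro: continuous_on_subset differentiable_on_subset)

lemma C_k_on_const: "C_k_on k (\<lambda>x. c) S"
proof (induction k arbitrary: c)
  case (Suc k)
  have "D i (\<lambda>x. c) = (\<lambda>x. 0)" for i :: 'a by (rule ext) simp
  with Suc show ?case by simp
qed simp

lemma C_k_on_component: "C_k_on k (\<lambda>x. x $ j) S"
proof (cases k)
  case 0 then show ?thesis by (simp add: continuous_on_component continuous_on_id)
next
  case (Suc l)
  have "D i (\<lambda>x. x $ j) = (\<lambda>x. if i = j then 1 else 0)" for i by (rule ext) simp
  then show ?thesis using Suc
    by (simp add: C_k_on_const differentiable_on_def differentiable_at_withinI)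
qed

lemma C_k_on_differentiable:
  assumes "C_k_on (Suc k) f S" "open S" "x \<in> S"
  shows "f differentiable at x"
  using assms by (simp add: differentiable_on_eq_differentiable_at)

lemma C_k_on_add:
  assumes "open S" "C_k_on k f S" "C_k_on k g S"
  shows "C_k_on k (\<lambda>x. f x + g x) S"
  using assms(2,3)
proof (induction k arbitrary: f g)
  case (Suc k)
  have d: "f differentiable at x" "g differentiable at x" if "x \<in> S" for x
    using Suc.prems C_k_on_differentiable assms(1) that by blast+
  have "C_k_on k (D i (\<lambda>x. f x + g x)) S" for i
    by (rule C_k_on_cong[OF assms(1), of "\<lambda>x. D i f x + D i g x"])
      (use Suc d in \<open>auto simp: D_add\<close>)
  with Suc.prems show ?case by (auto intro: differentiable_on_add)
qed (auto intro: continuous_intros)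

lemma C_k_on_mult:
  assumes "open S" "C_k_on k f S" "C_k_on k g S"
  shows "C_k_on k (\<lambda>x. f x * g x) S"
  using assms(2,3)
proof (induction k arbitrary: f g)
  case (Suc k)
  have d: "f differentiable at x" "g differentiable at x" if "x \<in> S" for x
    using Suc.prems C_k_on_differentiable assms(1) that by blast+
  have "C_k_on k (D i (\<lambda>x. f x * g x)) S" for i
  proof (rule C_k_on_cong[OF assms(1), of "\<lambda>x. D i f x * g x + f x * D i g x"])
    show "C_k_on k (\<lambda>x. D i f x * g x + f x * D i g x) S"
      using Suc.prems C_k_on_SucD by (intro C_k_on_add assms(1) Suc.IH) auto
  qed (use d in \<open>auto simp: D_mult\<close>)
  with Suc.prems show ?case by (auto intro: differentiable_on_mult)
qed (auto intro: continuous_intros)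

lemma C_k_on_cmult:
  assumes "open S" "C_k_on k f S"
  shows "C_k_on k (\<lambda>x. c * f x) S"
  using C_k_on_mult[OF assms(1) C_k_on_const assms(2)] .

lemma C_k_on_uminus:
  assumes "open S" "C_k_on k f S"
  shows "C_k_on k (\<lambda>x. - f x) S"
  using C_k_on_cmult[OF assms, of "-1"] by simp

lemma C_k_on_diff:
  assumes "open S" "C_k_on k f S" "C_k_on k g S"
  shows "C_k_on k (\<lambda>x. f x - g x) S"
  using C_k_on_add[OF assms(1,2) C_k_on_uminus[OF assms(1,3)]] by simp

lemma C_k_on_sum:
  assumes "open S" "finite I" "\<And>j. j \<in> I \<Longrightarrow> C_k_on k (f j) S"
  shows "C_k_on k (\<lambda>x. \<Sum>j\<in>I. f j x) S"
  using assms(2,3) by (induction I rule: finite_induct) (auto simp: C_k_on_const C_k_on_add assms(1))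

lemma C_k_on_power:
  assumes "open S" "C_k_on k f S"
  shows "C_k_on k (\<lambda>x. f x ^ n) S"
  by (induction n) (auto simp: C_k_on_const C_k_on_mult assms)

text \<open>Regularity is demanded of the composite \<open>h' (f x)\<close> only, not of
  \<open>h'\<close>. This permits inductions in which the outer derivative is expressed through the
  function under study, as for reciprocals and truncated powers.\<close>

lemma C_k_on_chain:
  assumes "open S" "C_k_on (Suc k) f S" "C_k_on k (\<lambda>x. h' (f x)) S"
    and "\<And>x. x \<in> S \<Longrightarrow> (h has_real_derivative h' (f x)) (at (f x))"
  shows "C_k_on (Suc k) (\<lambda>x. h (f x)) S"
proof -
  have d: "f differentiable at x" if "x \<in> S" for x
    using C_k_on_differentiable assms(1,2) that by blast
  have "C_k_on k (D i (\<lambda>x. h (f x))) S" for i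
    by (rule C_k_on_cong[OF assms(1), of "\<lambda>x. h' (f x) * D i f x"])
      (use assms d D_chain[OF d assms(4)] in \<open>auto intro: C_k_on_mult\<close>)
  moreover have "(\<lambda>x. h (f x)) differentiable_on S"
    using assms d by (auto simp: differentiable_on_eq_differentiable_at intro: differentiable_chain_real)
  ultimately show ?thesis by simp
qed

section \<open>Symmetry of second partial derivatives\<close>

text \<open>The mean value theorem is applied in direction \<open>i\<close> to the increment in
  direction \<open>j\<close>, then in direction \<open>j\<close> to \<open>D i f\<close>. The
  left-hand side is symmetric in \<open>i\<close> and \<open>j\<close>, which is what forces the
  mixed derivatives to agree. The condition \<open>2 * h < r\<close> keeps the whole square inside
  the ball.\<close>

lemma double_difference_MVT:
  fixes f :: "real^'n \<Rightarrow> real"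
  assumes f: "C_k_on 2 f (ball x r)" and h: "0 < h" "2 * h < r"
  obtains y where "y \<in> ball x r"
    "f (x + h *\<^sub>R axis i 1 + h *\<^sub>R axis j 1) - f (x + h *\<^sub>R axis i 1) - f (x + h *\<^sub>R axis j 1) + f x
       = h\<^sup>2 * D j (D i f) y"
proof -
  let ?i = "axis i 1 :: real^'n" and ?j = "axis j 1 :: real^'n"
  have f2: "C_k_on (Suc 0) (D i f) (ball x r)" "C_k_on (Suc (Suc 0)) f (ball x r)"
    using f by (simp_all add: numeral_2_eq_2)
  have d: "f differentiable at y" "D i f differentiable at y" if "y \<in> ball x r" for y
    using that f2 C_k_on_differentiable[OF _ open_ball] by blast+
  have inb: "x + s *\<^sub>R ?i + t *\<^sub>R ?j \<in> ball x r" if "0 \<le> s" "s \<le> h" "0 \<le> t" "t \<le> h" for s t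
  proof -
    have "norm (s *\<^sub>R ?i + t *\<^sub>R ?j) \<le> s + t"
      using that norm_triangle_ineq[of "s *\<^sub>R ?i" "t *\<^sub>R ?j"] by (simp add: norm_axis_1)
    then have "norm (- (s *\<^sub>R ?i + t *\<^sub>R ?j)) < r" using that h by (subst norm_minus_cancel) simp
    then show ?thesis by (simp add: dist_norm algebra_simps)
  qed
  define \<phi> where "\<phi> s = f (x + h *\<^sub>R ?j + s *\<^sub>R ?i) - f (x + s *\<^sub>R ?i)" for s
  have "\<exists>s>0. s < h \<and> \<phi> h - \<phi> 0 = (h - 0) * (D i f (x + h *\<^sub>R ?j + s *\<^sub>R ?i) - D i f (x + s *\<^sub>R ?i))"
    unfolding \<phi>_def
  proof (rule MVT2[OF h(1)])
    fix s assume s: "0 \<le> s" "s \<le> h"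
    have "x + h *\<^sub>R ?j + s *\<^sub>R ?i \<in> ball x r" "x + s *\<^sub>R ?i \<in> ball x r"
      using inb[OF s, of h] inb[OF s, of 0] h by (simp_all add: ac_simps)
    then show "((\<lambda>s. f (x + h *\<^sub>R ?j + s *\<^sub>R ?i) - f (x + s *\<^sub>R ?i)) has_real_derivative
        D i f (x + h *\<^sub>R ?j + s *\<^sub>R ?i) - D i f (x + s *\<^sub>R ?i)) (at s)"
      by (intro DERIV_diff DERIV_along_axis d)
  qed
  then obtain s where s: "0 < s" "s < h"
    and e1: "\<phi> h - \<phi> 0 = h * (D i f (x + h *\<^sub>R ?j + s *\<^sub>R ?i) - D i f (x + s *\<^sub>R ?i))" by auto
  have "\<exists>t>0. t < h \<and> D i f (x + s *\<^sub>R ?i + h *\<^sub>R ?j) - D i f (x + s *\<^sub>R ?i + 0 *\<^sub>R ?j)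
      = (h - 0) * D j (D i f) (x + s *\<^sub>R ?i + t *\<^sub>R ?j)"
    by (rule MVT2[OF h(1)]) (use s inb in \<open>intro DERIV_along_axis d, auto\<close>)
  then obtain t where t: "0 < t" "t < h"
    and e2: "D i f (x + s *\<^sub>R ?i + h *\<^sub>R ?j) - D i f (x + s *\<^sub>R ?i)
      = h * D j (D i f) (x + s *\<^sub>R ?i + t *\<^sub>R ?j)" by auto
  show ?thesis
  proof (rule that)
    show "x + s *\<^sub>R ?i + t *\<^sub>R ?j \<in> ball x r" using inb s t by simp
    have "\<phi> h - \<phi> 0 = h * (h * D j (D i f) (x + s *\<^sub>R ?i + t *\<^sub>R ?j))"
      using e1 e2 by (simp add: ac_simps)
    then show "f (x + h *\<^sub>R axis i 1 + h *\<^sub>R axis j 1) - f (x + h *\<^sub>R axis i 1) - f (x + h *\<^sub>R axis j 1) + f x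
       = h\<^sup>2 * D j (D i f) (x + s *\<^sub>R ?i + t *\<^sub>R ?j)"
      unfolding \<phi>_def by (simp add: ac_simps power2_eq_square)
  qed
qed

theorem clairaut:
  fixes f :: "real^'n \<Rightarrow> real"
  assumes "open S" "C_k_on 2 f S" "x \<in> S"
  shows "D i (D j f) x = D j (D i f) x"
proof -
  have cont: "continuous_on S (D i (D j f))" "continuous_on S (D j (D i f))"
    using assms(2) by (simp_all add: numeral_2_eq_2)
  have le: "\<bar>D i (D j f) x - D j (D i f) x\<bar> \<le> 0 + e" if "e > 0" for e
  proof -
    have e2: "e/2 > 0" using that by simp
    have ic: "isCont (D i (D j f)) x" "isCont (D j (D i f)) x"
      using cont assms by (auto simp: continuous_on_eq_continuous_at)
    obtain r1 where r1: "r1 > 0" "\<And>y. dist y x < r1 \<Longrightarrow> dist (D i (D j f) y) (D i (D j f) x) < e/2"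
      using ic(1) e2 unfolding continuous_at_eps_delta by blast
    obtain r2 where r2: "r2 > 0" "\<And>y. dist y x < r2 \<Longrightarrow> dist (D j (D i f) y) (D j (D i f) x) < e/2"
      using ic(2) e2 unfolding continuous_at_eps_delta by blast
    note r = r1(1) r2(1) r1(2) r2(2)
    obtain r0 where r0: "r0 > 0" "ball x r0 \<subseteq> S"
      using assms open_contains_ball by blast
    define r where "r = min r0 (min r1 r2)"
    have rp: "r > 0" using r r0 by (simp add: r_def)
    have f: "C_k_on 2 f (ball x r)"
      by (rule C_k_on_subset[OF assms(2)]) (use r0 in \<open>auto simp: r_def\<close>)
    define h where "h = r/4"
    have h: "0 < h" "2 * h < r" using rp by (simp_all add: h_def)
    obtain y where y: "y \<in> ball x r" "f (x + h *\<^sub>R axis i 1 + h *\<^sub>R axis j 1) - f (x + h *\<^sub>R axis i 1) - f (x + h *\<^sub>R axis j 1) + f x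
       = h\<^sup>2 * D j (D i f) y" using double_difference_MVT[OF f h] by blast
    obtain z where z: "z \<in> ball x r" "f (x + h *\<^sub>R axis j 1 + h *\<^sub>R axis i 1) - f (x + h *\<^sub>R axis j 1) - f (x + h *\<^sub>R axis i 1) + f x
       = h\<^sup>2 * D i (D j f) z" using double_difference_MVT[OF f h] by blast
    have "h\<^sup>2 * D j (D i f) y = h\<^sup>2 * D i (D j f) z"
      using y(2) z(2) by (simp add: algebra_simps)
    then have "D j (D i f) y = D i (D j f) z" using h by simp
    moreover have "dist (D i (D j f) z) (D i (D j f) x) < e/2" "dist (D j (D i f) y) (D j (D i f) x) < e/2"
      by (rule r(3), use z(1) in \<open>simp add: r_def dist_commute\<close>)
        (rule r(4), use y(1) in \<open>simp add: r_def dist_commute\<close>)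
    ultimately show ?thesis unfolding dist_real_def by linarith
  qed
  have "\<bar>D i (D j f) x - D j (D i f) x\<bar> \<le> 0" by (rule field_le_epsilon) (rule le)
  then show ?thesis by simp
qed

section \<open>The integral of a derivative of a compactly supported function\<close>

lemma integral_lborel_translation:
  fixes g :: "'a::euclidean_space \<Rightarrow> real"
  assumes "g \<in> borel_measurable borel"
  shows "(LINT x|lborel. g (c + x)) = (LINT x|lborel. g x)"
proof -
  have "(LINT x|lborel. g x) = (LINT x|distr lborel borel ((+) c). g x)" by (simp add: lborel_distr_plus)
  also have "\<dots> = (LINT x|lborel. g (c + x))" using assms by (intro integral_distr) auto
  finally show ?thesis by simp
qed

lemma integrable_lborel_translation:
  fixes g :: "'a::euclidean_space \<Rightarrow> real"
  assumes "integrable lborel g"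
  shows "integrable lborel (\<lambda>x. g (c + x))"
proof -
  have "integrable (distr lborel borel ((+) c)) g" using assms by (simp add: lborel_distr_plus)
  then show ?thesis by (subst (asm) integrable_distr_eq) (use assms in auto)
qed

text \<open>Extended by zero, \<open>f\<close> is differentiable everywhere, and each of its
  difference quotients has integral 0 by translation invariance of Lebesgue measure. Dominated
  convergence passes this to the derivative, so neither Fubini nor a boundary is involved.\<close>

theorem integral_partial_deriv_eq_0:
  fixes f :: "real^'n \<Rightarrow> real"
  assumes S: "open S" and f: "C_k_on 1 f S" and K: "compact K" "K \<subseteq> S"
    and zero: "\<And>x. x \<in> S \<Longrightarrow> x \<notin> K \<Longrightarrow> f x = 0"
  shows "(LINT x:K|lborel. D i f x) = 0"
proof -
  define g where "g x = (if x \<in> K then f x else 0)" for x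
  let ?e = "axis i 1 :: real^'n"
  have f1: "f differentiable_on S" "continuous_on S (D i f)" using f by auto
  have oK: "open (- K)" using K by (simp add: compact_imp_closed open_Compl)
  have gS: "f y = g y" if "y \<in> S" for y using that zero by (auto simp: g_def)
  have gK: "0 = g y" if "y \<in> - K" for y using that by (auto simp: g_def)
  have gd: "g differentiable at x" for x
  proof (cases "x \<in> K")
    case True
    then have "x \<in> S" using K by auto
    then show ?thesis using differentiable_cong_open[OF S _ gS] f1 S
      by (auto simp: differentiable_on_eq_differentiable_at)
  next
    case False
    then show ?thesis using differentiable_cong_open[OF oK _ gK] by auto
  qed
  have Dg: "D i g x = indicator K x * D i f x" for x
  proof (cases "x \<in> K")
    case True
    then show ?thesis using D_cong_open[OF S _ gS, where i = i and x = x] K by auto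
  next
    case False
    then show ?thesis using D_cong_open[OF oK _ gK, where i = i and x = x] by simp
  qed
  have "bounded (D i f ` K)"
    by (intro compact_imp_bounded compact_continuous_image K continuous_on_subset[OF f1(2)])
  then obtain B0 where B0: "\<And>x. x \<in> K \<Longrightarrow> \<bar>D i f x\<bar> \<le> B0"
    unfolding bounded_iff by auto
  define B where "B = max 0 B0"
  have B: "\<bar>D i g x\<bar> \<le> B" for x using B0[of x] by (cases "x \<in> K") (auto simp: Dg B_def)
  have B_nonneg: "B \<ge> 0" by (simp add: B_def)
  obtain \<rho> where \<rho>: "\<And>x. x \<in> K \<Longrightarrow> norm x \<le> \<rho>"
    using compact_imp_bounded[OF K(1)] unfolding bounded_iff by auto
  have gcont: "continuous_on UNIV g"
    using gd differentiable_imp_continuous_within[of g _ UNIV] by (simp add: continuous_on_eq_continuous_within)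
  have gmeas: "g \<in> borel_measurable borel" using gcont by (rule borel_measurable_continuous_onI)
  have gint: "integrable lborel g"
  proof -
    have "integrable lborel (\<lambda>x. indicator K x *\<^sub>R f x)"
      using K f1 by (intro borel_integrable_compact continuous_on_subset[OF differentiable_imp_continuous_on])
    moreover have "(\<lambda>x. indicator K x *\<^sub>R f x) = g" by (auto simp: g_def)
    ultimately show ?thesis by simp
  qed
  define h :: "nat \<Rightarrow> real" where "h n = inverse (real (Suc n))" for n
  have h: "0 < h n" "h n \<le> 1" for n by (auto simp: h_def field_simps)
  define q where "q n x = (g (h n *\<^sub>R ?e + x) - g x) / h n" for n x
  have qint: "(LINT x|lborel. q n x) = 0" for n
  proof -
    have "(LINT x|lborel. g (h n *\<^sub>R ?e + x) - g x) = 0"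
      using integral_lborel_translation[OF gmeas] integrable_lborel_translation[OF gint] gint by simp
    then show ?thesis by (simp add: q_def)
  qed
  have "(\<lambda>n. LINT x|lborel. q n x) \<longlonglongrightarrow> (LINT x|lborel. D i g x)"
  \<comment> \<open>The steps \<open>h n\<close> are at most 1, so all quotients vanish outside the
    ball of radius \<open>\<rho> + 1\<close>; inside it the mean value theorem bounds them by
    \<open>B\<close>.\<close>
  proof (rule integral_dominated_convergence[where w = "\<lambda>x. indicator (cball 0 (\<rho> + 1)) x *\<^sub>R B"])
    have [measurable]: "g \<in> borel_measurable borel" by (rule gmeas)
    show "q n \<in> borel_measurable lborel" for n unfolding q_def by measurable
    have lim: "(\<lambda>n. q n x) \<longlonglongrightarrow> D i g x" for x
    proof -
      have "((\<lambda>s. g (x + s *\<^sub>R ?e)) has_real_derivative D i g (x + 0 *\<^sub>R ?e)) (at 0)"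
        by (rule DERIV_along_axis[OF gd])
      then have "((\<lambda>s. (g (x + s *\<^sub>R ?e) - g x) / s) \<longlongrightarrow> D i g x) (at 0)"
        by (simp add: has_field_derivative_iff)
      moreover have "filterlim h (at 0) sequentially"
        unfolding filterlim_at using h LIMSEQ_inverse_real_of_nat by (auto simp: h_def[abs_def] intro!: always_eventually)
      ultimately have "((\<lambda>n. (g (x + h n *\<^sub>R ?e) - g x) / h n) \<longlonglongrightarrow> D i g x)"
        by (rule filterlim_compose)
      then show ?thesis by (simp add: q_def add.commute)
    qed
    show "AE x in lborel. (\<lambda>n. q n x) \<longlonglongrightarrow> D i g x" using lim by simp
    show "D i g \<in> borel_measurable lborel"
      by (rule borel_measurable_LIMSEQ_metric[where f = q, OF _ lim]) (unfold q_def, measurable)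
    show "integrable lborel (\<lambda>x. indicator (cball (0::real^'n) (\<rho> + 1)) x *\<^sub>R B)"
      by (rule borel_integrable_compact) auto
    show "AE x in lborel. norm (q n x) \<le> indicator (cball 0 (\<rho> + 1)) x *\<^sub>R B" for n
    proof (rule AE_I2)
      fix x
      show "norm (q n x) \<le> indicator (cball 0 (\<rho> + 1)) x *\<^sub>R B"
      proof (cases "x \<in> cball 0 (\<rho> + 1)")
        case True
        have "\<exists>s>0. s < h n \<and> g (x + h n *\<^sub>R ?e) - g (x + 0 *\<^sub>R ?e) = (h n - 0) * D i g (x + s *\<^sub>R ?e)"
          by (rule MVT2[OF h(1)]) (intro DERIV_along_axis gd)
        then obtain s where "g (x + h n *\<^sub>R ?e) - g x = h n * D i g (x + s *\<^sub>R ?e)" by auto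
        then have "q n x = D i g (x + s *\<^sub>R ?e)" using h(1)[of n] by (simp add: q_def add.commute)
        then show ?thesis using True B by simp
      next
        case False
        have "x \<notin> K" using \<rho>[of x] False by auto
        moreover have "h n *\<^sub>R ?e + x \<notin> K"
        proof
          assume "h n *\<^sub>R ?e + x \<in> K"
          then have "norm (h n *\<^sub>R ?e + x) \<le> \<rho>" using \<rho> by blast
          moreover have "norm x \<le> norm (h n *\<^sub>R ?e + x) + norm (h n *\<^sub>R ?e)"
            using norm_triangle_ineq4[of "h n *\<^sub>R ?e + x" "h n *\<^sub>R ?e"] by simp
          moreover have "norm (h n *\<^sub>R ?e) \<le> 1" using h[of n] by (simp add: norm_axis_1)
          ultimately show False using False by simp
        qed
        ultimately show ?thesis using False by (simp add: q_def g_def)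
      qed
    qed
  qed
  then have "(LINT x|lborel. D i g x) = 0" by (simp add: qint LIMSEQ_const_iff)
  then show ?thesis by (simp add: Dg set_lebesgue_integral_def)
qed

section \<open>The Jacobi inequality in an eigenframe\<close>

text \<open>Lagrange's identity: the gap is the sum of the squared two by two minors.\<close>

lemma cauchy4:
  fixes c1 :: real
  shows "(c1*q1 + c2*q2 + c3*q3 + c4*q4)\<^sup>2 \<le> (c1\<^sup>2+c2\<^sup>2+c3\<^sup>2+c4\<^sup>2) * (q1\<^sup>2+q2\<^sup>2+q3\<^sup>2+q4\<^sup>2)"
proof -
  have "(c1\<^sup>2+c2\<^sup>2+c3\<^sup>2+c4\<^sup>2) * (q1\<^sup>2+q2\<^sup>2+q3\<^sup>2+q4\<^sup>2) - (c1*q1 + c2*q2 + c3*q3 + c4*q4)\<^sup>2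
    = (c1*q2-c2*q1)\<^sup>2 + (c1*q3-c3*q1)\<^sup>2 + (c1*q4-c4*q1)\<^sup>2 + (c2*q3-c3*q2)\<^sup>2
      + (c2*q4-c4*q2)\<^sup>2 + (c3*q4-c4*q3)\<^sup>2"
    by (simp add: power2_eq_square algebra_simps)
  also have "\<dots> \<ge> 0" by (intro add_nonneg_nonneg zero_le_power2)
  finally show ?thesis by simp
qed

text \<open>The weights \<open>a - t b / 2\<close>, \<open>b - t a / 2\<close>, \<open>- (a + t b) / 2\<close>, \<open>- b r / 2\<close> in the Cauchy inequality below
  are chosen such that their squares sum to at most \<open>(3/2) (a\<^sup>2 + b\<^sup>2 - t a b)\<close>. The constant is sharp (for instance
  at \<open>a = b\<close>, \<open>t = -1\<close>), and it yields the factor \<open>4/3\<close> of the Jacobi inequality.\<close>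

lemma jacobi_form_core:
  fixes a b t Y Z :: real
  assumes t: "t\<^sup>2 \<le> 1"
  shows "(a*(a-2*t*b)*Y + b*(b-2*t*a)*Z)\<^sup>2 \<le> (3/2) * (a\<^sup>2+b\<^sup>2-t*a*b) *
    (((a-t*b)\<^sup>2 + t\<^sup>2*b\<^sup>2)*Y\<^sup>2 + ((b-t*a)\<^sup>2 + t\<^sup>2*a\<^sup>2)*Z\<^sup>2 + 2*t^3*a*b*Y*Z)"
proof -
  define r where "r = sqrt (1 - t\<^sup>2)"
  have r: "r\<^sup>2 = 1 - t\<^sup>2" using t by (simp add: r_def)
  let ?Q = "((a-t*b)\<^sup>2 + t\<^sup>2*b\<^sup>2)*Y\<^sup>2 + ((b-t*a)\<^sup>2 + t\<^sup>2*a\<^sup>2)*Z\<^sup>2 + 2*t^3*a*b*Y*Z"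
  let ?C = "(a-t*b/2)\<^sup>2 + (b-t*a/2)\<^sup>2 + (-(a+t*b)/2)\<^sup>2 + (-(b/2)*r)\<^sup>2"
  \<comment> \<open>The term t^2 a^2 Z^2 is split into t^4 a^2 Z^2 and r^2 t^2 a^2 Z^2. The first
    part completes the mixed term 2 t^3 a b Y Z to a square with t b Y.\<close>
  have Q: "((a-t*b)*Y)\<^sup>2 + ((b-t*a)*Z)\<^sup>2 + (t*b*Y + t*(t*a*Z))\<^sup>2 + (r*(t*a*Z))\<^sup>2 = ?Q"
    unfolding power_mult_distrib[of r] r by (simp add: power2_eq_square power3_eq_cube algebra_simps)
  then have Q0: "?Q \<ge> 0" by (metis add_nonneg_nonneg zero_le_power2)
  have "a*(a-2*t*b)*Y + b*(b-2*t*a)*Z = (a-t*b/2)*((a-t*b)*Y) + (b-t*a/2)*((b-t*a)*Z)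
      + (-(a+t*b)/2)*(t*b*Y + t*(t*a*Z)) - (b/2)*(1-t\<^sup>2)*(t*a*Z)"
    by (simp add: power2_eq_square field_simps)
  also have "(b/2)*(1-t\<^sup>2)*(t*a*Z) = (b/2)*r*(r*(t*a*Z))"
    unfolding r[symmetric] by (simp add: power2_eq_square)
  finally have "(a*(a-2*t*b)*Y + b*(b-2*t*a)*Z)\<^sup>2 = ((a-t*b/2)*((a-t*b)*Y) + (b-t*a/2)*((b-t*a)*Z)
      + (-(a+t*b)/2)*(t*b*Y + t*(t*a*Z)) + (-(b/2)*r)*(r*(t*a*Z)))\<^sup>2" by simp
  also have "\<dots> \<le> ?C * ?Q" unfolding Q[symmetric] by (rule cauchy4)
  also have "?C = (5/4+t\<^sup>2/4)*(a\<^sup>2+b\<^sup>2) - (3/2)*t*a*b"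
    unfolding power_mult_distrib[of _ r] r by (simp add: power2_eq_square field_simps)
  also have "((5/4+t\<^sup>2/4)*(a\<^sup>2+b\<^sup>2) - (3/2)*t*a*b) * ?Q \<le> (3/2) * (a\<^sup>2+b\<^sup>2-t*a*b) * ?Q"
  proof (rule mult_right_mono[OF _ Q0])
    have "(t\<^sup>2/4) * (a\<^sup>2+b\<^sup>2) \<le> (1/4) * (a\<^sup>2+b\<^sup>2)" using t by (intro mult_right_mono) auto
    then show "(5/4+t\<^sup>2/4)*(a\<^sup>2+b\<^sup>2) - (3/2)*t*a*b \<le> (3/2) * (a\<^sup>2+b\<^sup>2-t*a*b)"
      by (simp add: algebra_simps)
  qed
  finally show ?thesis .
qed

text \<open>With a^2 = l + m, b^2 = l + n and t = l / (a b), the identity (l + m)(l + n) = l^2 +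
  sigma_2 turns sigma_2 \<ge> 0 into t^2 \<le> 1, and sigma_1 becomes a^2 + b^2 - t a b. The core
  inequality then covers the terms of highest degree in the eigenvalues.\<close>

lemma jacobi_form_index:
  fixes l m n y z :: real
  assumes p: "l + m > 0" and q: "l + n > 0" and S: "l*m + l*n + m*n \<ge> 0"
  shows "(4/3) * ((m\<^sup>2 - l\<^sup>2)*y + (n\<^sup>2-l\<^sup>2)*z)\<^sup>2 \<le> 2 * (l+m+n) *
     ((l+m)*(2+l\<^sup>2+m\<^sup>2)*y\<^sup>2 + (l+n)*(2+l\<^sup>2+n\<^sup>2)*z\<^sup>2 + 2*l*(1+l\<^sup>2)*y*z)"
proof -
  define a where "a = sqrt (l+m)"
  define b where "b = sqrt (l+n)"
  define t where "t = l / (a*b)"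
  have ab: "a > 0" "b > 0" "a\<^sup>2 = l+m" "b\<^sup>2 = l+n" using p q by (auto simp: a_def b_def)
  have tab: "t*a*b = l" using ab by (simp add: t_def)
  have t2: "t\<^sup>2 * ((l+m)*(l+n)) = l\<^sup>2"
    using tab ab by (metis (no_types, lifting) power_mult_distrib mult.assoc)
  have pq: "(l+m)*(l+n) = l\<^sup>2 + (l*m + l*n + m*n)" by (simp add: power2_eq_square algebra_simps)
  have pq0: "(l+m)*(l+n) > 0" using p q by simp
  have t1: "t\<^sup>2 \<le> 1"
  proof (rule ccontr)
    assume "\<not> t\<^sup>2 \<le> 1"
    then have "1 * ((l+m)*(l+n)) < t\<^sup>2 * ((l+m)*(l+n))" using pq0 by (intro mult_strict_right_mono) auto
    then show False using t2 pq S by linarith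
  qed
  define Y where "Y = (l+m)*y"
  define Z where "Z = (l+n)*z"
  let ?p = "l+m" and ?q = "l+n"
  have e1: "(m\<^sup>2 - l\<^sup>2)*y + (n\<^sup>2-l\<^sup>2)*z = a*(a-2*t*b)*Y + b*(b-2*t*a)*Z"
  proof -
    have "a*(a-2*t*b) = m - l" "b*(b-2*t*a) = n - l"
      using ab tab by (simp_all add: algebra_simps power2_eq_square)
    then have "a*(a-2*t*b)*Y + b*(b-2*t*a)*Z = (m-l)*Y + (n-l)*Z" by (simp only:)
    then show ?thesis by (simp add: Y_def Z_def power2_eq_square algebra_simps)
  qed
  have e2: "a\<^sup>2+b\<^sup>2-t*a*b = l+m+n" using ab tab by simp
  let ?Q = "((a-t*b)\<^sup>2 + t\<^sup>2*b\<^sup>2)*Y\<^sup>2 + ((b-t*a)\<^sup>2 + t\<^sup>2*a\<^sup>2)*Z\<^sup>2 + 2*t^3*a*b*Y*Z"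
  have c1: "(a-t*b)\<^sup>2 + t\<^sup>2*b\<^sup>2 = m - l + 2*t\<^sup>2*?q" "(b-t*a)\<^sup>2 + t\<^sup>2*a\<^sup>2 = n - l + 2*t\<^sup>2*?p"
    using ab tab by (simp_all add: power2_diff power_mult_distrib algebra_simps)
  have c2: "2*t^3*a*b*Y*Z = 2*t\<^sup>2*l*Y*Z"
    using tab by (simp add: power3_eq_cube power2_eq_square algebra_simps)
  have Yt: "t\<^sup>2*?q*Y\<^sup>2 = l\<^sup>2*?p*y\<^sup>2" "t\<^sup>2*?p*Z\<^sup>2 = l\<^sup>2*?q*z\<^sup>2" "t\<^sup>2*(l*Y*Z) = l\<^sup>2*(l*y*z)"
    unfolding Y_def Z_def t2[symmetric] by (simp_all add: power2_eq_square algebra_simps)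
  have Qeq: "?Q = ?p*(m\<^sup>2-l\<^sup>2+2*l\<^sup>2)*y\<^sup>2 + ?q*(n\<^sup>2-l\<^sup>2+2*l\<^sup>2)*z\<^sup>2 + 2*l\<^sup>2*(l*y*z)"
  proof -
    have "?Q = (m-l)*Y\<^sup>2 + 2*(t\<^sup>2*?q*Y\<^sup>2) + (n-l)*Z\<^sup>2 + 2*(t\<^sup>2*?p*Z\<^sup>2) + 2*(t\<^sup>2*(l*Y*Z))"
      unfolding c1 c2 by (simp add: algebra_simps)
    then show ?thesis unfolding Yt by (simp add: Y_def Z_def power2_eq_square algebra_simps)
  qed
  have "(4/3) * ((m\<^sup>2 - l\<^sup>2)*y + (n\<^sup>2-l\<^sup>2)*z)\<^sup>2 \<le> (4/3) * ((3/2) * (l+m+n) * ?Q)"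
    unfolding e1 e2[symmetric] using jacobi_form_core[OF t1] by (intro mult_left_mono) auto
  also have "\<dots> = 2*(l+m+n) * ?Q" by simp
  also have "\<dots> \<le> 2*(l+m+n) * ((l+m)*(2+l\<^sup>2+m\<^sup>2)*y\<^sup>2 + (l+n)*(2+l\<^sup>2+n\<^sup>2)*z\<^sup>2 + 2*l*(1+l\<^sup>2)*y*z)"
  proof (rule mult_left_mono)
    \<comment> \<open>What the core inequality leaves over is 2 (l+m) y^2 + 2 (l+n) z^2 + 2 l y z,
      nonnegative again because |t| \<le> 1.\<close>
    have "0 \<le> (a*y + t*b*z)\<^sup>2 + (1-t\<^sup>2)*(b\<^sup>2*z\<^sup>2)" using t1 by simp
    also have "\<dots> = a\<^sup>2*y\<^sup>2 + b\<^sup>2*z\<^sup>2 + 2*((t*a*b)*y*z)"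
      by (simp add: power2_eq_square algebra_simps)
    also have "\<dots> = ?p*y\<^sup>2 + ?q*z\<^sup>2 + 2*(l*y*z)" by (simp only: ab tab)
    finally have "0 \<le> ?p*y\<^sup>2 + ?q*z\<^sup>2 + 2*(l*y*z)" .
    moreover have "0 \<le> ?p*y\<^sup>2 + ?q*z\<^sup>2" using p q by simp
    moreover have "((l+m)*(2+l\<^sup>2+m\<^sup>2)*y\<^sup>2 + (l+n)*(2+l\<^sup>2+n\<^sup>2)*z\<^sup>2 + 2*l*(1+l\<^sup>2)*y*z) - ?Q
      = (?p*y\<^sup>2 + ?q*z\<^sup>2) + (?p*y\<^sup>2 + ?q*z\<^sup>2 + 2*(l*y*z))"
      unfolding Qeq by (simp add: power2_eq_square algebra_simps)
    ultimately have "0 \<le> ((l+m)*(2+l\<^sup>2+m\<^sup>2)*y\<^sup>2 + (l+n)*(2+l\<^sup>2+n\<^sup>2)*z\<^sup>2 + 2*l*(1+l\<^sup>2)*y*z) - ?Q"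
      by (simp only: add_nonneg_nonneg)
    then show "?Q \<le> (l+m)*(2+l\<^sup>2+m\<^sup>2)*y\<^sup>2 + (l+n)*(2+l\<^sup>2+n\<^sup>2)*z\<^sup>2 + 2*l*(1+l\<^sup>2)*y*z"
      by (simp only: diff_ge_0_iff_ge)
    have "0 \<le> a\<^sup>2 + b\<^sup>2 - t*a*b"
    proof -
      have "0 \<le> (a - t*b/2)\<^sup>2 + (1-t\<^sup>2/4)*b\<^sup>2" using t1 by simp
      also have "\<dots> = a\<^sup>2 + b\<^sup>2 - t*a*b" by (simp add: power2_eq_square field_simps)
      finally show ?thesis .
    qed
    then show "0 \<le> 2*(l+m+n)" using e2 by simp
  qed
  finally show ?thesis .
qed

text \<open>\<open>X\<close>, \<open>Y\<close>, \<open>Z\<close> are the third derivatives u_11k,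
  u_22k, u_33k in an eigenframe, with k the direction of the eigenvalue \<open>l\<close>. The
  differentiated equation \<open>tr\<close> eliminates \<open>X\<close>, leaving a quadratic form in
  \<open>gm*Y\<close> and \<open>gn*Z\<close>.\<close>

lemma jacobi_form_trace_free:
  fixes l m n X Y Z :: real
  defines "gl \<equiv> 1/(1+l\<^sup>2)" and "gm \<equiv> 1/(1+m\<^sup>2)" and "gn \<equiv> 1/(1+n\<^sup>2)"
  assumes p: "l + m > 0" and q: "l + n > 0" and S: "l*m + l*n + m*n \<ge> 0"
    and tr: "gl*X + gm*Y + gn*Z = 0"
  shows "(4/3) * gl * (X+Y+Z)\<^sup>2 \<le> (l+m+n) * (2*(l*(gl*X)\<^sup>2 + m*(gm*Y)\<^sup>2 + n*(gn*Z)\<^sup>2)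
            + 2*(l+m)*gl*gm*Y\<^sup>2 + 2*(l+n)*gl*gn*Z\<^sup>2)"
proof -
  define L where "L = 1+l\<^sup>2"
  define M where "M = 1+m\<^sup>2"
  define N where "N = 1+n\<^sup>2"
  have pos: "L > 0" "M > 0" "N > 0" by (simp_all add: L_def M_def N_def add_pos_nonneg)
  define y where "y = gm*Y"
  define z where "z = gn*Z"
  have x: "gl*X = -(y+z)" using tr by (simp add: y_def z_def)
  have g: "gl = 1/L" "gm = 1/M" "gn = 1/N" by (simp_all add: gl_def gm_def gn_def L_def M_def N_def)
  have XYZ: "Y = M*y" "Z = N*z" "X = -(L*(y+z))"
    using x pos by (simp_all add: y_def z_def g field_simps)
  have "(4/3) * (X+Y+Z)\<^sup>2 = (4/3) * ((m\<^sup>2 - l\<^sup>2)*y + (n\<^sup>2-l\<^sup>2)*z)\<^sup>2"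
    by (simp add: XYZ L_def M_def N_def algebra_simps)
  also have "\<dots> \<le> 2 * (l+m+n) *
     ((l+m)*(2+l\<^sup>2+m\<^sup>2)*y\<^sup>2 + (l+n)*(2+l\<^sup>2+n\<^sup>2)*z\<^sup>2 + 2*l*(1+l\<^sup>2)*y*z)"
    by (rule jacobi_form_index[OF p q S])
  also have "\<dots> = (l+m+n) * (2*L*(l*(y+z)\<^sup>2 + m*y\<^sup>2 + n*z\<^sup>2) + 2*(l+m)*M*y\<^sup>2 + 2*(l+n)*N*z\<^sup>2)"
    by (simp add: L_def M_def N_def power2_eq_square algebra_simps)
  finally have "gl * ((4/3) * (X+Y+Z)\<^sup>2) \<le> gl * ((l+m+n) * (2*L*(l*(y+z)\<^sup>2 + m*y\<^sup>2 + n*z\<^sup>2) + 2*(l+m)*M*y\<^sup>2 + 2*(l+n)*N*z\<^sup>2))"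
    using pos by (intro mult_left_mono) (auto simp: g)
  also have "\<dots> = (l+m+n) * (2*(gl*L)*(l*(y+z)\<^sup>2 + m*y\<^sup>2 + n*z\<^sup>2) + 2*(l+m)*gl*(M*y\<^sup>2) + 2*(l+n)*gl*(N*z\<^sup>2))"
    by (simp add: algebra_simps)
  also have "gl*L = 1" using pos by (simp add: g)
  also have "M*y\<^sup>2 = gm*Y\<^sup>2" using pos by (simp add: XYZ g power2_eq_square)
  also have "N*z\<^sup>2 = gn*Z\<^sup>2" using pos by (simp add: XYZ g power2_eq_square)
  also have "(y+z)\<^sup>2 = (gl*X)\<^sup>2" unfolding x by (simp add: power2_eq_square algebra_simps)
  finally show ?thesis by (simp add: y_def z_def algebra_simps)
qed

text \<open>By total symmetry of \<open>T\<close> the quadratic form decouples into one block for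
  each k, made of T_11k, T_22k, T_33k, and the single entry T_123, whose coefficient is nonnegative
  because the pair sums are positive.\<close>

lemma jacobi_form_eigen:
  fixes l m n :: real and T :: "3 \<Rightarrow> 3 \<Rightarrow> 3 \<Rightarrow> real"
  defines "gl \<equiv> 1/(1+l\<^sup>2)" and "gm \<equiv> 1/(1+m\<^sup>2)" and "gn \<equiv> 1/(1+n\<^sup>2)"
  assumes p: "l + m > 0" "l + n > 0" "m + n > 0" and S: "l*m + l*n + m*n \<ge> 0"
    and tr: "\<And>c. gl*T 1 1 c + gm*T 2 2 c + gn*T 3 3 c = 0"
    and sym: "\<And>a b c. T a b c = T b a c" "\<And>a b c. T a b c = T a c b"
  shows "(4/3) * (gl*(T 1 1 1+T 2 2 1+T 3 3 1)\<^sup>2 + gm*(T 1 1 2+T 2 2 2+T 3 3 2)\<^sup>2 + gn*(T 1 1 3+T 2 2 3+T 3 3 3)\<^sup>2)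
    \<le> (l+m+n) * (\<Sum>c\<in>UNIV. 2 * (gl*gm*(l+m)*((T 1 2 c)\<^sup>2 - T 1 1 c * T 2 2 c)
        + gl*gn*(l+n)*((T 1 3 c)\<^sup>2 - T 1 1 c * T 3 3 c) + gm*gn*(m+n)*((T 2 3 c)\<^sup>2 - T 2 2 c * T 3 3 c)))"
proof -
  have nn: "gl > 0" "gm > 0" "gn > 0" by (simp_all add: gl_def gm_def gn_def add_pos_nonneg)
  \<comment> \<open>If x_1 + x_2 + x_3 = 0, the sum of (l_i + l_j) x_i x_j over pairs equals minus
    the sum of l_i x_i^2. This removes the mixed products.\<close>
  have split: "2 * (gl*gm*(l+m)*((T 1 2 c)\<^sup>2 - T 1 1 c * T 2 2 c)
        + gl*gn*(l+n)*((T 1 3 c)\<^sup>2 - T 1 1 c * T 3 3 c) + gm*gn*(m+n)*((T 2 3 c)\<^sup>2 - T 2 2 c * T 3 3 c))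
     = 2*(l*(gl*T 1 1 c)\<^sup>2 + m*(gm*T 2 2 c)\<^sup>2 + n*(gn*T 3 3 c)\<^sup>2)
       + 2*(gl*gm*(l+m)*(T 1 2 c)\<^sup>2 + gl*gn*(l+n)*(T 1 3 c)\<^sup>2 + gm*gn*(m+n)*(T 2 3 c)\<^sup>2)" for c
  proof -
    have x: "gl*T 1 1 c = -(gm*T 2 2 c) - gn*T 3 3 c" using tr[of c] by simp
    have "(l+m)*((gl*T 1 1 c)*(gm*T 2 2 c)) + (l+n)*((gl*T 1 1 c)*(gn*T 3 3 c)) + (m+n)*((gm*T 2 2 c)*(gn*T 3 3 c))
      + l*(gl*T 1 1 c)\<^sup>2 + m*(gm*T 2 2 c)\<^sup>2 + n*(gn*T 3 3 c)\<^sup>2 = 0"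
      unfolding x by (simp add: power2_eq_square algebra_simps)
    then show ?thesis by (simp add: algebra_simps)
  qed
  have 1: "(4/3) * gl * (T 1 1 1+T 2 2 1+T 3 3 1)\<^sup>2 \<le> (l+m+n) * (2*(l*(gl*T 1 1 1)\<^sup>2 + m*(gm*T 2 2 1)\<^sup>2 + n*(gn*T 3 3 1)\<^sup>2)
            + 2*(l+m)*gl*gm*(T 2 2 1)\<^sup>2 + 2*(l+n)*gl*gn*(T 3 3 1)\<^sup>2)"
    unfolding gl_def gm_def gn_def
    by (rule jacobi_form_trace_free) (use p S tr[of 1] in \<open>simp_all add: gl_def gm_def gn_def\<close>)
  have 2: "(4/3) * gm * (T 2 2 2+T 1 1 2+T 3 3 2)\<^sup>2 \<le> (m+l+n) * (2*(m*(gm*T 2 2 2)\<^sup>2 + l*(gl*T 1 1 2)\<^sup>2 + n*(gn*T 3 3 2)\<^sup>2)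
            + 2*(m+l)*gm*gl*(T 1 1 2)\<^sup>2 + 2*(m+n)*gm*gn*(T 3 3 2)\<^sup>2)"
    unfolding gl_def gm_def gn_def
    by (rule jacobi_form_trace_free) (use p S tr[of 2] in \<open>simp_all add: gl_def gm_def gn_def algebra_simps\<close>)
  have 3: "(4/3) * gn * (T 3 3 3+T 1 1 3+T 2 2 3)\<^sup>2 \<le> (n+l+m) * (2*(n*(gn*T 3 3 3)\<^sup>2 + l*(gl*T 1 1 3)\<^sup>2 + m*(gm*T 2 2 3)\<^sup>2)
            + 2*(n+l)*gn*gl*(T 1 1 3)\<^sup>2 + 2*(n+m)*gn*gm*(T 2 2 3)\<^sup>2)"
    unfolding gl_def gm_def gn_def
    by (rule jacobi_form_trace_free) (use p S tr[of 3] in \<open>simp_all add: gl_def gm_def gn_def algebra_simps\<close>)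
  have s: "T 1 2 1 = T 1 1 2" "T 1 3 1 = T 1 1 3" "T 1 2 2 = T 2 2 1" "T 2 3 2 = T 2 2 3"
     "T 1 3 3 = T 3 3 1" "T 2 3 3 = T 3 3 2" "T 1 3 2 = T 1 2 3" "T 2 3 1 = T 1 2 3"
    using sym by metis+
  have "0 \<le> gl*gm*(l+m) + gl*gn*(l+n) + gm*gn*(m+n)" using p nn by simp
  moreover have "0 \<le> l+m+n" using p by linarith
  ultimately have pos: "0 \<le> (l+m+n) * (2*(gl*gm*(l+m) + gl*gn*(l+n) + gm*gn*(m+n))*(T 1 2 3)\<^sup>2)"
    by simp
  have "(l+m+n) * (\<Sum>c\<in>UNIV. 2 * (gl*gm*(l+m)*((T 1 2 c)\<^sup>2 - T 1 1 c * T 2 2 c)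
        + gl*gn*(l+n)*((T 1 3 c)\<^sup>2 - T 1 1 c * T 3 3 c) + gm*gn*(m+n)*((T 2 3 c)\<^sup>2 - T 2 2 c * T 3 3 c)))
     = (l+m+n) * (2*(l*(gl*T 1 1 1)\<^sup>2 + m*(gm*T 2 2 1)\<^sup>2 + n*(gn*T 3 3 1)\<^sup>2)
            + 2*(l+m)*gl*gm*(T 2 2 1)\<^sup>2 + 2*(l+n)*gl*gn*(T 3 3 1)\<^sup>2)
      + (m+l+n) * (2*(m*(gm*T 2 2 2)\<^sup>2 + l*(gl*T 1 1 2)\<^sup>2 + n*(gn*T 3 3 2)\<^sup>2)
            + 2*(m+l)*gm*gl*(T 1 1 2)\<^sup>2 + 2*(m+n)*gm*gn*(T 3 3 2)\<^sup>2)
      + (n+l+m) * (2*(n*(gn*T 3 3 3)\<^sup>2 + l*(gl*T 1 1 3)\<^sup>2 + m*(gm*T 2 2 3)\<^sup>2)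
            + 2*(n+l)*gn*gl*(T 1 1 3)\<^sup>2 + 2*(n+m)*gn*gm*(T 2 2 3)\<^sup>2)
      + (l+m+n) * (2*(gl*gm*(l+m) + gl*gn*(l+n) + gm*gn*(m+n))*(T 1 2 3)\<^sup>2)"
    unfolding split sum_3 s by (simp add: algebra_simps)
  then show ?thesis using 1 2 3 pos by (simp add: algebra_simps)
qed

section \<open>Orthonormal frames and matrices diagonal in a frame\<close>

definition orthoframe :: "(3 \<Rightarrow> 3 \<Rightarrow> real) \<Rightarrow> bool" where
  "orthoframe E \<longleftrightarrow> (\<forall>a b. (\<Sum>i\<in>UNIV. E a i * E b i) = (if a = b then 1 else 0))"

definition coord :: "(3 \<Rightarrow> 3 \<Rightarrow> real) \<Rightarrow> (3 \<Rightarrow> real) \<Rightarrow> 3 \<Rightarrow> real" where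
  "coord E v a = (\<Sum>i\<in>UNIV. E a i * v i)"

lemma orthoframeD: "orthoframe E \<Longrightarrow> (\<Sum>i\<in>UNIV. E a i * E b i) = (if a = b then 1 else 0)"
  unfolding orthoframe_def by blast

text \<open>Orthonormal rows give orthonormal columns, since a right inverse of a square matrix is a
  left inverse.\<close>

lemma orthoframe_dual:
  assumes "orthoframe E"
  shows "(\<Sum>a\<in>UNIV. E a i * E a j) = (if i = j then 1 else 0)"
proof -
  define M :: "real^3^3" where "M = (\<chi> a i. E a i)"
  have "M ** transpose M = mat 1"
    using assms by (simp add: M_def matrix_matrix_mult_def transpose_def mat_def orthoframe_def vec_eq_iff)
  then have "transpose M ** M = mat 1" by (simp add: matrix_left_right_inverse)
  then have "(transpose M ** M) $ i $ j = (mat 1 :: real^3^3) $ i $ j" by simp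
  then show ?thesis by (simp add: M_def matrix_matrix_mult_def transpose_def mat_def)
qed

lemma parseval:
  assumes "orthoframe E"
  shows "(\<Sum>a\<in>UNIV. coord E v a * coord E w a) = (\<Sum>i\<in>UNIV. v i * w i)"
proof -
  have "(\<Sum>a\<in>UNIV. coord E v a * coord E w a) = (\<Sum>a\<in>UNIV. \<Sum>i\<in>UNIV. \<Sum>j\<in>UNIV. (E a i * v i) * (E a j * w j))"
    by (simp add: coord_def sum_product)
  also have "\<dots> = (\<Sum>i\<in>UNIV. \<Sum>a\<in>UNIV. \<Sum>j\<in>UNIV. (E a i * v i) * (E a j * w j))" by (rule sum.swap)
  also have "\<dots> = (\<Sum>i\<in>UNIV. \<Sum>j\<in>UNIV. \<Sum>a\<in>UNIV. (E a i * v i) * (E a j * w j))"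
    by (intro sum.cong refl sum.swap)
  also have "\<dots> = (\<Sum>i\<in>UNIV. \<Sum>j\<in>UNIV. v i * w j * (\<Sum>a\<in>UNIV. E a i * E a j))"
    by (simp add: sum_distrib_left ac_simps)
  also have "\<dots> = (\<Sum>i\<in>UNIV. v i * w i)" by (simp add: orthoframe_dual[OF assms] if_distrib cong: if_cong)
  finally show ?thesis .
qed

lemma coord_sum: "coord E (\<lambda>i. \<Sum>j\<in>A. f j i) a = (\<Sum>j\<in>A. coord E (f j) a)"
  by (simp add: coord_def sum_distrib_left sum.swap[of _ A])

lemma coord_mult: "coord E (\<lambda>i. c * f i) a = c * coord E f a"
  by (simp add: coord_def sum_distrib_left ac_simps)

lemma coord_add: "coord E (\<lambda>i. f i + g i) a = coord E f a + coord E g a"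
  by (simp add: coord_def sum.distrib algebra_simps)

text \<open>The symmetric matrix with eigenvectors \<open>E a\<close> and eigenvalues
  \<open>f a\<close>. For a fixed frame this is a functional calculus: sums and products of matrices
  become sums and products of \<open>f\<close>.\<close>

definition spectral :: "(3 \<Rightarrow> 3 \<Rightarrow> real) \<Rightarrow> (3 \<Rightarrow> real) \<Rightarrow> 3 \<Rightarrow> 3 \<Rightarrow> real" where
  "spectral E f i j = (\<Sum>a\<in>UNIV. f a * E a i * E a j)"

lemma spectral_apply: "(\<Sum>j\<in>UNIV. spectral E f i j * w j) = (\<Sum>a\<in>UNIV. f a * E a i * coord E w a)"
proof -
  have "(\<Sum>j\<in>UNIV. spectral E f i j * w j) = (\<Sum>j\<in>UNIV. \<Sum>a\<in>UNIV. f a * E a i * E a j * w j)"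
    by (simp add: spectral_def sum_distrib_right)
  also have "\<dots> = (\<Sum>a\<in>UNIV. \<Sum>j\<in>UNIV. f a * E a i * E a j * w j)" by (rule sum.swap)
  finally show ?thesis by (simp add: coord_def sum_distrib_left ac_simps)
qed

lemma spectral_quad: "(\<Sum>i\<in>UNIV. \<Sum>j\<in>UNIV. spectral E f i j * v i * w j) = (\<Sum>a\<in>UNIV. f a * coord E v a * coord E w a)"
proof -
  have "(\<Sum>i\<in>UNIV. \<Sum>j\<in>UNIV. spectral E f i j * v i * w j) = (\<Sum>i\<in>UNIV. v i * (\<Sum>j\<in>UNIV. spectral E f i j * w j))"
    by (simp add: sum_distrib_left ac_simps)
  also have "\<dots> = (\<Sum>i\<in>UNIV. \<Sum>a\<in>UNIV. v i * (f a * E a i * coord E w a))"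
    by (simp add: spectral_apply sum_distrib_left)
  also have "\<dots> = (\<Sum>a\<in>UNIV. \<Sum>i\<in>UNIV. v i * (f a * E a i * coord E w a))" by (rule sum.swap)
  also have "\<dots> = (\<Sum>a\<in>UNIV. f a * coord E v a * coord E w a)"
    by (subst (2) coord_def) (simp add: sum_distrib_left sum_distrib_right ac_simps)
  finally show ?thesis .
qed

lemma coord_spectral:
  assumes "orthoframe E"
  shows "coord E (\<lambda>i. \<Sum>j\<in>UNIV. spectral E f i j * w j) a = f a * coord E w a"
proof -
  have "coord E (\<lambda>i. \<Sum>j\<in>UNIV. spectral E f i j * w j) a
     = (\<Sum>i\<in>UNIV. \<Sum>b\<in>UNIV. E a i * (f b * E b i * coord E w b))"
    unfolding spectral_apply by (subst coord_def) (simp add: sum_distrib_left)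
  also have "\<dots> = (\<Sum>b\<in>UNIV. \<Sum>i\<in>UNIV. E a i * (f b * E b i * coord E w b))" by (rule sum.swap)
  also have "\<dots> = (\<Sum>b\<in>UNIV. f b * coord E w b * (\<Sum>i\<in>UNIV. E a i * E b i))"
    by (simp add: sum_distrib_left ac_simps)
  also have "\<dots> = f a * coord E w a"
    by (simp add: orthoframeD[OF assms] if_distrib cong: if_cong)
  finally show ?thesis .
qed

lemma spectral_trace:
  assumes "orthoframe E" shows "(\<Sum>i\<in>UNIV. spectral E f i i) = (\<Sum>a\<in>UNIV. f a)"
proof -
  have "(\<Sum>i\<in>UNIV. spectral E f i i) = (\<Sum>a\<in>UNIV. \<Sum>i\<in>UNIV. f a * E a i * E a i)"
    unfolding spectral_def by (rule sum.swap)
  also have "\<dots> = (\<Sum>a\<in>UNIV. f a * (\<Sum>i\<in>UNIV. E a i * E a i))"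
    by (simp add: sum_distrib_left ac_simps)
  finally show ?thesis using assms by (simp add: orthoframe_def)
qed

lemma spectral_mult:
  assumes "orthoframe E"
  shows "(\<Sum>k\<in>UNIV. spectral E f i k * spectral E g k j) = spectral E (\<lambda>a. f a * g a) i j"
proof -
  have "coord E (\<lambda>k. spectral E g k j) a = g a * E a j" for a
  proof -
    have "coord E (\<lambda>k. \<Sum>l\<in>UNIV. spectral E g k l * (if l = j then 1 else 0)) a
        = g a * coord E (\<lambda>l. if l = j then 1 else 0) a" by (rule coord_spectral[OF assms])
    then show ?thesis by (simp add: coord_def if_distrib cong: if_cong)
  qed
  then show ?thesis unfolding spectral_apply by (simp add: spectral_def ac_simps)
qed

lemma spectral_delta:
  assumes "orthoframe E" shows "spectral E (\<lambda>a. 1) i j = (if i = j then 1 else 0)"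
  by (simp add: spectral_def orthoframe_dual[OF assms])

lemma spectral_cmult: "spectral E (\<lambda>a. c * f a) i j = c * spectral E f i j"
  by (simp add: spectral_def sum_distrib_left ac_simps)

lemma spectral_add: "spectral E (\<lambda>a. f a + g a) i j = spectral E f i j + spectral E g i j"
  by (simp add: spectral_def sum.distrib algebra_simps)

section \<open>Special Lagrangian Hessians at a point\<close>

definition sq :: "(3 \<Rightarrow> 3 \<Rightarrow> real) \<Rightarrow> 3 \<Rightarrow> 3 \<Rightarrow> real" where
  "sq H i j = (\<Sum>k\<in>UNIV. H i k * H k j)"

definition sg1 :: "(3 \<Rightarrow> 3 \<Rightarrow> real) \<Rightarrow> real" where
  "sg1 H = (\<Sum>i\<in>UNIV. H i i)"

text \<open>Newton's identities: the elementary symmetric functions of the eigenvalues are written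
  through traces of powers of \<open>H\<close>. Traces are invariant under a change of frame and
  polynomial in the entries, so they can be both diagonalised and differentiated.\<close>

definition sg2 :: "(3 \<Rightarrow> 3 \<Rightarrow> real) \<Rightarrow> real" where
  "sg2 H = ((sg1 H)\<^sup>2 - (\<Sum>i\<in>UNIV. sq H i i)) / 2"

definition sg3 :: "(3 \<Rightarrow> 3 \<Rightarrow> real) \<Rightarrow> real" where
  "sg3 H = ((sg1 H)^3 - 3 * sg1 H * (\<Sum>i\<in>UNIV. sq H i i) + 2 * (\<Sum>i\<in>UNIV. \<Sum>k\<in>UNIV. sq H i k * H k i)) / 6"

abbreviation kd :: "3 \<Rightarrow> 3 \<Rightarrow> real" where
  "kd i j \<equiv> (if i = j then 1 else 0)"

definition vol :: "real \<Rightarrow> real \<Rightarrow> (3 \<Rightarrow> 3 \<Rightarrow> real) \<Rightarrow> real" where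
  "vol c s H = c * (1 - sg2 H) + s * (sg1 H - sg3 H)"

text \<open>On a special Lagrangian graph of phase \<open>\<Theta>\<close>, with \<open>c = cos \<Theta>\<close> and \<open>s = sin \<Theta>\<close>, the number
  \<^term>\<open>vol c s H\<close> is the volume density \<open>sqrt (det g)\<close> and \<open>lin c s H\<close> the matrix
  \<open>sqrt (det g) g\<^sup>-\<^sup>1\<close> for \<open>g = I + H\<^sup>2\<close>. In this polynomial form (the cofactor matrix being
  \<open>H\<^sup>2 - sg1 H + sg2\<close>) it is divergence free along Hessians.\<close>

definition lin :: "real \<Rightarrow> real \<Rightarrow> (3 \<Rightarrow> 3 \<Rightarrow> real) \<Rightarrow> 3 \<Rightarrow> 3 \<Rightarrow> real" where
  "lin c s H i j = (c * (1 - sg2 H) + s * sg1 H) * kd i j + (c * sg1 H - s) * H i j - c * sq H i j"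

text \<open>The first Newton transformation, which is the gradient of sigma_2. In an eigenframe each
  of its eigenvalues is the sum of the other two eigenvalues of \<open>H\<close>.\<close>

definition nw :: "(3 \<Rightarrow> 3 \<Rightarrow> real) \<Rightarrow> 3 \<Rightarrow> 3 \<Rightarrow> real" where
  "nw H i j = sg1 H * kd i j - H i j"

definition qf :: "(3 \<Rightarrow> 3 \<Rightarrow> real) \<Rightarrow> (3 \<Rightarrow> real) \<Rightarrow> (3 \<Rightarrow> real) \<Rightarrow> real" where
  "qf A v w = (\<Sum>i\<in>UNIV. \<Sum>j\<in>UNIV. A i j * v i * w j)"

definition app :: "(3 \<Rightarrow> 3 \<Rightarrow> real) \<Rightarrow> (3 \<Rightarrow> real) \<Rightarrow> 3 \<Rightarrow> real" where
  "app A w i = (\<Sum>j\<in>UNIV. A i j * w j)"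

text \<open>Minus the derivative of \<^const>\<open>lin\<close> in the direction \<open>B\<close>, contracted with \<open>B\<close>: the quadratic term
  produced by differentiating the equation twice.\<close>

definition curv :: "real \<Rightarrow> real \<Rightarrow> (3 \<Rightarrow> 3 \<Rightarrow> real) \<Rightarrow> (3 \<Rightarrow> 3 \<Rightarrow> real) \<Rightarrow> real" where
  "curv c s H B = c * (2 * (\<Sum>l\<in>UNIV. qf H (\<lambda>i. B i l) (\<lambda>i. B i l))
      - 2 * sg1 B * (\<Sum>i\<in>UNIV. \<Sum>j\<in>UNIV. H i j * B i j)
      + sg1 H * ((sg1 B)\<^sup>2 - (\<Sum>l\<in>UNIV. \<Sum>i\<in>UNIV. (B i l)\<^sup>2)))
      - s * ((sg1 B)\<^sup>2 - (\<Sum>l\<in>UNIV. \<Sum>i\<in>UNIV. (B i l)\<^sup>2))"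

lemma spectral_sg:
  assumes "orthoframe E" "H = spectral E l"
  shows "sq H = spectral E (\<lambda>a. (l a)\<^sup>2)" "sg1 H = l 1 + l 2 + l 3"
    "sg2 H = l 1 * l 2 + l 1 * l 3 + l 2 * l 3" "sg3 H = l 1 * l 2 * l 3"
    "(\<Sum>i\<in>UNIV. sq H i i) = (l 1)\<^sup>2 + (l 2)\<^sup>2 + (l 3)\<^sup>2"
proof -
  show 1: "sq H = spectral E (\<lambda>a. (l a)\<^sup>2)"
    by (intro ext) (simp add: sq_def assms(2) spectral_mult[OF assms(1)] power2_eq_square)
  show 2: "sg1 H = l 1 + l 2 + l 3"
    by (simp add: sg1_def assms(2) spectral_trace[OF assms(1)] sum_3)
  show 3: "(\<Sum>i\<in>UNIV. sq H i i) = (l 1)\<^sup>2 + (l 2)\<^sup>2 + (l 3)\<^sup>2"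
    unfolding 1 by (simp add: spectral_trace[OF assms(1)] sum_3)
  show "sg2 H = l 1 * l 2 + l 1 * l 3 + l 2 * l 3"
    unfolding sg2_def 2 3 by (simp add: power2_eq_square algebra_simps)
  have "(\<Sum>i\<in>UNIV. \<Sum>k\<in>UNIV. sq H i k * H k i) = (l 1)^3 + (l 2)^3 + (l 3)^3"
    unfolding 1 unfolding assms(2) spectral_mult[OF assms(1)] spectral_trace[OF assms(1)]
    by (simp add: sum_3 power2_eq_square power3_eq_cube)
  then show "sg3 H = l 1 * l 2 * l 3"
    unfolding sg3_def 2 3 by (simp add: power2_eq_square power3_eq_cube algebra_simps)
qed

lemma spectral_lin:
  assumes "orthoframe E" "H = spectral E l"
  shows "lin c s H = spectral E (\<lambda>a. c * (1 - sg2 H) + s * sg1 H + (c * sg1 H - s) * l a - c * (l a)\<^sup>2)"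
proof (intro ext)
  fix i j
  have "spectral E (\<lambda>a. (c * (1 - sg2 H) + s * sg1 H) * 1 + ((c * sg1 H - s) * l a + (- c) * (l a)\<^sup>2)) i j = lin c s H i j"
    unfolding spectral_add spectral_cmult spectral_delta[OF assms(1)] lin_def spectral_sg(1)[OF assms]
    by (simp add: assms(2))
  then show "lin c s H i j = spectral E (\<lambda>a. c * (1 - sg2 H) + s * sg1 H + (c * sg1 H - s) * l a - c * (l a)\<^sup>2) i j"
    by (simp add: algebra_simps)
qed

lemma spectral_nw:
  assumes "orthoframe E" "H = spectral E l"
  shows "nw H = spectral E (\<lambda>a. sg1 H - l a)"
proof (intro ext)
  fix i j
  have "spectral E (\<lambda>a. sg1 H * 1 + (-1) * l a) i j = nw H i j"
    unfolding spectral_add spectral_cmult spectral_delta[OF assms(1)] nw_def by (simp add: assms(2))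
  then show "nw H i j = spectral E (\<lambda>a. sg1 H - l a) i j" by simp
qed

lemma qf_spectral: "qf (spectral E f) v w = (\<Sum>a\<in>UNIV. f a * coord E v a * coord E w a)"
  unfolding qf_def by (rule spectral_quad)

lemma coord_app: "orthoframe E \<Longrightarrow> coord E (app (spectral E f) w) a = f a * coord E w a"
  using coord_spectral[of E f w a] by (simp add: app_def[abs_def])

lemma parseval_sq: "orthoframe E \<Longrightarrow> (\<Sum>i\<in>UNIV. (v i)\<^sup>2) = (\<Sum>a\<in>UNIV. (coord E v a)\<^sup>2)"
  using parseval[of E v v] by (simp add: power2_eq_square)

text \<open>The two identities are the real and imaginary parts of (1 + i l_1)(1 + i l_2)(1 + i l_3)
  = V (c + i s). The sign of \<open>c\<close> and the positive pair sums record that the phase is at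
  least pi / 2. Everything pointwise is derived from this algebraic form, without
  arctangents.\<close>

definition slag_point :: "real \<Rightarrow> real \<Rightarrow> (3 \<Rightarrow> 3 \<Rightarrow> real) \<Rightarrow> (3 \<Rightarrow> 3 \<Rightarrow> real) \<Rightarrow> (3 \<Rightarrow> real) \<Rightarrow> bool" where
  "slag_point c s H E l \<longleftrightarrow> orthoframe E \<and> H = spectral E l \<and> c \<le> 0 \<and> c\<^sup>2 + s\<^sup>2 = 1
     \<and> vol c s H > 0 \<and> 1 - sg2 H = vol c s H * c \<and> sg1 H - sg3 H = vol c s H * s
     \<and> l 1 + l 2 > 0 \<and> l 1 + l 3 > 0 \<and> l 2 + l 3 > 0"

text \<open>The angle addition formulas give the identities after division by the cosines. As pi/2
  \<le> \<Theta> < 3 pi/2, the cosine is nonpositive, so sigma_2 \<ge> 1. Then (l_1 + l_2)(l_1 +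
  l_3) = l_1^2 + sigma_2 > 0 and its analogues make all pair sums share one sign, and a negative
  sign would make 2 \<Theta> negative.\<close>

lemma slag_pointI:
  assumes E: "orthoframe E" and H: "H = spectral E l"
    and \<Theta>: "arctan (l 1) + arctan (l 2) + arctan (l 3) = \<Theta>" "\<Theta> \<ge> pi/2"
  shows "slag_point (cos \<Theta>) (sin \<Theta>) H E l"
proof -
  define C where "C a = cos (arctan (l a))" for a
  define V where "V = 1 / (C 1 * C 2 * C 3)"
  have Cp: "C a > 0" for a unfolding C_def using arctan_lbound arctan_ubound cos_gt_zero_pi by simp
  have Vp: "V > 0" using Cp by (simp add: V_def)
  have sn: "sin (arctan (l a)) = l a * C a" for a
    using Cp[of a] tan_arctan[of "l a"] by (simp add: C_def tan_def field_simps)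
  note sgs = spectral_sg[OF E H]
  have c: "cos \<Theta> = (1 - sg2 H) * (C 1 * C 2 * C 3)"
    unfolding \<Theta>(1)[symmetric] cos_add sin_add sn C_def[symmetric] sgs by (simp add: algebra_simps)
  have s: "sin \<Theta> = (sg1 H - sg3 H) * (C 1 * C 2 * C 3)"
    unfolding \<Theta>(1)[symmetric] cos_add sin_add sn C_def[symmetric] sgs by (simp add: algebra_simps)
  have e1: "1 - sg2 H = V * cos \<Theta>" and e2: "sg1 H - sg3 H = V * sin \<Theta>"
    using Cp[of 1] Cp[of 2] Cp[of 3] by (simp_all add: c s V_def)
  have vol: "vol (cos \<Theta>) (sin \<Theta>) H = V"
  proof -
    have "vol (cos \<Theta>) (sin \<Theta>) H = V * ((cos \<Theta>)\<^sup>2 + (sin \<Theta>)\<^sup>2)"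
      unfolding vol_def e1 e2 by algebra
    then show ?thesis by simp
  qed
  have "\<Theta> < 3*pi/2" using arctan_ubound[of "l 1"] arctan_ubound[of "l 2"] arctan_ubound[of "l 3"] \<Theta>(1) by linarith
  then have c0: "cos \<Theta> \<le> 0" using cos_ge_zero[of "\<Theta> - pi"] \<Theta>(2) by simp
  then have S: "sg2 H \<ge> 1" using e1 Vp by (metis diff_le_0_iff_le mult_nonneg_nonpos less_imp_le)
  have neg: "x + y < 0 \<Longrightarrow> arctan x + arctan y < 0" for x y
    using arctan_monotone[of x "- y"] by (simp add: arctan_minus)
  have pr: "(l 1 + l 2) * (l 1 + l 3) > 0" "(l 1 + l 2) * (l 2 + l 3) > 0"
  proof -
    have "(l 1 + l 2) * (l 1 + l 3) = (l 1)\<^sup>2 + sg2 H" "(l 1 + l 2) * (l 2 + l 3) = (l 2)\<^sup>2 + sg2 H"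
      by (simp_all add: sgs power2_eq_square algebra_simps)
    then show "(l 1 + l 2) * (l 1 + l 3) > 0" "(l 1 + l 2) * (l 2 + l 3) > 0"
      using S zero_le_power2[of "l 1"] zero_le_power2[of "l 2"] by linarith+
  qed
  have "l 1 + l 2 > 0"
  proof (rule ccontr)
    assume "\<not> l 1 + l 2 > 0"
    then have n: "l 1 + l 2 < 0" "l 1 + l 3 < 0" "l 2 + l 3 < 0" using pr
      by (auto simp: zero_less_mult_iff)
    then have "2 * \<Theta> < 0" using neg[OF n(1)] neg[OF n(2)] neg[OF n(3)] \<Theta>(1) by linarith
    then show False using \<Theta>(2) pi_gt_zero by linarith
  qed
  then have "l 1 + l 2 > 0" "l 1 + l 3 > 0" "l 2 + l 3 > 0" using pr by (auto simp: zero_less_mult_iff)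
  then show ?thesis unfolding slag_point_def vol using E H c0 Vp e1 e2 by simp
qed

context
  fixes c s H E l V
  assumes P: "slag_point c s H E l"
  defines "V \<equiv> vol c s H"
begin

lemma slag_E: "orthoframe E" and slag_H: "H = spectral E l" and slag_c: "c \<le> 0" "c\<^sup>2 + s\<^sup>2 = 1"
  and slag_V: "V > 0" "1 - sg2 H = V * c" "sg1 H - sg3 H = V * s"
  and slag_pairs: "l 1 + l 2 > 0" "l 1 + l 3 > 0" "l 2 + l 3 > 0"
  using P by (auto simp: slag_point_def V_def)

lemmas slag_sgs = spectral_sg[OF slag_E slag_H]

lemma slag_sg2: "sg2 H \<ge> 1"
  using slag_V slag_c by (metis diff_le_0_iff_le mult_nonneg_nonpos less_imp_le)

lemma slag_sg1: "sg1 H \<ge> 1"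
proof -
  have "(sg1 H)\<^sup>2 = (l 1)\<^sup>2 + (l 2)\<^sup>2 + (l 3)\<^sup>2 + 2 * sg2 H"
    by (simp add: slag_sgs power2_eq_square algebra_simps)
  then have "1\<^sup>2 \<le> (sg1 H)\<^sup>2" using slag_sg2 zero_le_power2[of "l 1"] zero_le_power2[of "l 2"] zero_le_power2[of "l 3"]
    unfolding one_power2 by linarith
  moreover have "sg1 H \<ge> 0" using slag_pairs by (simp add: slag_sgs)
  ultimately show ?thesis by (rule power2_le_imp_le)
qed

lemma slag_eq: "c * (sg1 H - sg3 H) = s * (1 - sg2 H)"
  using slag_V by simp

definition "mu a = c * (1 - sg2 H) + s * sg1 H + (c * sg1 H - s) * l a - c * (l a)\<^sup>2"

lemma lin_mu: "lin c s H = spectral E mu"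
  unfolding spectral_lin[OF slag_E slag_H] mu_def[abs_def] ..

lemma slag_V2: "V\<^sup>2 = (1 + (l 1)\<^sup>2) * (1 + (l 2)\<^sup>2) * (1 + (l 3)\<^sup>2)"
proof -
  have "V\<^sup>2 = (V * c)\<^sup>2 + (V * s)\<^sup>2" using slag_c(2) by (simp add: power_mult_distrib flip: distrib_left)
  then show ?thesis unfolding slag_V(2,3)[symmetric] slag_sgs by (simp add: power2_eq_square algebra_simps)
qed

text \<open>Multiplication by \<open>V\<close> replaces V c and V s by the polynomials 1 - sigma_2
  and sigma_1 - sigma_3, after which only an identity in the eigenvalues remains.\<close>

lemma mu_prod: "V * mu 1 = (1 + (l 2)\<^sup>2) * (1 + (l 3)\<^sup>2)" "V * mu 2 = (1 + (l 1)\<^sup>2) * (1 + (l 3)\<^sup>2)"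
  "V * mu 3 = (1 + (l 1)\<^sup>2) * (1 + (l 2)\<^sup>2)"
proof -
  have e: "V * mu a = (1 - sg2 H) * (V * c) + sg1 H * (V * s) + (V * c * sg1 H - V * s) * l a - (V * c) * (l a)\<^sup>2" for a
    by (simp add: mu_def algebra_simps)
  show "V * mu 1 = (1 + (l 2)\<^sup>2) * (1 + (l 3)\<^sup>2)" "V * mu 2 = (1 + (l 1)\<^sup>2) * (1 + (l 3)\<^sup>2)"
    "V * mu 3 = (1 + (l 1)\<^sup>2) * (1 + (l 2)\<^sup>2)"
    unfolding e slag_V(2,3)[symmetric] slag_sgs by (simp_all add: power2_eq_square algebra_simps)
qed

lemma mu_V: "mu a * (1 + (l a)\<^sup>2) = V"
proof -
  have "V * mu a * (1 + (l a)\<^sup>2) = V\<^sup>2"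
    using exhaust_3[of a] by (auto simp: mu_prod slag_V2)
  then have "V * (mu a * (1 + (l a)\<^sup>2)) = V * V" by (simp add: power2_eq_square)
  then show ?thesis using slag_V(1) by simp
qed

lemma mu_eq: "mu a = V * (1 / (1 + (l a)\<^sup>2))"
proof -
  have "1 + (l a)\<^sup>2 > 0" by (simp add: add_pos_nonneg)
  then show ?thesis using mu_V[of a] by (simp add: field_simps)
qed

lemma mu_pos: "mu a > 0"
  unfolding mu_eq using slag_V(1) by (simp add: add_pos_nonneg)

lemma mu_vol_ge_1: "1 \<le> V * mu a"
proof -
  have ge: "1 \<le> (1 + x\<^sup>2) * (1 + y\<^sup>2)" for x y :: real
    using mult_mono[of 1 "1 + x\<^sup>2" 1 "1+y\<^sup>2"] by simp
  show ?thesis using exhaust_3[of a] ge by (auto simp: mu_prod)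
qed

text \<open>The eigenvalue of \<open>nw\<close> is a sum x + y of two eigenvalues, and
  \<open>V * mu a\<close> is (1 + x^2)(1 + y^2); the difference to (x + y)^2 is (1 - x y)^2. With
  this bound \<open>qf_young\<close> applies to \<open>nw\<close> exactly as it does to the identity
  matrix.\<close>

lemma mu_vol_ge_nw: "(sg1 H - l a)\<^sup>2 \<le> V * mu a"
proof -
  have ge: "(x + y)\<^sup>2 \<le> (1 + x\<^sup>2) * (1 + y\<^sup>2)" for x y :: real
  proof -
    have "(1 + x\<^sup>2) * (1 + y\<^sup>2) - (x+y)\<^sup>2 = (1 - x*y)\<^sup>2" by (simp add: power2_eq_square algebra_simps)
    then show ?thesis by (metis diff_ge_0_iff_ge zero_le_power2)
  qed
  show ?thesis using exhaust_3[of a] ge by (auto simp: mu_prod slag_sgs)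
qed

text \<open>The hypothesis places the eigenvalues \<open>f a\<close> below the geometric mean of
  those of \<open>lin\<close> and the volume density, so a weighted Young inequality in each
  eigendirection suffices. It is the device that trades a Euclidean pairing for the energy of the
  graph metric plus volume.\<close>

lemma qf_young:
  assumes f: "\<And>a. (f a)\<^sup>2 \<le> V * mu a" and d: "d > 0"
  shows "qf (spectral E f) v w \<le> d * qf (lin c s H) v v + V / d * (\<Sum>i\<in>UNIV. (w i)\<^sup>2)"
proof -
  let ?x = "coord E v" and ?y = "coord E w"
  have "f a * ?x a * ?y a \<le> d * (mu a * (?x a)\<^sup>2) + V / d * (?y a)\<^sup>2" for a
  proof -
    have m: "mu a > 0" by (rule mu_pos)
    have "(f a)\<^sup>2 * (?y a)\<^sup>2 \<le> V * mu a * (?y a)\<^sup>2" by (intro mult_right_mono f) simp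
    then have le: "(f a)\<^sup>2 * (?y a)\<^sup>2 / (d * mu a) \<le> V / d * (?y a)\<^sup>2"
      using m d by (simp add: field_simps)
    have "0 \<le> (d * mu a * ?x a - f a * ?y a)\<^sup>2 / (d * mu a) + d * mu a * (?x a)\<^sup>2 + (f a * ?y a)\<^sup>2 / (d * mu a)"
      using m d by simp
    also have "\<dots> = 2 * (d * (mu a * (?x a)\<^sup>2) + (f a)\<^sup>2 * (?y a)\<^sup>2 / (d * mu a) - f a * ?x a * ?y a)"
      using m d by (simp add: field_simps power2_eq_square)
    finally show ?thesis using le by simp
  qed
  then have "(\<Sum>a\<in>UNIV. f a * ?x a * ?y a) \<le> (\<Sum>a\<in>UNIV. d * (mu a * (?x a)\<^sup>2) + V / d * (?y a)\<^sup>2)"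
    by (rule sum_mono)
  also have "\<dots> = d * (\<Sum>a\<in>UNIV. mu a * (?x a)\<^sup>2) + V / d * (\<Sum>a\<in>UNIV. (?y a)\<^sup>2)"
    by (simp add: sum.distrib sum_distrib_left)
  finally show ?thesis unfolding lin_mu qf_spectral parseval_sq[OF slag_E, of w]
    by (simp add: power2_eq_square mult.assoc)
qed

text \<open>Both \<open>sg1 H - l a\<close> and its distance to \<open>2 * sg1 H\<close> are sums of
  pair sums.\<close>

lemma nw_bounds: "0 < sg1 H - l a" "sg1 H - l a \<le> 2 * sg1 H"
  using exhaust_3[of a] slag_pairs by (auto simp: slag_sgs)

lemma inner_young:
  assumes "d > 0"
  shows "(\<Sum>i\<in>UNIV. v i * w i) \<le> d * qf (lin c s H) v v + V / d * (\<Sum>i\<in>UNIV. (w i)\<^sup>2)"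
proof -
  have "qf (spectral E (\<lambda>a. 1)) v w = (\<Sum>i\<in>UNIV. v i * w i)"
    using parseval[OF slag_E, of v w] by (simp add: qf_spectral)
  then show ?thesis using qf_young[of "\<lambda>a. 1" d v w] mu_vol_ge_1 assms by simp
qed

lemma nw_young:
  assumes "d > 0"
  shows "qf (nw H) v w \<le> d * qf (lin c s H) v v + V / d * (\<Sum>i\<in>UNIV. (w i)\<^sup>2)"
  unfolding spectral_nw[OF slag_E slag_H] by (rule qf_young[OF mu_vol_ge_nw assms])

text \<open>The factor 3 is made of two factors sqrt 3, comparing Euclidean norm and maximum norm in
  three-space.\<close>

lemma qf_entry_bound:
  assumes f: "\<And>a. 0 \<le> f a" "\<And>a. f a \<le> \<tau>" and v: "\<And>i. \<bar>v i\<bar> \<le> \<alpha>" and w: "\<And>i. \<bar>w i\<bar> \<le> \<beta>"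
  shows "\<bar>qf (spectral E f) v w\<bar> \<le> 3 * \<tau> * \<alpha> * \<beta>"
proof -
  have ab: "\<alpha> \<ge> 0" "\<beta> \<ge> 0" "\<tau> \<ge> 0" using v[of 1] w[of 1] f[of 1] by linarith+
  have sq: "sqrt (\<Sum>a\<in>UNIV. (coord E u a)\<^sup>2) \<le> sqrt 3 * \<gamma>" if "\<And>i. \<bar>u i\<bar> \<le> \<gamma>" "\<gamma> \<ge> 0" for u \<gamma>
  proof -
    have "(\<Sum>a\<in>UNIV. (coord E u a)\<^sup>2) = (\<Sum>i\<in>UNIV. (u i)\<^sup>2)" by (simp add: parseval_sq[OF slag_E, symmetric])
    also have "\<dots> \<le> (\<Sum>i\<in>(UNIV::3 set). \<gamma>\<^sup>2)"
      by (intro sum_mono) (metis that(1) abs_ge_zero power2_abs power_mono)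
    also have "\<dots> = 3 * \<gamma>\<^sup>2" by simp
    finally have "sqrt (\<Sum>a\<in>UNIV. (coord E u a)\<^sup>2) \<le> sqrt (3 * \<gamma>\<^sup>2)" by (rule real_sqrt_le_mono)
    then show ?thesis using that(2) by (simp add: real_sqrt_mult)
  qed
  have "\<bar>qf (spectral E f) v w\<bar> \<le> (\<Sum>a\<in>UNIV. \<bar>f a * coord E v a * coord E w a\<bar>)"
    unfolding qf_spectral by (rule sum_abs)
  also have "\<dots> \<le> (\<Sum>a\<in>UNIV. \<tau> * (\<bar>coord E v a\<bar> * \<bar>coord E w a\<bar>))"
    using f by (intro sum_mono) (simp add: abs_mult mult.assoc mult_right_mono)
  also have "\<dots> = \<tau> * (\<Sum>a\<in>UNIV. \<bar>coord E v a\<bar> * \<bar>coord E w a\<bar>)" by (simp add: sum_distrib_left)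
  also have "\<dots> \<le> \<tau> * (sqrt (\<Sum>a\<in>UNIV. (coord E v a)\<^sup>2) * sqrt (\<Sum>a\<in>UNIV. (coord E w a)\<^sup>2))"
    using L2_set_mult_ineq[of "coord E v" "coord E w" UNIV] ab by (intro mult_left_mono) (auto simp: L2_set_def)
  also have "\<dots> \<le> \<tau> * ((sqrt 3 * \<alpha>) * (sqrt 3 * \<beta>))"
    using ab by (intro mult_left_mono mult_mono sq v w) (auto intro!: sum_nonneg)
  also have "\<dots> = 3 * \<tau> * \<alpha> * \<beta>" by simp
  finally show ?thesis .
qed

lemma nw_entry_bound:
  assumes "\<And>i. \<bar>v i\<bar> \<le> \<alpha>" "\<And>i. \<bar>w i\<bar> \<le> \<beta>"
  shows "\<bar>qf (nw H) v w\<bar> \<le> 6 * sg1 H * \<alpha> * \<beta>"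
  unfolding spectral_nw[OF slag_E slag_H]
  using qf_entry_bound[of "\<lambda>a. sg1 H - l a" "2 * sg1 H", OF _ nw_bounds(2) assms] nw_bounds(1)
  by (simp add: less_imp_le)

lemma lin_trace: "(\<Sum>i\<in>UNIV. lin c s H i i) = mu 1 + mu 2 + mu 3"
  unfolding lin_mu by (simp add: spectral_trace[OF slag_E] sum_3)

lemma lin_trace_pos: "0 < (\<Sum>i\<in>UNIV. lin c s H i i)"
  unfolding lin_trace using mu_pos[of 1] mu_pos[of 2] mu_pos[of 3] by simp

text \<open>The trace equals 3 c - c sigma_2 + 2 s sigma_1: the cubic sigma_3 is absent, and |c|,
  |s| \<le> 1. This is why the trace, unlike the volume density, is accessible to integration by
  parts uniformly in the phase.\<close>

lemma lin_trace_le: "(\<Sum>i\<in>UNIV. lin c s H i i) \<le> sg2 H + 2 * sg1 H"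
proof -
  have "(\<Sum>i\<in>UNIV. lin c s H i i) = 3 * c - c * sg2 H + 2 * s * sg1 H"
    unfolding lin_trace mu_def slag_sgs by (simp add: power2_eq_square algebra_simps)
  moreover have "c * sg2 H \<ge> - 1 * sg2 H"
  proof (rule mult_right_mono)
    have "c\<^sup>2 \<le> 1\<^sup>2" using slag_c by (simp add: algebra_simps) (metis le_add_same_cancel1 zero_le_power2)
    then show "- 1 \<le> c" by (metis abs_le_square_iff abs_one abs_le_D2 minus_le_iff)
  qed (use slag_sg2 in simp)
  moreover have "s * sg1 H \<le> 1 * sg1 H"
  proof (rule mult_right_mono)
    have "s\<^sup>2 \<le> 1\<^sup>2" using slag_c(2) zero_le_power2[of c] unfolding one_power2 by linarith
    then show "s \<le> 1" by (rule power2_le_imp_le) simp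
  qed (use slag_sg1 in simp)
  ultimately show ?thesis using slag_c(1) by linarith
qed

lemma lin_entry_bound:
  assumes "\<And>i. \<bar>v i\<bar> \<le> \<alpha>" "\<And>i. \<bar>w i\<bar> \<le> \<beta>"
  shows "\<bar>qf (lin c s H) v w\<bar> \<le> 3 * (\<Sum>i\<in>UNIV. lin c s H i i) * \<alpha> * \<beta>"
  unfolding lin_trace unfolding lin_mu
proof (rule qf_entry_bound[OF _ _ assms])
  show "mu a \<le> mu 1 + mu 2 + mu 3" for a
    using exhaust_3[of a] mu_pos[of 1] mu_pos[of 2] mu_pos[of 3] by auto
qed (simp add: mu_pos less_imp_le)

lemma qf_lin_upper: "qf (lin c s H) v v \<le> (\<Sum>i\<in>UNIV. lin c s H i i) * (\<Sum>i\<in>UNIV. (v i)\<^sup>2)"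
proof -
  have "qf (lin c s H) v v = (\<Sum>a\<in>UNIV. mu a * (coord E v a)\<^sup>2)"
    by (simp add: lin_mu qf_spectral power2_eq_square ac_simps)
  also have "\<dots> \<le> (\<Sum>a\<in>UNIV. (mu 1 + mu 2 + mu 3) * (coord E v a)\<^sup>2)"
  proof (intro sum_mono mult_right_mono)
    show "mu a \<le> mu 1 + mu 2 + mu 3" for a
      using exhaust_3[of a] mu_pos[of 1] mu_pos[of 2] mu_pos[of 3] by auto
  qed simp
  finally show ?thesis by (simp add: lin_trace parseval_sq[OF slag_E, symmetric] flip: sum_distrib_left)
qed

text \<open>In an eigenframe the form has the weights mu_a l_a^2 = V - mu_a, each nonnegative and
  hence at most their sum.\<close>

lemma qf_lin_app_upper:
  "qf (lin c s H) (app H p) (app H p) \<le> (3 * V - (\<Sum>i\<in>UNIV. lin c s H i i)) * (\<Sum>i\<in>UNIV. (p i)\<^sup>2)"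
proof -
  have ml: "mu a * (l a)\<^sup>2 = V - mu a" for a using mu_V[of a] by (simp add: algebra_simps)
  have "coord E (app H p) a = l a * coord E p a" for a
    using coord_app[OF slag_E] by (simp add: slag_H)
  then have "qf (lin c s H) (app H p) (app H p) = (\<Sum>a\<in>UNIV. (mu a * (l a)\<^sup>2) * (coord E p a)\<^sup>2)"
    by (simp add: lin_mu qf_spectral power2_eq_square ac_simps)
  also have "\<dots> \<le> (\<Sum>a\<in>UNIV. (3 * V - (mu 1 + mu 2 + mu 3)) * (coord E p a)\<^sup>2)"
  proof (intro sum_mono mult_right_mono)
    have "mu a * (l a)\<^sup>2 \<ge> 0" for a using mu_pos[of a] by simp
    then have "V - mu a \<ge> 0" for a unfolding ml by blast
    from this[of 1] this[of 2] this[of 3] show "mu a * (l a)\<^sup>2 \<le> 3 * V - (mu 1 + mu 2 + mu 3)" for a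
      unfolding ml using exhaust_3[of a] by auto
  qed simp
  finally show ?thesis by (simp add: lin_trace parseval_sq[OF slag_E, symmetric] flip: sum_distrib_left)
qed

lemma lin_trace_le_vol: "(\<Sum>i\<in>UNIV. lin c s H i i) \<le> 3 * V"
proof -
  have "mu a \<le> V" for a
    using mu_V[of a] mult_left_mono[of 1 "1 + (l a)\<^sup>2" "mu a"] mu_pos[of a] by simp
  from this[of 1] this[of 2] this[of 3] show ?thesis unfolding lin_trace by linarith
qed

text \<open>Geometrically, projecting a vector of six-space to the tangent space of the graph does
  not lengthen it. In coordinates it is (v + l p)^2 \<le> (1 + l^2)(v^2 + p^2) together with mu_a (1
  + l_a^2) = V.\<close>

lemma qf_lin_graph: "qf (lin c s H) (\<lambda>i. v i + app H p i) (\<lambda>i. v i + app H p i) \<le> V * ((\<Sum>i\<in>UNIV. (v i)\<^sup>2) + (\<Sum>i\<in>UNIV. (p i)\<^sup>2))"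
proof -
  have co: "coord E (\<lambda>i. v i + app H p i) a = coord E v a + l a * coord E p a" for a
    using coord_app[OF slag_E] by (simp add: slag_H coord_add)
  have "qf (lin c s H) (\<lambda>i. v i + app H p i) (\<lambda>i. v i + app H p i)
      = (\<Sum>a\<in>UNIV. mu a * (coord E v a + l a * coord E p a)\<^sup>2)"
    by (simp add: lin_mu qf_spectral co power2_eq_square ac_simps)
  also have "\<dots> \<le> (\<Sum>a\<in>UNIV. V * ((coord E v a)\<^sup>2 + (coord E p a)\<^sup>2))"
  proof (rule sum_mono)
    fix a
    have "(coord E v a + l a * coord E p a)\<^sup>2 \<le> (1 + (l a)\<^sup>2) * ((coord E v a)\<^sup>2 + (coord E p a)\<^sup>2)"
      using cauchy4[of 1 "coord E v a" "l a" "coord E p a" 0 0 0 0] by simp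
    then have "mu a * (coord E v a + l a * coord E p a)\<^sup>2 \<le> mu a * ((1 + (l a)\<^sup>2) * ((coord E v a)\<^sup>2 + (coord E p a)\<^sup>2))"
      using mu_pos[of a] by (intro mult_left_mono) auto
    also have "\<dots> = V * ((coord E v a)\<^sup>2 + (coord E p a)\<^sup>2)" unfolding mult.assoc[symmetric] mu_V ..
    finally show "mu a * (coord E v a + l a * coord E p a)\<^sup>2 \<le> V * ((coord E v a)\<^sup>2 + (coord E p a)\<^sup>2)" .
  qed
  finally show ?thesis by (simp add: parseval_sq[OF slag_E, symmetric] sum.distrib distrib_left flip: sum_distrib_left)
qed

text \<open>After multiplication by \<open>V\<close> the left-hand sides factor, for example V (c
  l_1 - s) = - (l_2 + l_3)(1 + l_1^2). The pair sums are thus the weights of the second-order term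
  of the equation.\<close>

lemma curv_coeff: "c * l 1 - s = - V * (1/(1+(l 2)\<^sup>2)) * (1/(1+(l 3)\<^sup>2)) * (l 2 + l 3)"
  "c * l 2 - s = - V * (1/(1+(l 1)\<^sup>2)) * (1/(1+(l 3)\<^sup>2)) * (l 1 + l 3)"
  "c * l 3 - s = - V * (1/(1+(l 1)\<^sup>2)) * (1/(1+(l 2)\<^sup>2)) * (l 1 + l 2)"
proof -
  have p: "1 + (l a)\<^sup>2 > 0" for a by (simp add: add_pos_nonneg)
  have gen: "c * x - s = - V * (1/Y) * (1/Z) * w"
    if "V * c * x - V * s = - (w * X)" "V\<^sup>2 = X * Y * Z" "X > 0" "Y > 0" "Z > 0" for x w X Y Z
  proof -
    have "V * (c * x - s) = - w * X" using that(1) by (simp add: algebra_simps)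
    also have "\<dots> = - w * (V\<^sup>2 / (Y * Z))" using that by simp
    also have "\<dots> = V * (- V * (1/Y) * (1/Z) * w)" by (simp add: power2_eq_square)
    finally show ?thesis using slag_V(1) by (simp only: mult_cancel_left) simp
  qed
  show "c * l 1 - s = - V * (1/(1+(l 2)\<^sup>2)) * (1/(1+(l 3)\<^sup>2)) * (l 2 + l 3)"
    by (rule gen[where X = "1+(l 1)\<^sup>2"]) (use p slag_V2 in \<open>simp_all add: slag_V(2,3)[symmetric] slag_sgs power2_eq_square algebra_simps\<close>)
  show "c * l 2 - s = - V * (1/(1+(l 1)\<^sup>2)) * (1/(1+(l 3)\<^sup>2)) * (l 1 + l 3)"
    by (rule gen[where X = "1+(l 2)\<^sup>2"]) (use p slag_V2 in \<open>simp_all add: slag_V(2,3)[symmetric] slag_sgs power2_eq_square algebra_simps\<close>)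
  show "c * l 3 - s = - V * (1/(1+(l 1)\<^sup>2)) * (1/(1+(l 2)\<^sup>2)) * (l 1 + l 2)"
    by (rule gen[where X = "1+(l 3)\<^sup>2"]) (use p slag_V2 in \<open>simp_all add: slag_V(2,3)[symmetric] slag_sgs power2_eq_square algebra_simps\<close>)
qed

end

section \<open>The quadratic term and the Jacobi inequality at a point\<close>

definition coord2 :: "(3 \<Rightarrow> 3 \<Rightarrow> real) \<Rightarrow> (3 \<Rightarrow> 3 \<Rightarrow> real) \<Rightarrow> 3 \<Rightarrow> 3 \<Rightarrow> real" where
  "coord2 E B a b = coord E (\<lambda>j. coord E (\<lambda>i. B i j) a) b"

lemma spectral_contract:
  "(\<Sum>i\<in>UNIV. \<Sum>j\<in>UNIV. spectral E f i j * B i j) = (\<Sum>a\<in>UNIV. f a * coord2 E B a a)"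
proof -
  have "(\<Sum>i\<in>UNIV. \<Sum>j\<in>UNIV. spectral E f i j * B i j)
     = (\<Sum>i\<in>UNIV. \<Sum>j\<in>UNIV. \<Sum>a\<in>UNIV. f a * (E a j * (E a i * B i j)))"
    by (simp add: spectral_def sum_distrib_right sum_distrib_left ac_simps)
  also have "\<dots> = (\<Sum>j\<in>UNIV. \<Sum>i\<in>UNIV. \<Sum>a\<in>UNIV. f a * (E a j * (E a i * B i j)))" by (rule sum.swap)
  also have "\<dots> = (\<Sum>j\<in>UNIV. \<Sum>a\<in>UNIV. \<Sum>i\<in>UNIV. f a * (E a j * (E a i * B i j)))"
    by (intro sum.cong refl sum.swap)
  also have "\<dots> = (\<Sum>a\<in>UNIV. \<Sum>j\<in>UNIV. \<Sum>i\<in>UNIV. f a * (E a j * (E a i * B i j)))" by (rule sum.swap)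
  finally show ?thesis by (simp add: coord2_def coord_def sum_distrib_left)
qed

lemma coord2_trace:
  assumes "orthoframe E" shows "sg1 B = (\<Sum>a\<in>UNIV. coord2 E B a a)"
proof -
  have "sg1 B = (\<Sum>i\<in>UNIV. \<Sum>j\<in>UNIV. spectral E (\<lambda>a. 1) i j * B i j)"
    by (simp add: spectral_delta[OF assms] sg1_def if_distrib[of "\<lambda>x. x * _"] cong: if_cong)
  then show ?thesis by (simp add: spectral_contract)
qed

lemma coord2_sym:
  assumes "\<And>i j. B i j = B j i" shows "coord2 E B a b = coord2 E B b a"
proof -
  have "coord2 E B a b = (\<Sum>j\<in>UNIV. \<Sum>i\<in>UNIV. E b j * (E a i * B i j))"
    by (simp add: coord2_def coord_def sum_distrib_left)
  also have "\<dots> = (\<Sum>i\<in>UNIV. \<Sum>j\<in>UNIV. E b j * (E a i * B i j))" by (rule sum.swap)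
  also have "\<dots> = coord2 E B b a"
    by (simp add: coord2_def coord_def sum_distrib_left) (simp add: assms ac_simps)
  finally show ?thesis .
qed

text \<open>The second derivative of sigma_2 in direction \<open>B\<close> is twice the sum of the
  principal two by two minors of \<open>B\<close>; for sigma_3 each minor, taken in the eigenframe,
  is weighted by the remaining eigenvalue.\<close>

lemma curv_spectral:
  assumes E: "orthoframe E" and H: "H = spectral E l" and B: "\<And>i j. B i j = B j i"
  shows "curv c s H B = 2 * ((c * l 3 - s) * (coord2 E B 1 1 * coord2 E B 2 2 - coord2 E B 1 2 * coord2 E B 1 2)
     + (c * l 2 - s) * (coord2 E B 1 1 * coord2 E B 3 3 - coord2 E B 1 3 * coord2 E B 1 3)
     + (c * l 1 - s) * (coord2 E B 2 2 * coord2 E B 3 3 - coord2 E B 2 3 * coord2 E B 2 3))"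
proof -
  let ?B = "coord2 E B"
  have 1: "(\<Sum>m\<in>UNIV. \<Sum>i\<in>UNIV. (B i m)\<^sup>2) = (\<Sum>a\<in>UNIV. \<Sum>b\<in>UNIV. (?B a b)\<^sup>2)"
  proof -
    have "(\<Sum>m\<in>UNIV. \<Sum>i\<in>UNIV. (B i m)\<^sup>2) = (\<Sum>m\<in>UNIV. \<Sum>a\<in>UNIV. (coord E (\<lambda>i. B i m) a)\<^sup>2)"
      by (intro sum.cong refl parseval_sq[OF E])
    also have "\<dots> = (\<Sum>a\<in>UNIV. \<Sum>m\<in>UNIV. (coord E (\<lambda>i. B i m) a)\<^sup>2)" by (rule sum.swap)
    finally show ?thesis by (simp add: parseval_sq[OF E, symmetric] coord2_def)
  qed
  have 2: "(\<Sum>m\<in>UNIV. qf H (\<lambda>i. B i m) (\<lambda>i. B i m)) = (\<Sum>a\<in>UNIV. \<Sum>b\<in>UNIV. l a * (?B a b)\<^sup>2)"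
  proof -
    have "(\<Sum>m\<in>UNIV. qf H (\<lambda>i. B i m) (\<lambda>i. B i m)) = (\<Sum>m\<in>UNIV. \<Sum>a\<in>UNIV. l a * (coord E (\<lambda>i. B i m) a)\<^sup>2)"
      by (simp add: H qf_spectral power2_eq_square mult.assoc)
    also have "\<dots> = (\<Sum>a\<in>UNIV. \<Sum>m\<in>UNIV. l a * (coord E (\<lambda>i. B i m) a)\<^sup>2)" by (rule sum.swap)
    also have "\<dots> = (\<Sum>a\<in>UNIV. l a * (\<Sum>m\<in>UNIV. (coord E (\<lambda>i. B i m) a)\<^sup>2))" by (simp add: sum_distrib_left)
    finally show ?thesis by (simp add: parseval_sq[OF E, symmetric] coord2_def flip: sum_distrib_left)
  qed
  have 3: "(\<Sum>i\<in>UNIV. \<Sum>j\<in>UNIV. H i j * B i j) = (\<Sum>a\<in>UNIV. l a * ?B a a)"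
    unfolding H by (rule spectral_contract)
  have s: "?B 2 1 = ?B 1 2" "?B 3 1 = ?B 1 3" "?B 3 2 = ?B 2 3" by (rule coord2_sym, rule B)+
  show ?thesis
    unfolding curv_def 1 2 3 coord2_trace[OF E, of B] spectral_sg(2)[OF E H] unfolding sum_3 s
    by (simp add: power2_eq_square algebra_simps)
qed

text \<open>\<open>T\<close> stands for the third derivatives and \<open>eq\<close> for the equation
  differentiated once. All terms are invariant under rotation, so the three indices of
  \<open>T\<close> are rotated into the eigenframe of \<open>H\<close>, where the inequality is the
  one for eigenvalues, scaled by the volume density.\<close>

lemma jacobi_pointwise:
  assumes P: "slag_point c s H E l"
    and sym: "\<And>i j k. T i j k = T j i k" "\<And>i j k. T i j k = T i k j"
    and eq: "\<And>k. (\<Sum>i\<in>UNIV. \<Sum>j\<in>UNIV. lin c s H i j * T i j k) = 0"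
  shows "(4/3) * qf (lin c s H) (\<lambda>k. sg1 (\<lambda>i j. T i j k)) (\<lambda>k. sg1 (\<lambda>i j. T i j k))
    \<le> sg1 H * (\<Sum>k\<in>UNIV. curv c s H (\<lambda>i j. T i j k))"
proof -
  note E = slag_E[OF P] and H = slag_H[OF P]
  define V where "V = vol c s H"
  define U where "U a b c = coord E (\<lambda>k. coord2 E (\<lambda>i j. T i j k) a b) c" for a b c
  have Uex: "U a b c = (\<Sum>k\<in>UNIV. \<Sum>j\<in>UNIV. \<Sum>i\<in>UNIV. E c k * (E b j * (E a i * T i j k)))" for a b c
    by (simp add: U_def coord2_def coord_def sum_distrib_left)
  have U1: "U a b c = U b a c" for a b c
    unfolding U_def using coord2_sym[of "\<lambda>i j. T i j _" E a b] sym(1) by (metis (no_types, lifting))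
  have U2: "U a b c = U a c b" for a b c
  proof -
    have "U a b c = (\<Sum>j\<in>UNIV. \<Sum>k\<in>UNIV. \<Sum>i\<in>UNIV. E c k * (E b j * (E a i * T i j k)))"
      unfolding Uex by (rule sum.swap)
    also have "\<dots> = U a c b" unfolding Uex
      by (intro sum.cong refl) (metis sym(2) mult.left_commute)
    finally show ?thesis .
  qed
  have par: "(\<Sum>k\<in>UNIV. coord2 E (\<lambda>i j. T i j k) a b * coord2 E (\<lambda>i j. T i j k) a' b')
      = (\<Sum>c\<in>UNIV. U a b c * U a' b' c)" for a b a' b'
    unfolding U_def by (rule parseval[OF E, symmetric])
  define g where "g a = 1/(1+(l a)\<^sup>2)" for a
  have mu: "mu c s H l a = V * g a" for a using mu_eq[OF P] by (simp add: V_def g_def)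
  have V: "V > 0" using slag_V(1)[OF P] by (simp add: V_def)
  have tr: "g 1 * U 1 1 c' + g 2 * U 2 2 c' + g 3 * U 3 3 c' = 0" for c'
  proof -
    have z: "(\<Sum>a\<in>UNIV. mu c s H l a * coord2 E (\<lambda>i j. T i j k) a a) = 0" for k
      using eq[of k] unfolding lin_mu[OF P] spectral_contract .
    have "(\<Sum>a\<in>UNIV. mu c s H l a * U a a c') = coord E (\<lambda>k. \<Sum>a\<in>UNIV. mu c s H l a * coord2 E (\<lambda>i j. T i j k) a a) c'"
      by (simp add: coord_sum coord_mult U_def)
    also have "\<dots> = 0" unfolding z by (simp add: coord_def)
    finally have "V * (g 1 * U 1 1 c' + g 2 * U 2 2 c' + g 3 * U 3 3 c') = 0"
      by (simp add: mu sum_3 algebra_simps)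
    then show ?thesis using V by simp
  qed
  have t: "coord E (\<lambda>k. sg1 (\<lambda>i j. T i j k)) c' = U 1 1 c' + U 2 2 c' + U 3 3 c'" for c'
    by (simp add: coord2_trace[OF E] coord_sum U_def sum_3 coord_add)
  have lhs: "qf (lin c s H) (\<lambda>k. sg1 (\<lambda>i j. T i j k)) (\<lambda>k. sg1 (\<lambda>i j. T i j k))
     = V * (g 1*(U 1 1 1+U 2 2 1+U 3 3 1)\<^sup>2 + g 2*(U 1 1 2+U 2 2 2+U 3 3 2)\<^sup>2 + g 3*(U 1 1 3+U 2 2 3+U 3 3 3)\<^sup>2)"
    unfolding lin_mu[OF P] qf_spectral t mu sum_3 by (simp add: power2_eq_square algebra_simps)
  have rhs: "(\<Sum>k\<in>UNIV. curv c s H (\<lambda>i j. T i j k)) = V * (\<Sum>c\<in>UNIV. 2 * (g 1*g 2*(l 1+l 2)*((U 1 2 c)\<^sup>2 - U 1 1 c * U 2 2 c)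
        + g 1*g 3*(l 1+l 3)*((U 1 3 c)\<^sup>2 - U 1 1 c * U 3 3 c) + g 2*g 3*(l 2+l 3)*((U 2 3 c)\<^sup>2 - U 2 2 c * U 3 3 c)))"
  proof -
    let ?B = "\<lambda>k. coord2 E (\<lambda>i j. T i j k)"
    have cc: "c * l 1 - s = - V * g 2 * g 3 * (l 2 + l 3)" "c * l 2 - s = - V * g 1 * g 3 * (l 1 + l 3)"
      "c * l 3 - s = - V * g 1 * g 2 * (l 1 + l 2)"
      using curv_coeff[OF P] by (simp_all add: V_def g_def)
    have "(\<Sum>k\<in>UNIV. curv c s H (\<lambda>i j. T i j k)) = (\<Sum>k\<in>UNIV. 2 * ((c * l 3 - s) * (?B k 1 1 * ?B k 2 2 - ?B k 1 2 * ?B k 1 2)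
     + (c * l 2 - s) * (?B k 1 1 * ?B k 3 3 - ?B k 1 3 * ?B k 1 3)
     + (c * l 1 - s) * (?B k 2 2 * ?B k 3 3 - ?B k 2 3 * ?B k 2 3)))"
      by (intro sum.cong refl curv_spectral[OF E H] sym(1))
    also have "\<dots> = 2 * ((c * l 3 - s) * ((\<Sum>k\<in>UNIV. ?B k 1 1 * ?B k 2 2) - (\<Sum>k\<in>UNIV. ?B k 1 2 * ?B k 1 2))
     + (c * l 2 - s) * ((\<Sum>k\<in>UNIV. ?B k 1 1 * ?B k 3 3) - (\<Sum>k\<in>UNIV. ?B k 1 3 * ?B k 1 3))
     + (c * l 1 - s) * ((\<Sum>k\<in>UNIV. ?B k 2 2 * ?B k 3 3) - (\<Sum>k\<in>UNIV. ?B k 2 3 * ?B k 2 3)))"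
      unfolding sum_3 by (simp add: algebra_simps)
    also have "\<dots> = V * (\<Sum>c\<in>UNIV. 2 * (g 1*g 2*(l 1+l 2)*((U 1 2 c)\<^sup>2 - U 1 1 c * U 2 2 c)
        + g 1*g 3*(l 1+l 3)*((U 1 3 c)\<^sup>2 - U 1 1 c * U 3 3 c) + g 2*g 3*(l 2+l 3)*((U 2 3 c)\<^sup>2 - U 2 2 c * U 3 3 c)))"
      unfolding par cc unfolding sum_3 by (simp add: power2_eq_square algebra_simps)
    finally show ?thesis .
  qed
  have S: "l 1 * l 2 + l 1 * l 3 + l 2 * l 3 \<ge> 0"
    using slag_sg2[OF P] by (simp add: spectral_sg[OF E H])
  have "(4/3) * (g 1*(U 1 1 1+U 2 2 1+U 3 3 1)\<^sup>2 + g 2*(U 1 1 2+U 2 2 2+U 3 3 2)\<^sup>2 + g 3*(U 1 1 3+U 2 2 3+U 3 3 3)\<^sup>2)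
    \<le> (l 1+l 2+l 3) * (\<Sum>c\<in>UNIV. 2 * (g 1*g 2*(l 1+l 2)*((U 1 2 c)\<^sup>2 - U 1 1 c * U 2 2 c)
        + g 1*g 3*(l 1+l 3)*((U 1 3 c)\<^sup>2 - U 1 1 c * U 3 3 c) + g 2*g 3*(l 2+l 3)*((U 2 3 c)\<^sup>2 - U 2 2 c * U 3 3 c)))"
    using jacobi_form_eigen[OF slag_pairs[OF P] S tr[unfolded g_def] U1 U2] unfolding g_def .
  from mult_left_mono[OF this, of V] show ?thesis
    unfolding lhs rhs spectral_sg(2)[OF E H] using V by (simp add: mult.left_commute)
qed

section \<open>Diagonalisation of symmetric three by three matrices\<close>

text \<open>A maximiser \<open>x\<close> of the Rayleigh quotient on the unit sphere of
  \<open>W\<close> is an eigenvector: moving it along the residual \<open>r\<close>, the part of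
  \<open>A *v x\<close> orthogonal to \<open>x\<close>, would increase the quotient to first order
  unless the residual vanishes.\<close>

lemma symmetric_eigenvector_in_subspace:
  fixes A :: "real^'n^'n"
  assumes A: "transpose A = A" and W: "subspace W" "\<And>x. x \<in> W \<Longrightarrow> A *v x \<in> W" "\<exists>x\<in>W. x \<noteq> 0"
  obtains x m where "x \<in> W" "norm x = 1" "A *v x = m *\<^sub>R x"
proof -
  have adj: "(A *v x) \<bullet> y = x \<bullet> (A *v y)" for x y
    using dot_lmul_matrix[of x A y] transpose_matrix_vector[of A x] A by simp
  define K where "K = sphere 0 1 \<inter> W"
  have "compact K" unfolding K_def by (intro compact_Int_closed closed_subspace W) auto
  moreover have "K \<noteq> {}"
  proof -
    obtain x where x: "x \<in> W" "x \<noteq> 0" using W by blast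
    then have "(1 / norm x) *\<^sub>R x \<in> K" using W(1) by (auto simp: K_def subspace_scale)
    then show ?thesis by blast
  qed
  moreover have "continuous_on K (\<lambda>x. x \<bullet> (A *v x))"
    by (intro continuous_intros matrix_vector_mult_linear_continuous_on)
  ultimately obtain x where x: "x \<in> K" "\<And>y. y \<in> K \<Longrightarrow> y \<bullet> (A *v y) \<le> x \<bullet> (A *v x)"
    using continuous_attains_sup by metis
  define m where "m = x \<bullet> (A *v x)"
  have xW: "x \<in> W" and nx: "norm x = 1" using x by (auto simp: K_def)
  have xx: "x \<bullet> x = 1" using nx by (simp add: norm_eq_1)
  have le: "z \<bullet> (A *v z) \<le> m * (z \<bullet> z)" if "z \<in> W" for z
  proof (cases "z = 0")
    case False
    let ?y = "(1 / norm z) *\<^sub>R z"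
    have "?y \<in> K" using that False W(1) by (auto simp: K_def subspace_scale)
    then have "?y \<bullet> (A *v ?y) \<le> m" using x unfolding m_def by blast
    then have "(z \<bullet> (A *v z)) / (norm z * norm z) \<le> m"
      by (simp add: matrix_vector_mult_scaleR)
    then show ?thesis using False by (simp add: divide_le_eq dot_square_norm power2_eq_square)
  qed simp
  define r where "r = A *v x - m *\<^sub>R x"
  have rW: "r \<in> W" unfolding r_def using W xW by (simp add: subspace_diff subspace_scale)
  have xr: "x \<bullet> r = 0" by (simp add: r_def inner_diff_right xx m_def)
  have rAx: "r \<bullet> (A *v x) = r \<bullet> r"
  proof -
    have "A *v x = r + m *\<^sub>R x" by (simp add: r_def)
    then show ?thesis using xr by (simp add: inner_add_right inner_commute)
  qed
  define q where "q = r \<bullet> (A *v r) - m * (r \<bullet> r)"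
  have key: "2 * t * (r \<bullet> r) + t\<^sup>2 * q \<le> 0" for t
  proof -
    have "x + t *\<^sub>R r \<in> W" using W xW rW by (simp add: subspace_add subspace_scale)
    from le[OF this] have k1: "(x + t *\<^sub>R r) \<bullet> (A *v x + t *\<^sub>R (A *v r)) \<le> m * ((x + t *\<^sub>R r) \<bullet> (x + t *\<^sub>R r))"
      by (simp add: matrix_vector_right_distrib matrix_vector_mult_scaleR)
    have k2: "(x + t *\<^sub>R r) \<bullet> (A *v x + t *\<^sub>R (A *v r)) = m + 2 * t * (r \<bullet> r) + t\<^sup>2 * (r \<bullet> (A *v r))"
    proof -
      have "x \<bullet> (A *v r) = r \<bullet> r" using adj[of x r] rAx by (simp add: inner_commute)
      then show ?thesis using rAx
        by (simp add: inner_add_left inner_add_right m_def[symmetric] power2_eq_square algebra_simps)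
    qed
    have k3: "(x + t *\<^sub>R r) \<bullet> (x + t *\<^sub>R r) = 1 + t\<^sup>2 * (r \<bullet> r)"
      using xr xx by (simp add: inner_add_left inner_add_right inner_commute power2_eq_square)
    show ?thesis using k1[unfolded k2 k3] unfolding q_def by (simp add: algebra_simps)
  qed
  have q0: "q \<le> 0" using le[OF rW] by (simp add: q_def)
  have "r \<bullet> r = 0"
  proof (rule ccontr)
    assume "r \<bullet> r \<noteq> 0"
    then have rp: "r \<bullet> r > 0" by simp
    \<comment> \<open>This step size gives t q = t - |r|^2, so 2 |r|^2 + t q = |r|^2 + t is
      positive, against \<open>key\<close>.\<close>
    define t where "t = (r \<bullet> r) / (1 - q)"
    have t: "t > 0" "t * (1 - q) = r \<bullet> r" using rp q0 by (simp_all add: t_def)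
    have "t * (2 * (r \<bullet> r) + t * q) \<le> 0" using key[of t] by (simp add: power2_eq_square algebra_simps)
    then have "2 * (r \<bullet> r) + t * q \<le> 0" using t(1) by (simp add: mult_le_0_iff)
    then show False using t rp by (simp add: algebra_simps)
  qed
  then have "A *v x = m *\<^sub>R x" by (simp add: r_def)
  with xW nx show ?thesis by (rule that)
qed

lemma symmetric_orthonormal_eigenvectors:
  fixes A :: "real^3^3"
  assumes A: "transpose A = A"
  obtains e :: "3 \<Rightarrow> real^3" and l where "\<And>a b. e a \<bullet> e b = (if a = b then 1 else 0)" "\<And>a. A *v e a = l a *\<^sub>R e a"
proof -
  have adj: "(A *v x) \<bullet> y = x \<bullet> (A *v y)" for x y
    using dot_lmul_matrix[of x A y] transpose_matrix_vector[of A x] A by simp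
  \<comment> \<open>The orthogonal complement of a set of eigenvectors is invariant under a
    symmetric matrix, and it is nonzero while fewer than three are chosen.\<close>
  have ex: "\<exists>x m. norm x = 1 \<and> A *v x = m *\<^sub>R x \<and> (\<forall>y\<in>F. x \<bullet> y = 0)"
    if F: "finite F" "card F < 3" "\<And>y. y \<in> F \<Longrightarrow> \<exists>m. A *v y = m *\<^sub>R y" for F :: "(real^3) set"
  proof -
    define W where "W = {x. \<forall>y\<in>F. x \<bullet> y = 0}"
    have "subspace W" by (auto simp: W_def subspace_def inner_add_left)
    moreover have "A *v x \<in> W" if "x \<in> W" for x
      using that F(3) adj by (fastforce simp: W_def)
    moreover have "\<exists>x\<in>W. x \<noteq> 0"
    proof -
      have "dim F < DIM(real^3)" using dim_le_card'[OF F(1)] F(2) by simp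
      then obtain x where "x \<noteq> 0" "\<And>y. y \<in> span F \<Longrightarrow> orthogonal x y"
        using orthogonal_to_subspace_exists by blast
      then have "x \<in> W" by (simp add: W_def orthogonal_def span_base)
      with \<open>x \<noteq> 0\<close> show ?thesis by blast
    qed
    ultimately show ?thesis
      by (rule symmetric_eigenvector_in_subspace[OF A]) (auto simp: W_def)
  qed
  obtain e1 l1 where e1: "norm e1 = 1" "A *v e1 = l1 *\<^sub>R e1"
    using ex[of "{}"] by auto
  obtain e2 l2 where e2: "norm e2 = 1" "A *v e2 = l2 *\<^sub>R e2" "e2 \<bullet> e1 = 0"
    using ex[of "{e1}"] e1 by auto
  have c2: "card {e1, e2} < 3" using card_insert_le_m1[of 2 "{e2}" e1] by simp
  obtain e3 l3 where e3: "norm e3 = 1" "A *v e3 = l3 *\<^sub>R e3" "e3 \<bullet> e1 = 0" "e3 \<bullet> e2 = 0"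
    using ex[OF _ c2] e1 e2 by auto
  define e where "e a = (if a = 1 then e1 else if a = 2 then e2 else e3)" for a :: 3
  define l where "l a = (if a = 1 then l1 else if a = 2 then l2 else l3)" for a :: 3
  show ?thesis
  proof (rule that)
    have "(1::3) \<noteq> 2" "(1::3) \<noteq> 3" "(2::3) \<noteq> 3" by simp_all
    then show "e a \<bullet> e b = (if a = b then 1 else 0)" for a b
      using exhaust_3[of a] exhaust_3[of b] e1 e2 e3
      by (auto simp: e_def norm_eq_1 inner_commute)
    show "A *v e a = l a *\<^sub>R e a" for a using e1 e2 e3 by (simp add: e_def l_def)
  qed
qed

lemma charpoly_3:
  fixes A :: "real^3^3"
  assumes "transpose A = A"
  defines "H \<equiv> \<lambda>i j. A $ i $ j"
  shows "charpoly A = [: - sg3 H, sg2 H, - sg1 H, 1:]"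
proof -
  have s: "A $ 2 $ 1 = A $ 1 $ 2" "A $ 3 $ 1 = A $ 1 $ 3" "A $ 3 $ 2 = A $ 2 $ 3"
    using assms(1) by (simp_all add: transpose_def vec_eq_iff)
  have e1: "sg1 H = A $ 1 $ 1 + A $ 2 $ 2 + A $ 3 $ 3" by (simp add: sg1_def H_def sum_3)
  have e2: "sg2 H = A $ 1 $ 1 * A $ 2 $ 2 + A $ 1 $ 1 * A $ 3 $ 3 + A $ 2 $ 2 * A $ 3 $ 3
      - (A $ 1 $ 2)\<^sup>2 - (A $ 1 $ 3)\<^sup>2 - (A $ 2 $ 3)\<^sup>2"
    unfolding sg2_def e1 by (simp add: sq_def H_def sum_3 s power2_eq_square field_simps)
  have e3: "sg3 H = A $ 1 $ 1 * A $ 2 $ 2 * A $ 3 $ 3 + 2 * A $ 1 $ 2 * A $ 1 $ 3 * A $ 2 $ 3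
      - A $ 1 $ 1 * (A $ 2 $ 3)\<^sup>2 - A $ 2 $ 2 * (A $ 1 $ 3)\<^sup>2 - A $ 3 $ 3 * (A $ 1 $ 2)\<^sup>2"
    unfolding sg3_def e1 by (simp add: sq_def H_def sum_3 s power2_eq_square power3_eq_cube field_simps)
  show ?thesis unfolding e1 e2 e3 charpoly_def det_3
    by (simp add: s power2_eq_square algebra_simps)
qed

text \<open>This links the multiset of roots of the characteristic polynomial, in which the equation
  is stated, with eigenvalues labelled by a frame. In the eigenframe the coefficients of the
  polynomial are those of the product of the linear factors.\<close>

lemma symmetric_spectral:
  fixes A :: "real^3^3"
  assumes A: "transpose A = A"
  obtains E l where "orthoframe E" "(\<lambda>i j. A $ i $ j) = spectral E l" "eigenvalues A = {#l 1, l 2, l 3#}"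
proof -
  obtain e :: "3 \<Rightarrow> real^3" and l where e: "\<And>a b. e a \<bullet> e b = (if a = b then 1 else 0)"
    and l: "\<And>a. A *v e a = l a *\<^sub>R e a" using symmetric_orthonormal_eigenvectors[OF A] by blast
  define E where "E a i = e a $ i" for a i
  have E: "orthoframe E" unfolding orthoframe_def using e by (simp add: E_def inner_vec_def)
  have H: "(\<lambda>i j. A $ i $ j) = spectral E l"
  proof (intro ext)
    fix i j
    have "A $ i $ j = (\<Sum>k\<in>UNIV. A $ i $ k * (\<Sum>a\<in>UNIV. E a k * E a j))"
      by (simp add: orthoframe_dual[OF E] if_distrib cong: if_cong)
    also have "\<dots> = (\<Sum>k\<in>UNIV. \<Sum>a\<in>UNIV. A $ i $ k * E a k * E a j)" by (simp add: sum_distrib_left mult.assoc)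
    also have "\<dots> = (\<Sum>a\<in>UNIV. \<Sum>k\<in>UNIV. A $ i $ k * E a k * E a j)" by (rule sum.swap)
    also have "\<dots> = (\<Sum>a\<in>UNIV. (A *v e a) $ i * E a j)"
      by (simp add: matrix_vector_mult_def E_def sum_distrib_right)
    also have "\<dots> = spectral E l i j" by (simp add: l spectral_def E_def)
    finally show "A $ i $ j = spectral E l i j" .
  qed
  have "charpoly A = [:- l 1, 1:] * ([:- l 2, 1:] * [:- l 3, 1:])"
    unfolding charpoly_3[OF A] spectral_sg[OF E H] by (simp add: algebra_simps)
  then have "eigenvalues A = {#l 1#} + ({#l 2#} + {#l 3#})"
    unfolding eigenvalues_def by (simp add: proots_mult del: mult_pCons_left mult_pCons_right)
  then show ?thesis using that[OF E H] by (simp add: add_mset_commute)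
qed

section \<open>The linearised operator and the Jacobi inequality for the logarithm of the Laplacian\<close>

lemma differentiable_sum_real:
  fixes f :: "'i \<Rightarrow> 'a::real_normed_vector \<Rightarrow> real"
  assumes "finite I" "\<And>j. j \<in> I \<Longrightarrow> f j differentiable at x"
  shows "(\<lambda>x. \<Sum>j\<in>I. f j x) differentiable at x"
  using assms by (intro differentiable_sum) auto

lemmas D_rules = D_add D_diff D_mult D_sum
lemmas diff_rules = differentiable_add differentiable_diff differentiable_mult differentiable_sum_real differentiable_const

text \<open>The derivative of \<open>lin c s\<close> at \<open>H\<close> in the direction
  \<open>B\<close>, with the product rule written out.\<close>

definition dlin :: "real \<Rightarrow> real \<Rightarrow> (3 \<Rightarrow> 3 \<Rightarrow> real) \<Rightarrow> (3 \<Rightarrow> 3 \<Rightarrow> real) \<Rightarrow> 3 \<Rightarrow> 3 \<Rightarrow> real" where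
  "dlin c s H B i j = (c * ((\<Sum>p\<in>UNIV. \<Sum>q\<in>UNIV. H p q * B q p) - sg1 H * sg1 B) + s * sg1 B) * kd i j
     + c * sg1 B * H i j + (c * sg1 H - s) * B i j - c * (\<Sum>l\<in>UNIV. B i l * H l j + H i l * B l j)"

lemma curv_dlin:
  assumes "\<And>i j. H i j = H j i" "\<And>i j. B i j = B j i"
  shows "curv c s H B = - (\<Sum>i\<in>UNIV. \<Sum>j\<in>UNIV. dlin c s H B i j * B i j)"
proof -
  have s: "H 2 1 = H 1 2" "H 3 1 = H 1 3" "H 3 2 = H 2 3" "B 2 1 = B 1 2" "B 3 1 = B 1 3" "B 3 2 = B 2 3"
    by (rule assms)+
  show ?thesis unfolding curv_def dlin_def sg1_def qf_def sum_3 s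
    by (simp add: power2_eq_square algebra_simps)
qed

text \<open>Only the total symmetry of \<open>T\<close> enters: all terms cancel in pairs once
  permuted indices are identified. This is the algebra behind the divergence form of the
  operator.\<close>

lemma dlin_divergence:
  assumes "\<And>i j. H i j = H j i" "\<And>i j k. T i j k = T j i k" "\<And>i j k. T i j k = T i k j"
  shows "(\<Sum>i\<in>UNIV. dlin c s H (\<lambda>p q. T p q i) i j) = 0"
proof -
  have s: "H 2 1 = H 1 2" "H 3 1 = H 1 3" "H 3 2 = H 2 3" by (rule assms)+
  have t: "T 1 2 1 = T 1 1 2" "T 2 1 1 = T 1 1 2" "T 1 3 1 = T 1 1 3" "T 3 1 1 = T 1 1 3"
     "T 2 1 2 = T 1 2 2" "T 2 2 1 = T 1 2 2" "T 1 3 2 = T 1 2 3" "T 2 1 3 = T 1 2 3" "T 2 3 1 = T 1 2 3"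
     "T 3 1 2 = T 1 2 3" "T 3 2 1 = T 1 2 3" "T 3 1 3 = T 1 3 3" "T 3 3 1 = T 1 3 3"
     "T 2 3 2 = T 2 2 3" "T 3 2 2 = T 2 2 3" "T 3 2 3 = T 2 3 3" "T 3 3 2 = T 2 3 3"
    using assms(2,3) by metis+
  show ?thesis using exhaust_3[of j] unfolding dlin_def sg1_def sum_3 s t
    by (elim disjE) (simp_all add: s t algebra_simps)
qed

section \<open>The normalised problem on the ball of radius 8\<close>

text \<open>Each integral bound passes to a cutoff whose support is larger by one; the supports used
  have radii 2 to 7, and 8 keeps the last of them inside an open domain.\<close>

abbreviation B8 :: "(real^3) set" where "B8 \<equiv> ball 0 8"

text \<open>The frame in \<open>pt\<close> is chosen separately at each point, without any
  regularity in \<open>x\<close>: eigenvectors serve only for pointwise algebra, and every quantity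
  that is differentiated is polynomial in the Hessian or a function of its trace. Taking
  \<open>N\<close> at least 1 makes powers of \<open>N\<close> comparable.\<close>

locale slag =
  fixes u :: "real^3 \<Rightarrow> real" and c s N :: real
  assumes smooth: "smooth_on u B8"
    and pt: "\<And>x. x \<in> B8 \<Longrightarrow> \<exists>E l. slag_point c s (\<lambda>i j. D i (D j u) x) E l"
    and grad: "\<And>x i. x \<in> B8 \<Longrightarrow> \<bar>D i u x\<bar> \<le> N"
    and N: "1 \<le> N"
begin

definition A :: "real^3 \<Rightarrow> 3 \<Rightarrow> 3 \<Rightarrow> real" where "A x i j = D i (D j u) x"
definition T :: "real^3 \<Rightarrow> 3 \<Rightarrow> 3 \<Rightarrow> 3 \<Rightarrow> real" where "T x i j k = D k (D i (D j u)) x"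

lemma Cu: "C_k_on k u B8" using smooth by (simp add: smooth_on_def)
lemma CD: "(\<And>k. C_k_on k f B8) \<Longrightarrow> C_k_on k (D i f) B8"
  by (metis C_k_on.simps(2))
lemma C1: "C_k_on k (D i u) B8" by (rule CD, rule Cu)
lemma C2: "C_k_on k (D i (D j u)) B8" by (rule CD, rule C1)
lemma C3: "C_k_on k (D l (D i (D j u))) B8" by (rule CD, rule C2)
lemma CA: "C_k_on k (\<lambda>x. A x i j) B8" unfolding A_def by (rule C2)
lemma CT: "C_k_on k (\<lambda>x. T x i j l) B8" unfolding T_def by (rule C3)

lemmas C_intros = C_k_on_add[OF open_ball] C_k_on_diff[OF open_ball] C_k_on_mult[OF open_ball]
  C_k_on_const C_k_on_sum[OF open_ball finite] C_k_on_uminus[OF open_ball] C_k_on_power[OF open_ball]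

lemma C_diff: "x \<in> B8 \<Longrightarrow> C_k_on 1 f B8 \<Longrightarrow> f differentiable at x"
  using C_k_on_differentiable[of 0 f B8 x] by simp

lemma dA: "x \<in> B8 \<Longrightarrow> (\<lambda>x. A x i j) differentiable at x"
  and dT: "x \<in> B8 \<Longrightarrow> (\<lambda>x. T x i j k) differentiable at x"
  by (auto intro: C_diff CA CT)

lemma DA: "D k (\<lambda>x. A x i j) x = T x i j k"
  by (simp add: A_def T_def)

lemma swap: "x \<in> B8 \<Longrightarrow> (\<And>k. C_k_on k f B8) \<Longrightarrow> D i (D j f) x = D j (D i f) x"
  by (rule clairaut[OF open_ball])

lemma A_sym: "x \<in> B8 \<Longrightarrow> A x i j = A x j i"
  unfolding A_def by (rule swap) (auto intro: Cu)

lemma T_sym1: "x \<in> B8 \<Longrightarrow> T x i j k = T x j i k"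
  unfolding T_def by (rule D_cong_open[where S = B8]) (simp_all add: swap Cu)

lemma T_sym2: "x \<in> B8 \<Longrightarrow> T x i j k = T x i k j"
proof -
  assume x: "x \<in> B8"
  have "T x i j k = D i (D k (D j u)) x" unfolding T_def by (rule swap[OF x]) (rule C1)
  also have "\<dots> = D i (D j (D k u)) x"
    by (rule D_cong_open[OF open_ball x]) (auto intro: swap Cu)
  also have "\<dots> = D j (D i (D k u)) x" by (rule swap[OF x]) (rule C1)
  finally show ?thesis by (simp add: T_def)
qed

lemma pointE:
  assumes "x \<in> B8" obtains E l where "slag_point c s (A x) E l"
  using pt[OF assms] by (auto simp: A_def[abs_def])

lemma C_sg1: "C_k_on k (\<lambda>x. sg1 (A x)) B8" unfolding sg1_def by (intro C_intros CA)
lemma C_sq: "C_k_on k (\<lambda>x. sq (A x) i j) B8" unfolding sq_def by (intro C_intros CA)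
lemma C_sg2: "C_k_on k (\<lambda>x. sg2 (A x)) B8"
proof -
  have "C_k_on k (\<lambda>x. (1/2) * ((sg1 (A x))\<^sup>2 - (\<Sum>i\<in>UNIV. sq (A x) i i))) B8"
    by (intro C_intros C_sg1 C_sq)
  then show ?thesis by (simp add: sg2_def[abs_def])
qed
lemma C_lin: "C_k_on k (\<lambda>x. lin c s (A x) i j) B8"
  unfolding lin_def by (intro C_intros C_sg1 C_sq C_sg2 CA)
lemma C_nw: "C_k_on k (\<lambda>x. nw (A x) i j) B8"
  unfolding nw_def by (intro C_intros C_sg1 CA)

lemma D_sg1: "x \<in> B8 \<Longrightarrow> D k (\<lambda>x. sg1 (A x)) x = sg1 (\<lambda>i j. T x i j k)"
  unfolding sg1_def by (simp add: D_sum dA DA)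

lemma D_sq: "x \<in> B8 \<Longrightarrow> D k (\<lambda>x. sq (A x) i j) x = (\<Sum>l\<in>UNIV. T x i l k * A x l j + A x i l * T x l j k)"
  unfolding sq_def by (simp add: D_rules diff_rules dA DA)

lemma D_sg2:
  assumes x: "x \<in> B8"
  shows "D k (\<lambda>x. sg2 (A x)) x = sg1 (A x) * sg1 (\<lambda>i j. T x i j k) - (\<Sum>p\<in>UNIV. \<Sum>q\<in>UNIV. A x p q * T x q p k)"
proof -
  have d: "(\<lambda>x. sg1 (A x)) differentiable at x" "\<And>i. (\<lambda>x. sq (A x) i i) differentiable at x"
    using x by (auto intro: C_diff C_sg1 C_sq)
  have "D k (\<lambda>x. sg2 (A x)) x = D k (\<lambda>x. (1/2) * (sg1 (A x) * sg1 (A x) - (\<Sum>i\<in>UNIV. sq (A x) i i))) x"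
    by (simp add: sg2_def[abs_def] power2_eq_square)
  also have "\<dots> = (1/2) * (2 * sg1 (A x) * sg1 (\<lambda>i j. T x i j k)
      - (\<Sum>i\<in>UNIV. \<Sum>l\<in>UNIV. T x i l k * A x l i + A x i l * T x l i k))"
    using d x by (simp add: D_rules diff_rules D_sg1 D_sq del: times_divide_eq_left)
  also have "(\<Sum>i\<in>UNIV. \<Sum>l\<in>UNIV. T x i l k * A x l i + A x i l * T x l i k)
     = 2 * (\<Sum>p\<in>UNIV. \<Sum>q\<in>UNIV. A x p q * T x q p k)"
  proof -
    have "(\<Sum>i\<in>UNIV. \<Sum>l\<in>UNIV. T x i l k * A x l i) = (\<Sum>l\<in>UNIV. \<Sum>i\<in>UNIV. T x i l k * A x l i)"
      by (rule sum.swap)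
    then show ?thesis by (simp add: sum.distrib mult.commute)
  qed
  finally show ?thesis by (simp add: algebra_simps)
qed

lemma D_lin:
  assumes x: "x \<in> B8"
  shows "D k (\<lambda>x. lin c s (A x) i j) x = dlin c s (A x) (\<lambda>i j. T x i j k) i j"
proof -
  have d: "(\<lambda>x. sg1 (A x)) differentiable at x" "(\<lambda>x. sq (A x) i j) differentiable at x"
    "(\<lambda>x. sg2 (A x)) differentiable at x" "(\<lambda>x. A x i j) differentiable at x"
    using x by (auto intro: C_diff C_sg1 C_sq C_sg2 CA)
  show ?thesis unfolding lin_def dlin_def
    using d x by (simp add: D_rules diff_rules D_sg1 D_sq D_sg2 DA)
qed

lemma lin_divergence: "x \<in> B8 \<Longrightarrow> (\<Sum>i\<in>UNIV. D i (\<lambda>x. lin c s (A x) i j) x) = 0"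
  by (simp add: D_lin) (rule dlin_divergence, simp_all add: A_sym T_sym1 T_sym2)

text \<open>The two contributions are the gradient of the Laplacian, once as derivative of the trace
  and once as divergence of the Hessian.\<close>

lemma nw_divergence:
  assumes x: "x \<in> B8" shows "(\<Sum>i\<in>UNIV. D i (\<lambda>x. nw (A x) i j) x) = 0"
proof -
  have "(\<Sum>i\<in>UNIV. D i (\<lambda>x. nw (A x) i j) x) = (\<Sum>i\<in>UNIV. sg1 (\<lambda>p q. T x p q i) * kd i j - T x i j i)"
    using x by (simp add: nw_def D_rules diff_rules D_sg1 DA dA C_diff[OF x C_sg1])
  also have "\<dots> = sg1 (\<lambda>p q. T x p q j) - (\<Sum>i\<in>UNIV. T x i j i)"
    by (simp add: sum_subtractf if_distrib[of "\<lambda>r. _ * r"] cong: if_cong)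
  also have "(\<Sum>i\<in>UNIV. T x i j i) = (\<Sum>i\<in>UNIV. T x i i j)"
    by (intro sum.cong refl T_sym2[OF x])
  finally show ?thesis by (simp add: sg1_def)
qed

text \<open>Differentiating c (sigma_1 - sigma_3) = s (1 - sigma_2) once suffices, because
  \<open>lin\<close> is precisely the linearisation of this polynomial form of the equation.\<close>

lemma lin_T:
  assumes x: "x \<in> B8"
  shows "(\<Sum>i\<in>UNIV. \<Sum>j\<in>UNIV. lin c s (A x) i j * T x i j k) = 0"
proof -
  let ?F = "\<lambda>x. c * (sg1 (A x) - sg3 (A x)) - s * (1 - sg2 (A x))"
  let ?p2 = "\<lambda>x. \<Sum>i\<in>UNIV. sq (A x) i i" and ?p3 = "\<lambda>x. \<Sum>i\<in>UNIV. \<Sum>l\<in>UNIV. sq (A x) i l * A x l i"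
  have "?F y = 0" if y: "y \<in> B8" for y
  proof -
    obtain E l where "slag_point c s (A y) E l" using pointE[OF y] by blast
    from slag_eq[OF this] show ?thesis by simp
  qed
  then have "D k ?F x = D k (\<lambda>x. 0) x" by (intro D_cong_open[OF open_ball x]) auto
  then have F0: "D k ?F x = 0" by simp
  have d: "(\<lambda>x. sg1 (A x)) differentiable at x" "\<And>i j. (\<lambda>x. sq (A x) i j) differentiable at x"
    "(\<lambda>x. sg2 (A x)) differentiable at x" "\<And>i j. (\<lambda>x. A x i j) differentiable at x"
    using x by (auto intro: C_diff C_sg1 C_sq C_sg2 CA)
  let ?B = "\<lambda>i j. T x i j k" and ?H = "A x"
  let ?Q = "\<lambda>i j. \<Sum>l\<in>UNIV. ?B i l * ?H l j + ?H i l * ?B l j"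
  have s3: "sg3 (A x) = (1/6) * (sg1 (A x) * sg1 (A x) * sg1 (A x) - 3 * (sg1 (A x) * ?p2 x) + 2 * ?p3 x)" for x
    by (simp add: sg3_def power3_eq_cube mult.assoc)
  have D3: "D k (\<lambda>x. sg3 (A x)) x = (1/6) * (3 * sg1 ?H * sg1 ?H * sg1 ?B - 3 * (sg1 ?B * ?p2 x + sg1 ?H * (\<Sum>i\<in>UNIV. ?Q i i))
      + 2 * (\<Sum>i\<in>UNIV. \<Sum>l\<in>UNIV. ?Q i l * ?H l i + sq ?H i l * ?B l i))"
    unfolding s3 using d x
    by (simp add: D_rules diff_rules D_sg1 D_sq DA del: times_divide_eq_left)
  have d3: "(\<lambda>x. sg3 (A x)) differentiable at x"
    unfolding s3 using d by (intro diff_rules) auto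
  have eq: "c * (sg1 ?B - D k (\<lambda>x. sg3 (A x)) x) + s * (sg1 ?H * sg1 ?B - (\<Sum>p\<in>UNIV. \<Sum>q\<in>UNIV. ?H p q * ?B q p)) = 0"
    using F0 d d3 x by (simp add: D_rules diff_rules D_sg1 D_sg2)
  have sy: "?H 2 1 = ?H 1 2" "?H 3 1 = ?H 1 3" "?H 3 2 = ?H 2 3" "?B 2 1 = ?B 1 2" "?B 3 1 = ?B 1 3" "?B 3 2 = ?B 2 3"
    using A_sym[OF x] T_sym1[OF x] by blast+
  have "(\<Sum>i\<in>UNIV. \<Sum>j\<in>UNIV. lin c s (A x) i j * T x i j k)
    = c * (sg1 ?B - D k (\<lambda>x. sg3 (A x)) x) + s * (sg1 ?H * sg1 ?B - (\<Sum>p\<in>UNIV. \<Sum>q\<in>UNIV. ?H p q * ?B q p))"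
    unfolding D3 lin_def sg2_def sq_def sg1_def sum_3 sy by (simp add: power2_eq_square field_simps)
  then show ?thesis using eq by simp
qed

definition L :: "(real^3 \<Rightarrow> real) \<Rightarrow> real^3 \<Rightarrow> real" where
  "L f x = (\<Sum>i\<in>UNIV. \<Sum>j\<in>UNIV. lin c s (A x) i j * D i (D j f) x)"

abbreviation a :: "real^3 \<Rightarrow> (3 \<Rightarrow> real) \<Rightarrow> (3 \<Rightarrow> real) \<Rightarrow> real" where
  "a x \<equiv> qf (lin c s (A x))"

definition gr :: "(real^3 \<Rightarrow> real) \<Rightarrow> real^3 \<Rightarrow> 3 \<Rightarrow> real" where "gr f x i = D i f x"

definition w :: "real^3 \<Rightarrow> real" where "w x = sg1 (A x)"

lemma Cw: "C_k_on k w B8" unfolding w_def[abs_def] by (rule C_sg1)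

lemma Dw: "x \<in> B8 \<Longrightarrow> D k w x = sg1 (\<lambda>i j. T x i j k)"
  unfolding w_def[abs_def] by (rule D_sg1)

lemma w_ge: "x \<in> B8 \<Longrightarrow> w x \<ge> 1"
  by (metis pointE slag_sg1 w_def)

text \<open>The equation is differentiated twice in each direction \<open>k\<close> and summed. The
  derivatives of the coefficients, contracted with third derivatives of \<open>u\<close>, go to the
  right-hand side, and the fourth derivatives are reordered into second derivatives of the
  Laplacian.\<close>

lemma L_w: 
  assumes x: "x \<in> B8"
  shows "L w x = (\<Sum>k\<in>UNIV. curv c s (A x) (\<lambda>i j. T x i j k))"
proof -
  have DDw: "D i (D j w) x = (\<Sum>k\<in>UNIV. D k (\<lambda>x. T x i j k) x)" for i j
  proof -
    have "D i (D j w) x = D i (\<lambda>x. \<Sum>k\<in>UNIV. T x k k j) x"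
      by (rule D_cong_open[OF open_ball x]) (simp add: Dw, simp add: sg1_def)
    also have "\<dots> = D i (\<lambda>x. \<Sum>k\<in>UNIV. T x k j k) x"
      by (rule D_cong_open[OF open_ball x]) (metis (no_types, lifting) T_sym2 sum.cong)
    also have "\<dots> = (\<Sum>k\<in>UNIV. D i (\<lambda>x. T x k j k) x)" using x by (simp add: D_sum dT)
    also have "\<dots> = (\<Sum>k\<in>UNIV. D k (\<lambda>x. T x i j k) x)"
    proof (rule sum.cong[OF refl])
      fix k
      have "D i (\<lambda>x. T x k j k) x = D i (D k (D k (D j u))) x" by (simp add: T_def)
      also have "\<dots> = D k (D i (D k (D j u))) x" by (rule swap[OF x]) (rule C2)
      also have "\<dots> = D k (D k (D i (D j u))) x"
        by (rule D_cong_open[OF open_ball x]) (rule swap, auto intro: C1)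
      finally show "D i (\<lambda>x. T x k j k) x = D k (\<lambda>x. T x i j k) x" by (simp add: T_def)
    qed
    finally show ?thesis .
  qed
  have z: "(\<Sum>i\<in>UNIV. \<Sum>j\<in>UNIV. dlin c s (A x) (\<lambda>i j. T x i j k) i j * T x i j k)
      + (\<Sum>i\<in>UNIV. \<Sum>j\<in>UNIV. lin c s (A x) i j * D k (\<lambda>x. T x i j k) x) = 0" for k
  proof -
    have dl: "(\<lambda>x. lin c s (A x) i j) differentiable at x" for i j using x by (auto intro: C_diff C_lin)
    have "D k (\<lambda>x. \<Sum>i\<in>UNIV. \<Sum>j\<in>UNIV. lin c s (A x) i j * T x i j k) x = D k (\<lambda>x. 0) x"
      by (rule D_cong_open[OF open_ball x]) (simp add: lin_T)
    moreover have "D k (\<lambda>x. \<Sum>i\<in>UNIV. \<Sum>j\<in>UNIV. lin c s (A x) i j * T x i j k) x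
       = (\<Sum>i\<in>UNIV. \<Sum>j\<in>UNIV. dlin c s (A x) (\<lambda>i j. T x i j k) i j * T x i j k + lin c s (A x) i j * D k (\<lambda>x. T x i j k) x)"
      using x dl by (simp add: D_rules diff_rules D_lin dT)
    ultimately show ?thesis by (simp add: sum.distrib)
  qed
  have e: "(\<Sum>i\<in>UNIV. \<Sum>j\<in>UNIV. lin c s (A x) i j * D k (\<lambda>x. T x i j k) x) = curv c s (A x) (\<lambda>i j. T x i j k)" for k
  proof -
    have "curv c s (A x) (\<lambda>i j. T x i j k) = - (\<Sum>i\<in>UNIV. \<Sum>j\<in>UNIV. dlin c s (A x) (\<lambda>i j. T x i j k) i j * T x i j k)"
      by (rule curv_dlin) (rule A_sym[OF x], rule T_sym1[OF x])
    then show ?thesis using z[of k] by simp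
  qed
  have "L w x = (\<Sum>i\<in>UNIV. \<Sum>j\<in>UNIV. \<Sum>k\<in>UNIV. lin c s (A x) i j * D k (\<lambda>x. T x i j k) x)"
    by (simp add: L_def DDw sum_distrib_left)
  also have "\<dots> = (\<Sum>i\<in>UNIV. \<Sum>k\<in>UNIV. \<Sum>j\<in>UNIV. lin c s (A x) i j * D k (\<lambda>x. T x i j k) x)"
    by (intro sum.cong refl sum.swap)
  also have "\<dots> = (\<Sum>k\<in>UNIV. \<Sum>i\<in>UNIV. \<Sum>j\<in>UNIV. lin c s (A x) i j * D k (\<lambda>x. T x i j k) x)"
    by (rule sum.swap)
  finally show ?thesis by (simp add: e)
qed

lemma jacobi_w: 
  assumes x: "x \<in> B8"
  shows "(4/3) * a x (gr w x) (gr w x) \<le> w x * L w x"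
proof -
  obtain E l where P: "slag_point c s (A x) E l" using pointE[OF x] by blast
  have "gr w x = (\<lambda>k. sg1 (\<lambda>i j. T x i j k))"
    using x by (auto simp: gr_def Dw)
  then show ?thesis
    using jacobi_pointwise[OF P T_sym1[OF x] T_sym2[OF x] lin_T[OF x]] by (simp add: L_w[OF x] w_def)
qed

text \<open>Unlike the logarithm of the largest eigenvalue, the logarithm of the Laplacian is smooth.\<close>

definition b :: "real^3 \<Rightarrow> real" where "b x = ln (w x)"

lemma Db: "x \<in> B8 \<Longrightarrow> D i b x = inverse (w x) * D i w x"
  unfolding b_def[abs_def]
  by (rule D_chain) (use w_ge[of x] C_diff[OF _ Cw] in \<open>auto intro!: DERIV_ln\<close>)

text \<open>The derivative of the reciprocal is a polynomial in the reciprocal, so the induction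
  feeds itself.\<close>

lemma C_inverse_w: "C_k_on k (\<lambda>x. inverse (w x)) B8"
proof (induction k)
  case 0
  then show ?case using w_ge Cw[of 0] by (force intro!: continuous_intros)
next
  case (Suc k)
  show ?case
  proof (rule C_k_on_chain[OF open_ball Cw, where h' = "\<lambda>t. - (inverse t * inverse t)"])
    show "C_k_on k (\<lambda>x. - (inverse (w x) * inverse (w x))) B8" by (intro C_intros Suc)
    show "(inverse has_real_derivative - (inverse (w x) * inverse (w x))) (at (w x))" if "x \<in> B8" for x
      using DERIV_inverse[of "w x" UNIV] w_ge[OF that] by (simp add: power2_eq_square)
  qed
qed

lemma Cb: "C_k_on k b B8"
proof -
  have "C_k_on (Suc k) (\<lambda>x. ln (w x)) B8"
    by (rule C_k_on_chain[OF open_ball Cw C_inverse_w]) (use w_ge in \<open>force intro!: DERIV_ln\<close>)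
  then show ?thesis unfolding b_def[abs_def] by (rule C_k_on_SucD)
qed

lemma DDb:
  assumes x: "x \<in> B8"
  shows "D i (D j b) x = inverse (w x) * D i (D j w) x - D i b x * D j b x"
proof -
  have "D i (D j b) x = D i (\<lambda>x. inverse (w x) * D j w x) x"
    by (rule D_cong_open[OF open_ball x]) (rule Db)
  also have "\<dots> = D i (\<lambda>x. inverse (w x)) x * D j w x + inverse (w x) * D i (D j w) x"
    by (intro D_mult C_diff x C_inverse_w CD Cw)
  also have "D i (\<lambda>x. inverse (w x)) x = - (inverse (w x) * inverse (w x)) * D i w x"
    by (rule D_chain[OF C_diff[OF x Cw]]) (use DERIV_inverse[of "w x" UNIV] w_ge[OF x] in \<open>simp add: power2_eq_square\<close>)
  finally show ?thesis by (simp add: Db[OF x])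
qed

lemma b_nonneg: "x \<in> B8 \<Longrightarrow> 0 \<le> b x" using w_ge[of x] by (simp add: b_def)
lemma b_le: "x \<in> B8 \<Longrightarrow> b x \<le> w x" using w_ge[of x] ln_le_minus_one[of "w x"] by (simp add: b_def)

text \<open>Taking the logarithm subtracts one full squared gradient from \<open>L w / w\<close>, so
  the factor 4/3 for \<open>w\<close> leaves 1/3 for \<open>b\<close>. Any factor above 1 would
  leave a positive amount.\<close>

lemma jacobi_b: 
  assumes x: "x \<in> B8"
  shows "(1/3) * a x (gr b x) (gr b x) \<le> L b x"
proof -
  let ?i = "inverse (w x)"
  have wp: "w x > 0" using w_ge[OF x] by simp
  have ab: "a x (gr b x) (gr b x) = ?i\<^sup>2 * a x (gr w x) (gr w x)"
    by (simp add: qf_def gr_def Db[OF x] sum_distrib_left power2_eq_square ac_simps)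
  have "L b x = ?i * L w x - a x (gr b x) (gr b x)"
    by (simp add: L_def DDb[OF x] qf_def gr_def right_diff_distrib sum_subtractf sum_distrib_left ac_simps)
  moreover have "?i\<^sup>2 * ((4/3) * a x (gr w x) (gr w x)) \<le> ?i\<^sup>2 * (w x * L w x)"
    by (intro mult_left_mono jacobi_w x) simp
  moreover have "?i\<^sup>2 * (w x * L w x) = ?i * L w x" using wp by (simp add: power2_eq_square)
  ultimately show ?thesis by (simp add: ab)
qed

end

section \<open>Cutoff functions\<close>

lemma DERIV_max_power:
  "((\<lambda>t::real. max 0 t ^ Suc (Suc n)) has_real_derivative real (Suc (Suc n)) * max 0 t ^ Suc n) (at t)"
proof -
  consider "t > 0" | "t < 0" | "t = 0" by linarith
  then show ?thesis
  proof cases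
    case 1
    have "((\<lambda>t. t ^ Suc (Suc n)) has_real_derivative real (Suc (Suc n)) * t ^ Suc n) (at t)"
      by (rule derivative_eq_intros | simp)+
    then have "((\<lambda>t. max 0 t ^ Suc (Suc n)) has_real_derivative real (Suc (Suc n)) * t ^ Suc n) (at t)"
      by (rule has_field_derivative_transform_within_open[where S = "{0<..}"]) (use 1 in auto)
    then show ?thesis using 1 by simp
  next
    case 2
    have "((\<lambda>t::real. 0) has_real_derivative 0) (at t)" by simp
    then have "((\<lambda>t. max 0 t ^ Suc (Suc n)) has_real_derivative 0) (at t)"
      by (rule has_field_derivative_transform_within_open[where S = "{..<0}"]) (use 2 in auto)
    then show ?thesis using 2 by simp
  next
    case 3
    \<comment> \<open>For h different from 0 the difference quotient at 0 is the next lower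
      truncated power of h.\<close>
    have "isCont (\<lambda>h::real. max 0 h ^ Suc n) 0" by (intro continuous_intros)
    then have "((\<lambda>h::real. max 0 h ^ Suc n) \<longlongrightarrow> 0) (at 0)" by (simp add: isCont_def)
    then have "((\<lambda>h::real. (max 0 (0 + h) ^ Suc (Suc n) - max 0 0 ^ Suc (Suc n)) / h) \<longlongrightarrow> 0) (at 0)"
      by (rule Lim_transform_eventually) (auto simp: eventually_at_filter max_def)
    then show ?thesis using 3 by (simp add: DERIV_def)
  qed
qed

text \<open>Each derivative costs one power, and the last remaining power is still
  continuous.\<close>

lemma C_k_on_max_power:
  assumes S: "open S" and f: "C_k_on k f S"
  shows "C_k_on k (\<lambda>x. max 0 (f x) ^ Suc k) S"
  using f
proof (induction k)
  case 0
  then show ?case by (auto intro!: continuous_intros)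
next
  case (Suc k)
  show ?case
  proof (rule C_k_on_chain[OF S Suc.prems])
    show "C_k_on k (\<lambda>x. real (Suc (Suc k)) * max 0 (f x) ^ Suc k) S"
      by (rule C_k_on_cmult[OF S Suc.IH[OF C_k_on_SucD[OF Suc.prems]]])
  qed (rule DERIV_max_power)
qed

text \<open>A round upper bound for all constants of the cutoffs, the largest of them being 64 * 7^2
  * 49^2 = 7529536.\<close>

definition kappa :: real where "kappa = 10 ^ 7"

lemma kappa_ge: "kappa \<ge> 1" "kappa > 0" by (simp_all add: kappa_def)

text \<open>The fourth power yields three continuous derivatives, and it makes the squared gradient
  a bounded multiple of \<open>cut n\<close> itself. The function is at least 1 on the ball of
  radius \<open>n\<close> and is left without normalisation; its size is absorbed by
  \<open>kappa\<close>.\<close>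

definition cut :: "nat \<Rightarrow> real^3 \<Rightarrow> real" where
  "cut n x = max 0 ((real n + 1)\<^sup>2 - (norm x)\<^sup>2) ^ 4"

lemma norm_sq_sum: "(norm (x::real^3))\<^sup>2 = (\<Sum>i\<in>UNIV. x $ i * x $ i)"
  by (simp add: power2_norm_eq_inner inner_vec_def)

lemma C_k_on_bump: "open S \<Longrightarrow> C_k_on k (\<lambda>x::real^3. r - (norm x)\<^sup>2) S"
  unfolding norm_sq_sum
  by (intro C_k_on_diff C_k_on_const C_k_on_sum C_k_on_mult C_k_on_component) auto

lemma D_bump: "D i (\<lambda>x::real^3. r - (norm x)\<^sup>2) x = - 2 * x $ i"
  unfolding norm_sq_sum
  by (simp add: D_rules diff_rules if_distrib[of "\<lambda>a. a * _"] if_distrib[of "\<lambda>a. _ * a"] cong: if_cong)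

lemma C_cut: "C_k_on 3 (cut n) B8"
  unfolding cut_def[abs_def] using C_k_on_max_power[OF _ C_k_on_bump, of B8 3] by (simp add: numeral_eq_Suc)

lemma bump_differentiable: "(\<lambda>x::real^3. r - (norm x)\<^sup>2) differentiable at x"
  by (rule C_k_on_differentiable[OF C_k_on_bump, of UNIV]) auto

lemma D_max_power_bump:
  "D i (\<lambda>x::real^3. max 0 (r - (norm x)\<^sup>2) ^ Suc (Suc n)) x = (real (Suc (Suc n)) * max 0 (r - (norm x)\<^sup>2) ^ Suc n) * (- 2 * x $ i)"
  unfolding D_bump[symmetric, of _ _ r] by (rule D_chain[OF bump_differentiable DERIV_max_power])

lemma D_cut: "D i (cut n) x = - 8 * x $ i * max 0 ((real n + 1)\<^sup>2 - (norm x)\<^sup>2) ^ 3"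
  using D_max_power_bump[of i "(real n + 1)\<^sup>2" 2 x] by (simp add: cut_def[abs_def] numeral_eq_Suc)

lemma DD_cut: "D j (D i (cut n)) x = 48 * (x $ i * x $ j) * max 0 ((real n + 1)\<^sup>2 - (norm x)\<^sup>2) ^ 2
   - 8 * kd i j * max 0 ((real n + 1)\<^sup>2 - (norm x)\<^sup>2) ^ 3"
proof -
  let ?m = "\<lambda>x. max 0 ((real n + 1)\<^sup>2 - (norm x)\<^sup>2) ^ Suc (Suc (Suc 0))"
  have d: "?m differentiable at x"
    by (rule differentiable_chain_real[OF bump_differentiable DERIV_max_power])
  have "D j (D i (cut n)) x = D j (\<lambda>x. (- 8 * x $ i) * ?m x) x"
    by (rule arg_cong[where f = "\<lambda>f. D j f x"]) (auto simp: D_cut numeral_eq_Suc)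
  also have "\<dots> = D j (\<lambda>x. - 8 * x $ i) x * ?m x + (- 8 * x $ i) * D j ?m x"
    by (rule D_mult[OF _ d]) (intro diff_rules differentiable_component)
  also have "D j (\<lambda>x. - 8 * x $ i) x = - 8 * kd i j" by (subst D_cmult) auto
  finally show ?thesis unfolding D_max_power_bump by (simp add: numeral_eq_Suc)
qed

lemma cut_nonneg: "0 \<le> cut n x" by (simp add: cut_def)

lemma cut_ge_1: assumes "norm x \<le> real n" shows "1 \<le> cut n x"
proof -
  have "(norm x)\<^sup>2 \<le> (real n)\<^sup>2" using assms by (intro power_mono) auto
  then have "1 \<le> max 0 ((real n + 1)\<^sup>2 - (norm x)\<^sup>2)" by (simp add: power2_eq_square algebra_simps)
  then show ?thesis unfolding cut_def by (rule one_le_power)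
qed

lemma cut_zero: assumes "real n + 1 \<le> norm x" shows "cut n x = 0"
proof -
  have "(real n + 1)\<^sup>2 \<le> (norm x)\<^sup>2" using assms by (intro power_mono) auto
  then show ?thesis by (simp add: cut_def)
qed

text \<open>Where \<open>cut n\<close> or one of its derivatives is nonzero, the norm of
  \<open>x\<close> is below n + 1, so \<open>cut (Suc n) x\<close> is at least 1 and absolute bounds
  turn into multiples of the next cutoff. The restriction to n \<le> 6 bounds the base of the power
  by 49.\<close>

lemma cut_bounds:
  assumes n: "n \<le> 6"
  shows "cut n x \<le> kappa" "cut n x \<le> kappa * cut (Suc n) x" "cut n x \<le> kappa * (cut (Suc n) x)\<^sup>2"
    "\<bar>D i (cut n) x\<bar> \<le> kappa * cut (Suc n) x" "(D i (cut n) x)\<^sup>2 \<le> kappa * cut n x"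
    "\<bar>D j (D i (cut n)) x\<bar> \<le> kappa * cut (Suc n) x"
proof -
  define m where "m = max 0 ((real n + 1)\<^sup>2 - (norm x)\<^sup>2)"
  have r: "real n + 1 \<le> 7" using n by simp
  have "(real n + 1)\<^sup>2 \<le> 7\<^sup>2" using r by (intro power_mono) auto
  then have "(real n + 1)\<^sup>2 \<le> 49" by simp
  then have "(real n + 1)\<^sup>2 - (norm x)\<^sup>2 \<le> 49" using zero_le_power2[of "norm x"] by linarith
  then have m: "0 \<le> m" "m \<le> 49" by (auto simp: m_def)
  have mp: "m ^ k \<le> 49 ^ k" for k using m by (intro power_mono)
  have C: "cut n x = m ^ 4" by (simp add: cut_def m_def)
  have D1: "D i (cut n) x = - 8 * x $ i * m ^ 3" for i by (simp add: D_cut m_def)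
  have D2: "D j (D i (cut n)) x = 48 * (x $ i * x $ j) * m ^ 2 - 8 * kd i j * m ^ 3" by (simp add: DD_cut m_def)
  have m23: "m ^ 2 \<le> 2401" "m ^ 3 \<le> 117649" using mp[of 2] mp[of 3] by simp_all
  have km: "0 \<le> kappa" using kappa_ge by simp
  have c1: "m ^ 4 \<le> kappa" using mp[of 4] by (simp add: kappa_def)
  show "cut n x \<le> kappa" using c1 C by simp
  have key: "cut n x \<le> kappa * cut (Suc n) x \<and> cut n x \<le> kappa * (cut (Suc n) x)\<^sup>2 \<and>
    \<bar>D i (cut n) x\<bar> \<le> kappa * cut (Suc n) x \<and> (D i (cut n) x)\<^sup>2 \<le> kappa * cut n x \<and>
    \<bar>D j (D i (cut n)) x\<bar> \<le> kappa * cut (Suc n) x"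
  proof (cases "m = 0")
    case True
    then show ?thesis unfolding C D1 D2 using cut_nonneg kappa_ge by simp
  next
    case False
    then have "(norm x)\<^sup>2 < (real n + 1)\<^sup>2" unfolding m_def by linarith
    then have nx: "norm x < real n + 1" by (rule power2_less_imp_less) simp
    then have c': "1 \<le> cut (Suc n) x" by (intro cut_ge_1) simp
    then have c2: "1 \<le> (cut (Suc n) x)\<^sup>2" by (simp add: one_le_power)
    have le: "t \<le> kappa * cut (Suc n) x" if "t \<le> kappa" for t
      using that mult_left_mono[OF c' km] by linarith
    have xi: "\<bar>x $ i\<bar> \<le> 7" for i using component_le_norm_cart[of x i] nx r by linarith
    have b1: "\<bar>D i (cut n) x\<bar> \<le> kappa"
    proof -
      have "\<bar>D i (cut n) x\<bar> = 8 * \<bar>x $ i\<bar> * m ^ 3" using m by (simp add: D1 abs_mult)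
      also have "\<dots> \<le> 8 * 7 * 49 ^ 3" using xi m m23 by (intro mult_mono) auto
      finally show ?thesis by (simp add: kappa_def)
    qed
    have b2: "\<bar>D j (D i (cut n)) x\<bar> \<le> kappa"
    proof -
      have "\<bar>D j (D i (cut n)) x\<bar> \<le> \<bar>48 * (x $ i * x $ j) * m ^ 2\<bar> + \<bar>8 * kd i j * m ^ 3\<bar>"
        unfolding D2 by (rule abs_triangle_ineq4)
      also have "\<dots> = 48 * (\<bar>x $ i\<bar> * \<bar>x $ j\<bar>) * m ^ 2 + 8 * kd i j * m ^ 3" using m by (simp add: abs_mult)
      also have "\<dots> \<le> 48 * (7 * 7) * 49 ^ 2 + 8 * 1 * 49 ^ 3"
        using xi m m23 by (intro add_mono mult_mono) auto
      finally show ?thesis by (simp add: kappa_def)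
    qed
    have b3: "(D i (cut n) x)\<^sup>2 \<le> kappa * cut n x"
    proof -
      have "(D i (cut n) x)\<^sup>2 = 64 * (x $ i)\<^sup>2 * m ^ 2 * m ^ 4" unfolding D1
        by (simp add: power2_eq_square numeral_eq_Suc algebra_simps)
      also have "\<dots> \<le> 64 * 7\<^sup>2 * 49 ^ 2 * m ^ 4"
      proof (intro mult_right_mono mult_mono mp)
        show "(x $ i)\<^sup>2 \<le> 7\<^sup>2" using xi[of i] by (metis abs_ge_zero power2_abs power_mono)
      qed (use m in auto)
      also have "\<dots> \<le> kappa * m ^ 4" using m by (intro mult_right_mono) (auto simp: kappa_def)
      finally show ?thesis by (simp add: C)
    qed
    have "cut n x \<le> kappa * (cut (Suc n) x)\<^sup>2"
      using c1 mult_left_mono[OF c2 km] unfolding C by linarith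
    then show ?thesis using le[OF b1] le[OF b2] le[OF c1] b3 C by simp
  qed
  show "cut n x \<le> kappa * cut (Suc n) x" "cut n x \<le> kappa * (cut (Suc n) x)\<^sup>2"
    "\<bar>D i (cut n) x\<bar> \<le> kappa * cut (Suc n) x" "(D i (cut n) x)\<^sup>2 \<le> kappa * cut n x"
    "\<bar>D j (D i (cut n)) x\<bar> \<le> kappa * cut (Suc n) x"
    using key by blast+
qed

section \<open>Integrals over the closed ball of radius 7 and integration by parts\<close>

abbreviation K7 :: "(real^3) set" where "K7 \<equiv> cball 0 7"

definition Itg :: "(real^3 \<Rightarrow> real) \<Rightarrow> real" where
  "Itg f = (LINT x:K7|lborel. f x)"

lemma K7_B8: "K7 \<subseteq> B8" by auto

lemma K7_integrable: "C_k_on k f B8 \<Longrightarrow> set_integrable lborel K7 f"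
  unfolding set_integrable_def
  using continuous_on_subset[OF _ K7_B8] C_k_on_mono[of k f B8 0] by (intro borel_integrable_compact) auto

lemma Itg_mono:
  assumes "C_k_on k f B8" "C_k_on j g B8" "\<And>x. x \<in> B8 \<Longrightarrow> f x \<le> g x"
  shows "Itg f \<le> Itg g"
  unfolding Itg_def using assms(1,2)
  by (intro set_integral_mono K7_integrable assms(3) subsetD[OF K7_B8])

lemma Itg_add: "C_k_on k f B8 \<Longrightarrow> C_k_on j g B8 \<Longrightarrow> Itg (\<lambda>x. f x + g x) = Itg f + Itg g"
  unfolding Itg_def by (intro set_integral_add(2) K7_integrable)

lemma Itg_diff: "C_k_on k f B8 \<Longrightarrow> C_k_on j g B8 \<Longrightarrow> Itg (\<lambda>x. f x - g x) = Itg f - Itg g"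
  unfolding Itg_def by (intro set_integral_diff(2) K7_integrable)

lemma Itg_cmult: "Itg (\<lambda>x. r * f x) = r * Itg f"
  unfolding Itg_def by simp

lemma Itg_cong: "(\<And>x. x \<in> B8 \<Longrightarrow> f x = g x) \<Longrightarrow> Itg f = Itg g"
  unfolding Itg_def using K7_B8 by (intro set_lebesgue_integral_cong) auto

lemma Itg_sum: "finite I \<Longrightarrow> (\<And>i. i \<in> I \<Longrightarrow> C_k_on k (f i) B8) \<Longrightarrow> Itg (\<lambda>x. \<Sum>i\<in>I. f i x) = (\<Sum>i\<in>I. Itg (f i))"
proof (induction I rule: finite_induct)
  case empty
  then show ?case by (simp add: Itg_def)
next
  case (insert a F)
  then show ?case by (simp add: Itg_add[of k _ k] C_k_on_sum)
qed

lemma Itg_D: "C_k_on 1 f B8 \<Longrightarrow> (\<And>x. x \<in> B8 \<Longrightarrow> x \<notin> K7 \<Longrightarrow> f x = 0) \<Longrightarrow> Itg (D i f) = 0"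
  unfolding Itg_def by (rule integral_partial_deriv_eq_0[OF open_ball _ _ K7_B8]) auto

lemma D_vanish:
  assumes f: "\<And>x. x \<in> B8 \<Longrightarrow> x \<notin> K7 \<Longrightarrow> f x = (0::real)" and x: "x \<in> B8" "x \<notin> K7"
  shows "D i f x = 0"
proof -
  have "D i f x = D i (\<lambda>x. 0) x"
    by (rule D_cong_open[of "B8 - K7"]) (use x f in \<open>auto intro: open_Diff\<close>)
  then show ?thesis by simp
qed

text \<open>The divergence of the field with components Y_i = sum_j M_ij X_j integrates to 0, and
  the terms that differentiate \<open>M\<close> drop out. The identity matrix, \<open>nw\<close> and
  \<open>lin\<close> are the instances.\<close>

lemma Itg_divergence_free:
  fixes M :: "real^3 \<Rightarrow> 3 \<Rightarrow> 3 \<Rightarrow> real" and X :: "3 \<Rightarrow> real^3 \<Rightarrow> real"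
  assumes M: "\<And>i j. C_k_on 1 (\<lambda>x. M x i j) B8" "\<And>x j. x \<in> B8 \<Longrightarrow> (\<Sum>i\<in>UNIV. D i (\<lambda>x. M x i j) x) = 0"
    and X: "\<And>j. C_k_on 1 (X j) B8" "\<And>j x. x \<in> B8 \<Longrightarrow> x \<notin> K7 \<Longrightarrow> X j x = 0"
  shows "Itg (\<lambda>x. \<Sum>i\<in>UNIV. \<Sum>j\<in>UNIV. M x i j * D i (X j) x) = (0::real)"
proof -
  let ?Y = "\<lambda>i x. \<Sum>j\<in>(UNIV::3 set). M x i j * X j x"
  have Y: "C_k_on 1 (?Y i) B8" for i by (intro C_k_on_sum C_k_on_mult M X) auto
  have CD: "C_k_on 0 (D i (?Y i)) B8" for i using Y by (simp add: One_nat_def)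
  have "0 = (\<Sum>i\<in>(UNIV::3 set). Itg (D i (?Y i)))"
    by (subst Itg_D[OF Y]) (use X in auto)
  also have "\<dots> = Itg (\<lambda>x. \<Sum>i\<in>UNIV. D i (?Y i) x)" by (rule Itg_sum[symmetric, OF finite CD])
  also have "\<dots> = Itg (\<lambda>x. \<Sum>i\<in>UNIV. \<Sum>j\<in>UNIV. M x i j * D i (X j) x)"
  proof (rule Itg_cong)
    fix x :: "real^3" assume x: "x \<in> B8"
    have d: "(\<lambda>x. M x i j) differentiable at x" "X j differentiable at x" for i j
      using C_k_on_differentiable[OF _ open_ball x, of 0] M(1) X(1) by auto
    have "(\<Sum>i\<in>UNIV. D i (?Y i) x) = (\<Sum>i\<in>UNIV. \<Sum>j\<in>UNIV. D i (\<lambda>x. M x i j) x * X j x) + (\<Sum>i\<in>UNIV. \<Sum>j\<in>UNIV. M x i j * D i (X j) x)"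
      using d by (simp add: D_rules diff_rules sum.distrib)
    also have "(\<Sum>i\<in>UNIV. \<Sum>j\<in>UNIV. D i (\<lambda>x. M x i j) x * X j x) = (\<Sum>j\<in>UNIV. \<Sum>i\<in>UNIV. D i (\<lambda>x. M x i j) x * X j x)"
      by (rule sum.swap)
    also have "\<dots> = 0" by (simp add: M(2)[OF x] flip: sum_distrib_right)
    finally show "(\<Sum>i\<in>UNIV. D i (?Y i) x) = (\<Sum>i\<in>UNIV. \<Sum>j\<in>UNIV. M x i j * D i (X j) x)" by simp
  qed
  finally show ?thesis by simp
qed

section \<open>Integral identities\<close>

lemma coord_spectral_column:
  assumes "orthoframe E" shows "coord E (\<lambda>i. spectral E f i k) a = f a * E a k"
proof -
  have "coord E (\<lambda>i. \<Sum>j\<in>UNIV. spectral E f i j * kd j k) a = f a * coord E (\<lambda>j. kd j k) a"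
    by (rule coord_spectral[OF assms])
  then show ?thesis by (simp add: coord_def if_distrib cong: if_cong)
qed

lemma lin_trace_sq:
  assumes P: "slag_point c s H E l"
  shows "(\<Sum>k\<in>UNIV. qf (lin c s H) (\<lambda>i. H i k) (\<lambda>i. H i k)) = 3 * vol c s H - (\<Sum>i\<in>UNIV. lin c s H i i)"
proof -
  note E = slag_E[OF P]
  have co: "coord E (\<lambda>i. H i k) a = l a * E a k" for k a
    unfolding slag_H[OF P] by (rule coord_spectral_column[OF E])
  have "(\<Sum>k\<in>UNIV. qf (lin c s H) (\<lambda>i. H i k) (\<lambda>i. H i k))
     = (\<Sum>k\<in>UNIV. \<Sum>a\<in>UNIV. mu c s H l a * (l a)\<^sup>2 * (E a k * E a k))"
    unfolding lin_mu[OF P] qf_spectral co by (simp add: power2_eq_square ac_simps)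
  also have "\<dots> = (\<Sum>a\<in>UNIV. \<Sum>k\<in>UNIV. mu c s H l a * (l a)\<^sup>2 * (E a k * E a k))" by (rule sum.swap)
  also have "\<dots> = (\<Sum>a\<in>UNIV. mu c s H l a * (l a)\<^sup>2)"
    by (simp add: orthoframeD[OF E] flip: sum_distrib_left)
  also have "\<dots> = (\<Sum>a\<in>UNIV. vol c s H - mu c s H l a)"
    using mu_V[OF P] by (intro sum.cong refl) (simp add: algebra_simps)
  finally show ?thesis by (simp add: lin_trace[OF P] sum_3)
qed

lemma qf_add_left: "qf M (\<lambda>i. v i + v' i) w = qf M v w + qf M v' w"
  by (simp add: qf_def distrib_left distrib_right sum.distrib)
lemma qf_add_right: "qf M v (\<lambda>i. w i + w' i) = qf M v w + qf M v w'"
  by (simp add: qf_def distrib_left sum.distrib)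
lemma qf_cmult_left: "qf M (\<lambda>i. r * v i) w = r * qf M v w"
  by (simp add: qf_def sum_distrib_left ac_simps)
lemma qf_cmult_right: "qf M v (\<lambda>i. r * w i) = r * qf M v w"
  by (simp add: qf_def sum_distrib_left ac_simps)
lemma qf_minus_left: "qf M (\<lambda>i. - v i) w = - qf M v w"
  by (simp add: qf_def sum_negf)
lemma qf_lin_nonneg:
  assumes P: "slag_point c s H E l" shows "0 \<le> qf (lin c s H) v v"
proof -
  have "qf (lin c s H) v v = (\<Sum>a\<in>UNIV. mu c s H l a * (coord E v a)\<^sup>2)"
    unfolding lin_mu[OF P] qf_spectral by (simp add: power2_eq_square ac_simps)
  then show ?thesis using mu_pos[OF P] by (simp add: sum_nonneg less_imp_le)
qed

lemma qf_lin_sym: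
  assumes P: "slag_point c s H E l" shows "qf (lin c s H) v w = qf (lin c s H) w v"
  unfolding lin_mu[OF P] qf_spectral by (simp add: ac_simps)

lemma qf_lin_young:
  assumes P: "slag_point c s H E l" and t: "t > 0"
  shows "- (2 * qf (lin c s H) v w) \<le> t * qf (lin c s H) v v + (1 / t) * qf (lin c s H) w w"
proof -
  have "0 \<le> (1/t) * qf (lin c s H) (\<lambda>i. t * v i + w i) (\<lambda>i. t * v i + w i)"
    using qf_lin_nonneg[OF P] t by simp
  also have "\<dots> = t * qf (lin c s H) v v + 2 * qf (lin c s H) v w + (1 / t) * qf (lin c s H) w w"
    unfolding qf_add_left qf_add_right qf_cmult_left qf_cmult_right
    using t qf_lin_sym[OF P, of w v] by (simp add: field_simps)
  finally show ?thesis by simp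
qed

context slag
begin

definition tra :: "real^3 \<Rightarrow> real" where "tra x = (\<Sum>i\<in>UNIV. lin c s (A x) i i)"
definition V :: "real^3 \<Rightarrow> real" where "V x = vol c s (A x)"

lemma C_sg3: "C_k_on k (\<lambda>x. sg3 (A x)) B8"
proof -
  have "C_k_on k (\<lambda>x. (1/6) * ((sg1 (A x))^3 - 3 * sg1 (A x) * (\<Sum>i\<in>UNIV. sq (A x) i i)
      + 2 * (\<Sum>i\<in>UNIV. \<Sum>k\<in>UNIV. sq (A x) i k * A x k i))) B8"
    by (intro C_intros C_sg1 C_sq CA)
  then show ?thesis by (simp add: sg3_def[abs_def])
qed

lemma C_V: "C_k_on k V B8" unfolding V_def[abs_def] vol_def by (intro C_intros C_sg1 C_sg2 C_sg3)
lemma C_tra: "C_k_on k tra B8" unfolding tra_def[abs_def] by (intro C_intros C_lin)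

lemma V_pos: "x \<in> B8 \<Longrightarrow> 0 < V x"
  by (metis pointE slag_V(1) V_def)
lemma tra_pos: "x \<in> B8 \<Longrightarrow> 0 < tra x"
  by (metis pointE lin_trace_pos tra_def)

lemma C_L: "C_k_on (Suc (Suc k)) f B8 \<Longrightarrow> C_k_on k (L f) B8"
  unfolding L_def[abs_def] by (intro C_intros C_lin) simp

lemma C_D: "C_k_on (Suc k) f B8 \<Longrightarrow> C_k_on k (D i f) B8" by simp

lemma C_qf: "(\<And>i j. C_k_on k (\<lambda>x. M x i j) B8) \<Longrightarrow> (\<And>i. C_k_on k (\<lambda>x. v x i) B8) \<Longrightarrow> (\<And>i. C_k_on k (\<lambda>x. v' x i) B8)
   \<Longrightarrow> C_k_on k (\<lambda>x. qf (M x) (v x) (v' x)) B8"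
  unfolding qf_def by (intro C_intros) auto

lemma C_gr: "C_k_on (Suc k) f B8 \<Longrightarrow> C_k_on k (\<lambda>x. gr f x i) B8"
  unfolding gr_def by simp

lemma div_lin:
  assumes X: "\<And>j. C_k_on 1 (X j) B8" "\<And>j x. x \<in> B8 \<Longrightarrow> x \<notin> K7 \<Longrightarrow> X j x = 0"
  shows "Itg (\<lambda>x. \<Sum>i\<in>UNIV. \<Sum>j\<in>UNIV. lin c s (A x) i j * D i (X j) x) = 0"
  by (rule Itg_divergence_free[OF C_lin lin_divergence X])

lemma div_nw:
  assumes X: "\<And>j. C_k_on 1 (X j) B8" "\<And>j x. x \<in> B8 \<Longrightarrow> x \<notin> K7 \<Longrightarrow> X j x = 0"
  shows "Itg (\<lambda>x. \<Sum>i\<in>UNIV. \<Sum>j\<in>UNIV. nw (A x) i j * D i (X j) x) = 0"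
  by (rule Itg_divergence_free[OF C_nw nw_divergence X])

text \<open>The field f Dg - g Df vanishes wherever \<open>f\<close> does on an open set, so a
  cutoff on one function suffices; the gradient cross terms cancel by symmetry of
  \<open>lin\<close>.\<close>

lemma green:
  assumes f: "C_k_on 2 f B8" and g: "C_k_on 2 g B8" and z: "\<And>x. x \<in> B8 \<Longrightarrow> x \<notin> K7 \<Longrightarrow> f x = 0"
  shows "Itg (\<lambda>x. f x * L g x) = Itg (\<lambda>x. g x * L f x)"
proof -
  note f' = f[unfolded numeral_2_eq_2] and g' = g[unfolded numeral_2_eq_2]
  have C: "C_k_on 1 f B8" "C_k_on 1 g B8" "\<And>i. C_k_on 1 (D i f) B8" "\<And>i. C_k_on 1 (D i g) B8"
    using C_k_on_mono[OF f, of 1] C_k_on_mono[OF g, of 1] f' g' by auto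
  have "0 = Itg (\<lambda>x. \<Sum>i\<in>UNIV. \<Sum>j\<in>UNIV. lin c s (A x) i j * D i (\<lambda>x. f x * D j g x - g x * D j f x) x)"
    by (rule div_lin[symmetric]) (use C z D_vanish[OF z] in \<open>auto intro!: C_intros simp del: C_k_on.simps\<close>)
  also have "\<dots> = Itg (\<lambda>x. f x * L g x - g x * L f x)"
  proof (rule Itg_cong)
    fix x :: "real^3" assume x: "x \<in> B8"
    have d: "f differentiable at x" "g differentiable at x" "\<And>i. D i f differentiable at x" "\<And>i. D i g differentiable at x"
      using C C_diff[OF x] by blast+
    have "(\<Sum>i\<in>UNIV. \<Sum>j\<in>UNIV. lin c s (A x) i j * D i (\<lambda>x. f x * D j g x - g x * D j f x) x)
      = f x * L g x - g x * L f x + (a x (gr f x) (gr g x) - a x (gr g x) (gr f x))"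
      using d by (simp add: D_rules diff_rules L_def qf_def gr_def algebra_simps sum.distrib sum_subtractf sum_distrib_left)
    also obtain E l where P: "slag_point c s (A x) E l" using pointE[OF x] by blast
    note qf_lin_sym[OF P, of "gr g x" "gr f x"]
    finally show "(\<Sum>i\<in>UNIV. \<Sum>j\<in>UNIV. lin c s (A x) i j * D i (\<lambda>x. f x * D j g x - g x * D j f x) x) = f x * L g x - g x * L f x"
      by simp
  qed
  also have "\<dots> = Itg (\<lambda>x. f x * L g x) - Itg (\<lambda>x. g x * L f x)"
    by (rule Itg_diff[of 0 _ 0])
      (use f' g' C_k_on_mono[OF f, of 0] C_k_on_mono[OF g, of 0] in \<open>auto intro!: C_intros C_L simp del: C_k_on.simps\<close>)
  finally show ?thesis by simp
qed

lemma parts_w: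
  assumes f: "C_k_on 1 f B8" and z: "\<And>x. x \<in> B8 \<Longrightarrow> x \<notin> K7 \<Longrightarrow> f x = 0"
  shows "Itg (\<lambda>x. f x * w x) = Itg (\<lambda>x. - (\<Sum>i\<in>UNIV. gr f x i * gr u x i))"
proof -
  have f0: "C_k_on 0 f B8" "\<And>i. C_k_on 0 (\<lambda>x. gr f x i) B8" "\<And>i. C_k_on 0 (\<lambda>x. gr u x i) B8"
    using C_k_on_mono[OF f, of 0] f Cu[of "Suc 0"] by (auto intro!: C_gr simp del: C_k_on.simps)
  have "0 = Itg (\<lambda>x. \<Sum>i\<in>UNIV. \<Sum>j\<in>UNIV. kd i j * D i (\<lambda>x. f x * D j u x) x)"
    by (rule Itg_divergence_free[symmetric]) (use f z C1 in \<open>auto intro!: C_intros simp del: C_k_on.simps\<close>)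
  also have "\<dots> = Itg (\<lambda>x. f x * w x - - (\<Sum>i\<in>UNIV. gr f x i * gr u x i))"
  proof (rule Itg_cong)
    fix x :: "real^3" assume x: "x \<in> B8"
    have d: "f differentiable at x" "\<And>i. D i u differentiable at x"
      using C_diff[OF x] f C1 by blast+
    show "(\<Sum>i\<in>UNIV. \<Sum>j\<in>UNIV. kd i j * D i (\<lambda>x. f x * D j u x) x) = f x * w x - - (\<Sum>i\<in>UNIV. gr f x i * gr u x i)"
      using d by (simp add: D_mult if_distrib[of "\<lambda>r. r * _"] gr_def w_def sg1_def A_def sum.distrib sum_distrib_left cong: if_cong)
  qed
  also have "\<dots> = Itg (\<lambda>x. f x * w x) - Itg (\<lambda>x. - (\<Sum>i\<in>UNIV. gr f x i * gr u x i))"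
    by (rule Itg_diff[of 0 _ 0]) (intro C_intros f0 Cw)+
  finally show ?thesis by simp
qed

text \<open>Contracting \<open>nw\<close> with the Hessian gives 2 sigma_2, which is therefore the
  divergence of \<open>nw\<close> applied to Du.\<close>

lemma parts_sg2:
  assumes f: "C_k_on 1 f B8" and z: "\<And>x. x \<in> B8 \<Longrightarrow> x \<notin> K7 \<Longrightarrow> f x = 0"
  shows "Itg (\<lambda>x. 2 * f x * sg2 (A x)) = Itg (\<lambda>x. - qf (nw (A x)) (gr f x) (gr u x))"
proof -
  have f0: "C_k_on 0 f B8" "\<And>i. C_k_on 0 (\<lambda>x. gr f x i) B8" "\<And>i. C_k_on 0 (\<lambda>x. gr u x i) B8"
    using C_k_on_mono[OF f, of 0] f Cu[of "Suc 0"] by (auto intro!: C_gr simp del: C_k_on.simps)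
  have "0 = Itg (\<lambda>x. \<Sum>i\<in>UNIV. \<Sum>j\<in>UNIV. nw (A x) i j * D i (\<lambda>x. f x * D j u x) x)"
    by (rule div_nw[symmetric]) (use f z C1 in \<open>auto intro!: C_intros simp del: C_k_on.simps\<close>)
  also have "\<dots> = Itg (\<lambda>x. 2 * f x * sg2 (A x) - - qf (nw (A x)) (gr f x) (gr u x))"
  proof (rule Itg_cong)
    fix x :: "real^3" assume x: "x \<in> B8"
    have d: "f differentiable at x" "\<And>i. D i u differentiable at x"
      using C_diff[OF x] f C1 by blast+
    have "(\<Sum>i\<in>UNIV. \<Sum>j\<in>UNIV. nw (A x) i j * A x i j) = 2 * sg2 (A x)"
      using A_sym[OF x, of 2 1] A_sym[OF x, of 3 1] A_sym[OF x, of 3 2]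
      by (simp add: nw_def sg2_def sg1_def sq_def sum_3 power2_eq_square algebra_simps)
    then have "f x * (\<Sum>i\<in>UNIV. \<Sum>j\<in>UNIV. nw (A x) i j * A x i j) = 2 * f x * sg2 (A x)" by simp
    then show "(\<Sum>i\<in>UNIV. \<Sum>j\<in>UNIV. nw (A x) i j * D i (\<lambda>x. f x * D j u x) x) = 2 * f x * sg2 (A x) - - qf (nw (A x)) (gr f x) (gr u x)"
      using d by (simp add: D_mult gr_def qf_def A_def sum.distrib sum_distrib_left distrib_left ac_simps)
  qed
  also have "\<dots> = Itg (\<lambda>x. 2 * f x * sg2 (A x)) - Itg (\<lambda>x. - qf (nw (A x)) (gr f x) (gr u x))"
    by (rule Itg_diff[of 0 _ 0]) (intro C_intros f0 C_sg2 C_qf C_nw)+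
  finally show ?thesis by simp
qed

lemma parts_L:
  assumes f: "C_k_on 1 f B8" and g: "C_k_on 2 g B8" and z: "\<And>x. x \<in> B8 \<Longrightarrow> x \<notin> K7 \<Longrightarrow> f x = 0"
  shows "Itg (\<lambda>x. f x * L g x) = Itg (\<lambda>x. - a x (gr f x) (gr g x))"
proof -
  note g' = g[unfolded numeral_2_eq_2]
  have f0: "C_k_on 0 f B8" "\<And>i. C_k_on 0 (\<lambda>x. gr f x i) B8" "\<And>i. C_k_on 0 (\<lambda>x. gr g x i) B8"
    using C_k_on_mono[OF f, of 0] f C_k_on_mono[OF g, of "Suc 0"] by (auto intro!: C_gr simp del: C_k_on.simps)
  have g1: "C_k_on 1 (D i g) B8" for i unfolding One_nat_def by (rule C_D[OF g'])
  note f0 = f0 g1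
  have "0 = Itg (\<lambda>x. \<Sum>i\<in>UNIV. \<Sum>j\<in>UNIV. lin c s (A x) i j * D i (\<lambda>x. f x * D j g x) x)"
    by (rule div_lin[symmetric]) (use f z f0 in \<open>auto intro!: C_intros simp del: C_k_on.simps\<close>)
  also have "\<dots> = Itg (\<lambda>x. f x * L g x - - a x (gr f x) (gr g x))"
  proof (rule Itg_cong)
    fix x :: "real^3" assume x: "x \<in> B8"
    have d: "f differentiable at x" "\<And>i. D i g differentiable at x"
      using C_diff[OF x] f f0 by blast+
    show "(\<Sum>i\<in>UNIV. \<Sum>j\<in>UNIV. lin c s (A x) i j * D i (\<lambda>x. f x * D j g x) x) = f x * L g x - - a x (gr f x) (gr g x)"
      using d by (simp add: D_mult gr_def qf_def L_def sum.distrib sum_distrib_left distrib_left ac_simps)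
  qed
  also have "\<dots> = Itg (\<lambda>x. f x * L g x) - Itg (\<lambda>x. - a x (gr f x) (gr g x))"
    by (rule Itg_diff[of 0 _ 0]) (intro C_intros f0 C_L g' C_qf C_lin)+
  finally show ?thesis by simp
qed

end

section \<open>Energy estimates\<close>

lemma inner_bound_3:
  fixes v w :: "3 \<Rightarrow> real"
  assumes "\<And>i. \<bar>v i\<bar> \<le> \<alpha>" "\<And>i. \<bar>w i\<bar> \<le> \<beta>"
  shows "\<bar>\<Sum>i\<in>UNIV. v i * w i\<bar> \<le> 3 * \<alpha> * \<beta>"
proof -
  have "\<bar>v i * w i\<bar> \<le> \<alpha> * \<beta>" for i
    unfolding abs_mult using assms by (intro mult_mono) (auto intro: order_trans[OF abs_ge_zero])
  then have "(\<Sum>i\<in>(UNIV::3 set). \<bar>v i * w i\<bar>) \<le> (\<Sum>i\<in>(UNIV::3 set). \<alpha> * \<beta>)" by (intro sum_mono)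
  then have "(\<Sum>i\<in>(UNIV::3 set). \<bar>v i * w i\<bar>) \<le> 3 * \<alpha> * \<beta>" by simp
  then show ?thesis by (rule order_trans[OF sum_abs])
qed

lemma cut_outside: "n \<le> 6 \<Longrightarrow> x \<notin> cball 0 7 \<Longrightarrow> cut n x = 0"
  by (rule cut_zero) auto

context slag
begin

lemma C_cut_le: "k \<le> 3 \<Longrightarrow> C_k_on k (cut n) B8"
  by (rule C_k_on_mono[OF C_cut])

lemmas C_facts = C_cut_le Cw Cb C_V C_tra C_sg2 C_lin C_nw CA C1

lemma gr_mult:
  assumes "x \<in> B8" "C_k_on 1 f B8" "C_k_on 1 g B8"
  shows "gr (\<lambda>x. f x * g x) x = (\<lambda>i. g x * gr f x i + f x * gr g x i)"
  unfolding gr_def using C_diff[OF assms(1)] assms(2,3) by (auto simp: D_mult mult.commute)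

lemma L_mult:
  assumes x: "x \<in> B8" and f: "C_k_on 2 f B8" and g: "C_k_on 2 g B8"
  shows "L (\<lambda>x. f x * g x) x = f x * L g x + g x * L f x + 2 * a x (gr f x) (gr g x)"
proof -
  have C: "C_k_on 1 f B8" "C_k_on 1 g B8" "\<And>i. C_k_on 1 (D i f) B8" "\<And>i. C_k_on 1 (D i g) B8"
    using C_k_on_mono[OF f, of 1] C_k_on_mono[OF g, of 1] f g by (auto simp: numeral_2_eq_2)
  have d: "f differentiable at y" "g differentiable at y" "\<And>i. D i f differentiable at y" "\<And>i. D i g differentiable at y"
    if "y \<in> B8" for y using C C_diff[OF that] by blast+
  have DD: "D i (D j (\<lambda>x. f x * g x)) x = g x * D i (D j f) x + f x * D i (D j g) x + (D i f x * D j g x + D i g x * D j f x)" for i j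
  proof -
    have "D i (D j (\<lambda>x. f x * g x)) x = D i (\<lambda>x. D j f x * g x + f x * D j g x) x"
      by (rule D_cong_open[OF open_ball x]) (rule D_mult, rule d, assumption, rule d)
    also have "\<dots> = g x * D i (D j f) x + f x * D i (D j g) x + (D i f x * D j g x + D i g x * D j f x)"
      using d[OF x] by (simp add: D_rules diff_rules)
    finally show ?thesis .
  qed
  obtain E l where P: "slag_point c s (A x) E l" using pointE[OF x] by blast
  have "L (\<lambda>x. f x * g x) x = f x * L g x + g x * L f x + a x (gr f x) (gr g x) + a x (gr g x) (gr f x)"
    by (simp add: L_def DD qf_def gr_def sum.distrib sum_distrib_left distrib_left ac_simps)
  then show ?thesis using qf_lin_sym[OF P, of "gr g x" "gr f x"] by simp
qed

lemma lin_entry: 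
  assumes x: "x \<in> B8" shows "\<bar>lin c s (A x) i j\<bar> \<le> 3 * tra x"
proof -
  obtain E l where P: "slag_point c s (A x) E l" using pointE[OF x] by blast
  have "qf (lin c s (A x)) (kd i) (kd j) = lin c s (A x) i j"
    by (simp add: qf_def if_distrib[of "\<lambda>r. r * _"] if_distrib[of "\<lambda>r. _ * r"] cong: if_cong)
  then show ?thesis using lin_entry_bound[OF P, of "kd i" 1 "kd j" 1] by (simp add: tra_def)
qed

text \<open>27 counts nine entries, each entry of \<open>lin\<close> being at most
  \<open>3 * tra x\<close>.\<close>

lemma L_cut_bound:
  assumes x: "x \<in> B8" and n: "n \<le> 6"
  shows "\<bar>L (cut n) x\<bar> \<le> 27 * kappa * (cut (Suc n) x * tra x)"
proof -
  have "\<bar>lin c s (A x) i j * D i (D j (cut n)) x\<bar> \<le> 3 * tra x * (kappa * cut (Suc n) x)" for i j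
    unfolding abs_mult using lin_entry[OF x] cut_bounds(6)[OF n] tra_pos[OF x] by (intro mult_mono) auto
  then have "(\<Sum>i\<in>(UNIV::3 set). \<Sum>j\<in>(UNIV::3 set). \<bar>lin c s (A x) i j * D i (D j (cut n)) x\<bar>)
     \<le> (\<Sum>i\<in>(UNIV::3 set). \<Sum>j\<in>(UNIV::3 set). 3 * tra x * (kappa * cut (Suc n) x))"
    by (intro sum_mono)
  moreover have "\<bar>L (cut n) x\<bar> \<le> (\<Sum>i\<in>(UNIV::3 set). \<Sum>j\<in>(UNIV::3 set). \<bar>lin c s (A x) i j * D i (D j (cut n)) x\<bar>)"
    unfolding L_def by (rule order_trans[OF sum_abs]) (intro sum_mono sum_abs)
  ultimately show ?thesis by (simp add: ac_simps)
qed

definition P2 :: "real^3 \<Rightarrow> real" where "P2 x = (\<Sum>k\<in>UNIV. D k u x * D k u x)"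

lemma C_P2: "C_k_on k P2 B8" unfolding P2_def[abs_def] by (intro C_intros C1)

lemma gr_u_bound: "x \<in> B8 \<Longrightarrow> \<bar>gr u x i\<bar> \<le> N" by (simp add: gr_def grad)

lemma sum_gr_u_sq: assumes "x \<in> B8" shows "(\<Sum>i\<in>UNIV. (gr u x i)\<^sup>2) \<le> 3 * N\<^sup>2"
  using inner_bound_3[of "gr u x" N "gr u x" N] gr_u_bound[OF assms] by (simp add: power2_eq_square mult.assoc)

lemma P2_bounds: "x \<in> B8 \<Longrightarrow> 0 \<le> P2 x \<and> P2 x \<le> 3 * N\<^sup>2"
  using sum_gr_u_sq[of x] by (auto simp: P2_def gr_def power2_eq_square sum_nonneg)

lemma D_P2: "x \<in> B8 \<Longrightarrow> D i P2 x = 2 * app (A x) (gr u x) i"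
  unfolding P2_def[abs_def] app_def gr_def A_def
  by (simp add: D_rules diff_rules C_diff[OF _ C1] sum_distrib_left ac_simps flip: mult_2)

lemma L_P2:
  assumes x: "x \<in> B8" shows "L P2 x = 2 * (3 * V x - tra x)"
proof -
  obtain E l where P: "slag_point c s (A x) E l" using pointE[OF x] by blast
  have d: "D k u differentiable at x" "(\<lambda>x. A x i j) differentiable at x" for k i j
    using C_diff[OF x C1] dA[OF x] by auto
  have DD: "D i (D j P2) x = 2 * (\<Sum>k\<in>UNIV. A x i k * A x j k + D k u x * T x i j k)" for i j
  proof -
    have "D i (D j P2) x = D i (\<lambda>x. 2 * (\<Sum>k\<in>UNIV. A x j k * D k u x)) x"
      by (rule D_cong_open[OF open_ball x]) (simp add: D_P2 app_def gr_def)
    also have "\<dots> = 2 * (\<Sum>k\<in>UNIV. T x j k i * D k u x + A x j k * A x i k)"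
      using d by (simp add: D_rules diff_rules DA) (simp add: A_def)
    also have "\<dots> = 2 * (\<Sum>k\<in>UNIV. A x i k * A x j k + D k u x * T x i j k)"
      using T_sym1[OF x] T_sym2[OF x] by (simp add: ac_simps)
    finally show ?thesis .
  qed
  have "L P2 x = 2 * (\<Sum>i\<in>UNIV. \<Sum>j\<in>UNIV. \<Sum>k\<in>UNIV. lin c s (A x) i j * (A x i k * A x j k + D k u x * T x i j k))"
    by (simp only: L_def DD sum_distrib_left mult.left_commute[of _ 2])
  also have "(\<Sum>i\<in>UNIV. \<Sum>j\<in>UNIV. \<Sum>k\<in>UNIV. lin c s (A x) i j * (A x i k * A x j k + D k u x * T x i j k))
     = (\<Sum>i\<in>UNIV. \<Sum>k\<in>UNIV. \<Sum>j\<in>UNIV. lin c s (A x) i j * (A x i k * A x j k + D k u x * T x i j k))"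
    by (intro sum.cong refl sum.swap)
  also have "\<dots> = (\<Sum>k\<in>UNIV. \<Sum>i\<in>UNIV. \<Sum>j\<in>UNIV. lin c s (A x) i j * (A x i k * A x j k + D k u x * T x i j k))"
    by (rule sum.swap)
  also have "\<dots> = (\<Sum>k\<in>UNIV. a x (\<lambda>i. A x i k) (\<lambda>i. A x i k)) + (\<Sum>k\<in>UNIV. D k u x * (\<Sum>i\<in>UNIV. \<Sum>j\<in>UNIV. lin c s (A x) i j * T x i j k))"
    by (simp add: qf_def distrib_left sum.distrib sum_distrib_left ac_simps)
  finally show ?thesis by (simp add: lin_T[OF x] lin_trace_sq[OF P] V_def tra_def)
qed

text \<open>The term \<open>3 * V x - tra x\<close>, the trace of \<open>lin A\<^sup>2\<close>, is produced by \<open>L P2\<close>. This trades the full volume density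
  for the trace of \<^const>\<open>lin\<close>, which involves only elementary symmetric functions of order at most two, at the price of
  a factor \<open>N\<^sup>2\<close>, and takes the place of a Sobolev inequality on the graph.\<close>

lemma L_test_function:
  assumes x: "x \<in> B8" and n: "n \<le> 6"
  shows "cut n x * (3 * V x - tra x) \<le> L (\<lambda>x. cut n x * P2 x) x + 117 * kappa * N\<^sup>2 * (cut (Suc n) x * tra x)"
proof -
  obtain E l where P: "slag_point c s (A x) E l" using pointE[OF x] by blast
  have e: "L (\<lambda>x. cut n x * P2 x) x = cut n x * (2 * (3 * V x - tra x)) + P2 x * L (cut n) x + 2 * a x (gr (cut n) x) (gr P2 x)"
    using L_mult[OF x C_cut_le C_P2, of n] by (simp add: L_P2[OF x])
  have grP: "gr P2 x = (\<lambda>i. 2 * app (A x) (gr u x) i)" by (auto simp: gr_def D_P2[OF x] gr_def[abs_def])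
  let ?q = "app (A x) (gr u x)" and ?y = "cut (Suc n) x * tra x"
  have tr2: "0 \<le> 3 * V x - tra x" using lin_trace_le_vol[OF P] by (simp add: V_def tra_def)
  have y0: "0 \<le> ?y" using cut_nonneg tra_pos[OF x] by (simp add: less_imp_le)
  have N2: "N\<^sup>2 > 0" using N by simp
  have q: "a x ?q ?q \<le> (3 * V x - tra x) * (3 * N\<^sup>2)"
  proof -
    have "a x ?q ?q \<le> (3 * V x - tra x) * (\<Sum>i\<in>UNIV. (gr u x i)\<^sup>2)"
      using qf_lin_app_upper[OF P, of "gr u x"] by (simp add: V_def tra_def)
    also have "\<dots> \<le> (3 * V x - tra x) * (3 * N\<^sup>2)" using tr2 sum_gr_u_sq[OF x] by (rule mult_left_mono[rotated])
    finally show ?thesis .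
  qed
  have 1: "- (4 * a x (gr (cut n) x) ?q) \<le> cut n x * (3 * V x - tra x) + 36 * kappa * N\<^sup>2 * ?y"
  proof (cases "cut n x = 0")
    case True
    then have "gr (cut n) x = (\<lambda>i. 0)"
      using cut_bounds(5)[OF n, of _ x] by (auto simp: gr_def)
    then have "a x (gr (cut n) x) ?q = 0" by (simp add: qf_def)
    then show ?thesis using True y0 N2 kappa_ge by simp
  next
    case False
    then have pos: "cut n x > 0" using cut_nonneg[of n x] by simp
    then have "norm x \<le> real (Suc n)" using cut_zero[of n x] by force
    then have c1: "1 \<le> cut (Suc n) x" by (rule cut_ge_1)
    \<comment> \<open>With this weight the gradient of \<open>P2\<close> uses up one of the two
      copies of \<open>cut n x * (3 * V x - tra x)\<close> supplied by \<open>L P2\<close>. The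
      division explains the separate case \<open>cut n x = 0\<close>, where the gradient of the
      cutoff vanishes as well.\<close>
    define t where "t = 6 * N\<^sup>2 / cut n x"
    have t: "t > 0" using pos N2 by (simp add: t_def)
    have "- (2 * a x (gr (cut n) x) ?q) \<le> t * a x (gr (cut n) x) (gr (cut n) x) + (1/t) * a x ?q ?q"
      by (rule qf_lin_young[OF P t])
    moreover have "t * a x (gr (cut n) x) (gr (cut n) x) \<le> 18 * kappa * N\<^sup>2 * ?y"
    proof -
      have "a x (gr (cut n) x) (gr (cut n) x) \<le> tra x * (\<Sum>i\<in>UNIV. (gr (cut n) x i)\<^sup>2)"
        using qf_lin_upper[OF P] by (simp add: tra_def)
      also have "\<dots> \<le> tra x * (\<Sum>i\<in>(UNIV::3 set). kappa * cut n x)"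
        using tra_pos[OF x] cut_bounds(5)[OF n] by (intro mult_left_mono sum_mono) (auto simp: gr_def)
      also have "\<dots> = 3 * kappa * cut n x * tra x" by simp
      finally have "t * a x (gr (cut n) x) (gr (cut n) x) \<le> t * (3 * kappa * cut n x * tra x)"
        using t by (intro mult_left_mono) auto
      also have "\<dots> = 18 * kappa * N\<^sup>2 * (1 * tra x)" using pos by (simp add: t_def)
      also have "\<dots> \<le> 18 * kappa * N\<^sup>2 * ?y"
        using c1 tra_pos[OF x] N2 kappa_ge by (intro mult_left_mono mult_right_mono) auto
      finally show ?thesis .
    qed
    moreover have "(1/t) * a x ?q ?q \<le> (1/2) * (cut n x * (3 * V x - tra x))"
    proof -
      have "(1/t) * a x ?q ?q \<le> (1/t) * ((3 * V x - tra x) * (3 * N\<^sup>2))" using t q by (intro mult_left_mono) auto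
      also have "\<dots> = (1/2) * (cut n x * (3 * V x - tra x))" using N2 by (simp add: t_def field_simps)
      finally show ?thesis .
    qed
    ultimately show ?thesis by linarith
  qed
  have 2: "- (P2 x * L (cut n) x) \<le> 81 * kappa * N\<^sup>2 * ?y"
  proof -
    have "- (P2 x * L (cut n) x) \<le> P2 x * \<bar>L (cut n) x\<bar>"
      using P2_bounds[OF x] by (metis abs_ge_minus_self mult_left_mono mult_minus_right)
    also have "\<dots> \<le> 3 * N\<^sup>2 * (27 * kappa * ?y)"
      using P2_bounds[OF x] L_cut_bound[OF x n] by (intro mult_mono) auto
    finally show ?thesis by (simp add: ac_simps)
  qed
  have "2 * a x (gr (cut n) x) (gr P2 x) = 4 * a x (gr (cut n) x) ?q"
    unfolding grP qf_cmult_right by simp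
  then show ?thesis unfolding e using 1 2 by (simp add: algebra_simps)
qed

text \<open>Green's identity moves \<open>L\<close> from the test function to the subharmonic
  \<open>f\<close>; there \<open>P2\<close> is replaced by its bound \<open>3 * N\<^sup>2\<close>,
  which is legitimate since \<open>L f\<close> is nonnegative. A second use of Green's identity
  moves \<open>L\<close> back onto the bare cutoff, where the trace of \<open>lin\<close> controls
  it.\<close>

lemma energy_estimate:
  assumes n: "n \<le> 5" and f: "C_k_on 2 f B8" "\<And>x. x \<in> B8 \<Longrightarrow> 0 \<le> f x" "\<And>x. x \<in> B8 \<Longrightarrow> 0 \<le> L f x"
  shows "Itg (\<lambda>x. cut n x * (f x * V x)) \<le> 200 * kappa * N\<^sup>2 * Itg (\<lambda>x. cut (Suc n) x * (f x * tra x))"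
proof -
  have n6: "n \<le> 6" using n by simp
  let ?J = "Itg (\<lambda>x. cut (Suc n) x * (f x * tra x))"
  have C0: "C_k_on 0 f B8" "C_k_on 0 (L f) B8" "C_k_on 2 (\<lambda>x. cut n x * P2 x) B8" "C_k_on 0 (L (\<lambda>x. cut n x * P2 x)) B8"
    "C_k_on 0 (L (cut n)) B8"
    using C_k_on_mono[OF f(1), of 0] C_L[of 0 f] f(1) C_L[of 0 "\<lambda>x. cut n x * P2 x"] C_L[of 0 "cut n"] C_intros(3)[OF C_cut_le[of 2 n] C_P2[of 2]] C_cut_le[of 2 n]
    by (simp_all add: numeral_2_eq_2 del: C_k_on.simps)
  have f_L: "0 \<le> f x * (cut (Suc n) x * tra x)" if "x \<in> B8" for x
    using f(2)[OF that] cut_nonneg tra_pos[OF that] by (simp add: less_imp_le)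
  have N2: "0 < N\<^sup>2" using N by simp
  have Z: "\<And>x. x \<in> B8 \<Longrightarrow> x \<notin> K7 \<Longrightarrow> cut n x = 0" using cut_outside[OF n6] by blast
  have 1: "Itg (\<lambda>x. cut n x * L f x) \<le> 27 * kappa * ?J"
  proof -
    have "Itg (\<lambda>x. cut n x * L f x) = Itg (\<lambda>x. f x * L (cut n) x)"
      by (rule green[OF C_cut_le f(1) Z]) simp
    also have "\<dots> \<le> Itg (\<lambda>x. 27 * kappa * (cut (Suc n) x * (f x * tra x)))"
    proof (rule Itg_mono[of 0 _ 0])
      fix x assume x: "x \<in> B8"
      have "f x * L (cut n) x \<le> f x * (27 * kappa * (cut (Suc n) x * tra x))"
        using L_cut_bound[OF x n6] f(2)[OF x] by (intro mult_left_mono) auto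
      then show "f x * L (cut n) x \<le> 27 * kappa * (cut (Suc n) x * (f x * tra x))" by (simp add: ac_simps)
    qed (intro C_intros C0 C_facts; simp)+
    finally show ?thesis by (simp only: Itg_cmult)
  qed
  have 2: "Itg (\<lambda>x. f x * L (\<lambda>x. cut n x * P2 x) x) \<le> 3 * N\<^sup>2 * Itg (\<lambda>x. cut n x * L f x)"
  proof -
    have "Itg (\<lambda>x. f x * L (\<lambda>x. cut n x * P2 x) x) = Itg (\<lambda>x. (cut n x * P2 x) * L f x)"
      by (rule green[OF C0(3) f(1), symmetric]) (simp add: Z)
    also have "\<dots> \<le> Itg (\<lambda>x. 3 * N\<^sup>2 * (cut n x * L f x))"
    proof (rule Itg_mono[of 0 _ 0])
      fix x assume x: "x \<in> B8"
      have "P2 x * (cut n x * L f x) \<le> 3 * N\<^sup>2 * (cut n x * L f x)"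
        using P2_bounds[OF x] f(3)[OF x] cut_nonneg by (intro mult_right_mono) auto
      then show "cut n x * P2 x * L f x \<le> 3 * N\<^sup>2 * (cut n x * L f x)" by (simp add: ac_simps)
    qed (intro C_intros C0 C_facts C_P2; simp)+
    finally show ?thesis by (simp only: Itg_cmult)
  qed
  have "3 * Itg (\<lambda>x. cut n x * (f x * V x)) = Itg (\<lambda>x. 3 * (cut n x * (f x * V x)))" by (simp only: Itg_cmult)
  also have "\<dots> \<le> Itg (\<lambda>x. f x * L (\<lambda>x. cut n x * P2 x) x + (118 * kappa * N\<^sup>2) * (cut (Suc n) x * (f x * tra x)))"
  proof (rule Itg_mono[of 0 _ 0])
    fix x assume x: "x \<in> B8"
    have "cut n x * tra x \<le> kappa * cut (Suc n) x * tra x"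
      using cut_bounds(2)[OF n6] tra_pos[OF x] by (intro mult_right_mono) auto
    also have "\<dots> \<le> kappa * N\<^sup>2 * (cut (Suc n) x * tra x)"
    proof -
      have "kappa * (cut (Suc n) x * tra x) * 1 \<le> kappa * (cut (Suc n) x * tra x) * N\<^sup>2"
        using kappa_ge cut_nonneg[of "Suc n" x] tra_pos[OF x] N by (intro mult_left_mono) (auto simp: one_le_power)
      then show ?thesis by (simp add: ac_simps)
    qed
    finally have "cut n x * (3 * V x) \<le> L (\<lambda>x. cut n x * P2 x) x + 118 * kappa * N\<^sup>2 * (cut (Suc n) x * tra x)"
      using L_test_function[OF x n6] by (simp add: algebra_simps)
    from mult_left_mono[OF this f(2)[OF x]]
    show "3 * (cut n x * (f x * V x)) \<le> f x * L (\<lambda>x. cut n x * P2 x) x + (118 * kappa * N\<^sup>2) * (cut (Suc n) x * (f x * tra x))"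
      by (simp add: algebra_simps)
  qed (intro C_intros C0 C_facts; simp)+
  also have "\<dots> = Itg (\<lambda>x. f x * L (\<lambda>x. cut n x * P2 x) x) + (118 * kappa * N\<^sup>2) * ?J"
    by (subst Itg_add[of 0 _ 0]) (simp only: Itg_cmult | intro C_intros C0 C_facts; simp)+
  also have "\<dots> \<le> 3 * N\<^sup>2 * (27 * kappa * ?J) + (118 * kappa * N\<^sup>2) * ?J"
  proof -
    have "3 * N\<^sup>2 * Itg (\<lambda>x. cut n x * L f x) \<le> 3 * N\<^sup>2 * (27 * kappa * ?J)"
      using N2 by (intro mult_left_mono 1) simp
    then show ?thesis using 2 by linarith
  qed
  \<comment> \<open>199 is 3 * 27 + 118.\<close>
  finally have "3 * Itg (\<lambda>x. cut n x * (f x * V x)) \<le> 199 * (kappa * N\<^sup>2 * ?J)" by (simp add: algebra_simps)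
  moreover have "0 \<le> kappa * N\<^sup>2 * ?J"
  proof -
    have "Itg (\<lambda>x. 0) \<le> ?J"
      by (rule Itg_mono[of 0 _ 0]) (use f_L in \<open>auto intro!: C_intros C0 C_facts simp: ac_simps simp del: C_k_on.simps\<close>)
    then have "0 \<le> ?J" by (simp add: Itg_def)
    then show ?thesis using N2 kappa_ge by simp
  qed
  ultimately have "Itg (\<lambda>x. cut n x * (f x * V x)) \<le> 200 * (kappa * N\<^sup>2 * ?J)" by linarith
  then show ?thesis by (simp add: ac_simps)
qed

end

section \<open>Integral bounds as powers of the gradient bound\<close>

context slag
begin

text \<open>The ledger of the bounds: powers of the cutoff constant and of \<open>N\<close>, times
  the volume of the ball of radius 7. The second index at the end is the exponent in the final
  estimate.\<close>

definition M :: "nat \<Rightarrow> nat \<Rightarrow> real" where "M i j = kappa ^ i * N ^ j * Itg (\<lambda>x. 1)"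

lemma Itg_one_nonneg: "0 \<le> Itg (\<lambda>x. 1)"
proof -
  have "Itg (\<lambda>x. 0) \<le> Itg (\<lambda>x. 1)" by (rule Itg_mono[of 0 _ 0]) (auto intro: C_k_on_const)
  then show ?thesis by (simp add: Itg_def)
qed

lemma M_nonneg: "0 \<le> M i j" using kappa_ge N Itg_one_nonneg by (simp add: M_def)

lemma M_mono: "i \<le> i' \<Longrightarrow> j \<le> j' \<Longrightarrow> M i j \<le> M i' j'"
  unfolding M_def using kappa_ge N Itg_one_nonneg
  by (intro mult_right_mono mult_mono power_increasing) auto

lemma kappa_M: "kappa * M i j = M (Suc i) j"
  by (simp add: M_def)

lemma kappa_N_M: "kappa * N * M i j = M (Suc i) (Suc j)" and N2_M: "N\<^sup>2 * M i j = M i (Suc (Suc j))"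
  by (simp_all add: M_def power2_eq_square)

lemma gr_cut_bound: "n \<le> 6 \<Longrightarrow> \<bar>gr (cut n) x i\<bar> \<le> kappa * cut (Suc n) x"
  unfolding gr_def by (rule cut_bounds(4))

lemma bound_w:
  assumes n: "n \<le> 5" shows "Itg (\<lambda>x. cut n x * w x) \<le> 3 * M 2 1"
proof -
  have n': "n \<le> 6" "Suc n \<le> 6" using n by auto
  have "Itg (\<lambda>x. cut n x * w x) = Itg (\<lambda>x. - (\<Sum>i\<in>UNIV. gr (cut n) x i * gr u x i))"
    by (rule parts_w[OF C_cut_le]) (use cut_outside[OF n'(1)] in auto)
  also have "\<dots> \<le> Itg (\<lambda>x. (3 * kappa\<^sup>2 * N) * 1)"
  proof (rule Itg_mono[of 0 _ 0])
    fix x assume x: "x \<in> B8"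
    have "\<bar>gr (cut n) x i\<bar> \<le> kappa\<^sup>2" for i
    proof -
      have "kappa * cut (Suc n) x \<le> kappa * kappa" using cut_bounds(1)[OF n'(2)] kappa_ge by (intro mult_left_mono) auto
      then show ?thesis using gr_cut_bound[OF n'(1), of x i] by (simp add: power2_eq_square)
    qed
    from inner_bound_3[of "gr (cut n) x" "kappa\<^sup>2" "gr u x" N, OF this gr_u_bound[OF x]]
    show "- (\<Sum>i\<in>UNIV. gr (cut n) x i * gr u x i) \<le> (3 * kappa\<^sup>2 * N) * 1" by linarith
  qed (intro C_intros C_gr C_cut_le Cu; simp)+
  also have "\<dots> = 3 * M 2 1" by (simp only: Itg_cmult M_def) simp
  finally show ?thesis .
qed

text \<open>After integration by parts \<open>nw\<close> meets the gradient of the cutoff and Du.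
  Its eigenvalues are at most 2 sigma_1, so the bound costs one more power of \<open>N\<close> than
  that for sigma_1.\<close>

lemma bound_sg2:
  assumes n: "n \<le> 4" shows "Itg (\<lambda>x. 2 * cut n x * sg2 (A x)) \<le> 18 * M 3 2"
proof -
  have n': "n \<le> 6" "Suc n \<le> 5" using n by auto
  have "Itg (\<lambda>x. 2 * cut n x * sg2 (A x)) = Itg (\<lambda>x. - qf (nw (A x)) (gr (cut n) x) (gr u x))"
    by (rule parts_sg2[OF C_cut_le]) (use cut_outside[OF n'(1)] in auto)
  also have "\<dots> \<le> Itg (\<lambda>x. (6 * (kappa * N)) * (cut (Suc n) x * w x))"
  proof (rule Itg_mono[of 0 _ 0])
    fix x assume x: "x \<in> B8"
    obtain E l where P: "slag_point c s (A x) E l" using pointE[OF x] by blast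
    have "\<bar>qf (nw (A x)) (gr (cut n) x) (gr u x)\<bar> \<le> 6 * sg1 (A x) * (kappa * cut (Suc n) x) * N"
      by (rule nw_entry_bound[OF P gr_cut_bound[OF n'(1)] gr_u_bound[OF x]])
    then show "- qf (nw (A x)) (gr (cut n) x) (gr u x) \<le> (6 * (kappa * N)) * (cut (Suc n) x * w x)"
      by (simp add: w_def ac_simps)
  qed (intro C_intros C_gr C_qf C_facts Cu; simp)+
  also have "\<dots> = 6 * (kappa * N * Itg (\<lambda>x. cut (Suc n) x * w x))" by (simp only: Itg_cmult mult.assoc)
  also have "\<dots> \<le> 6 * (kappa * N * (3 * M 2 1))"
    using bound_w[OF n'(2)] kappa_ge N by (intro mult_left_mono) auto
  also have "\<dots> = 18 * (kappa * N * M 2 1)" by simp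
  also have "\<dots> = 18 * M 3 2" unfolding kappa_N_M by (simp add: numeral_eq_Suc)
  finally show ?thesis .
qed

lemma tra_le: "x \<in> B8 \<Longrightarrow> tra x \<le> sg2 (A x) + 2 * w x"
  by (metis pointE lin_trace_le tra_def w_def)

lemma bound_tra:
  assumes n: "n \<le> 4" shows "Itg (\<lambda>x. cut n x * tra x) \<le> 15 * M 3 2"
proof -
  have "Itg (\<lambda>x. cut n x * tra x) \<le> Itg (\<lambda>x. (1/2) * (2 * cut n x * sg2 (A x)) + 2 * (cut n x * w x))"
  proof (rule Itg_mono[of 0 _ 0])
    fix x assume x: "x \<in> B8"
    show "cut n x * tra x \<le> (1/2) * (2 * cut n x * sg2 (A x)) + 2 * (cut n x * w x)"
      using mult_left_mono[OF tra_le[OF x] cut_nonneg[of n x]] by (simp add: algebra_simps)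
  qed (intro C_intros C_facts; simp)+
  also have "\<dots> = (1/2) * Itg (\<lambda>x. 2 * cut n x * sg2 (A x)) + 2 * Itg (\<lambda>x. cut n x * w x)"
    by (subst Itg_add[of 0 _ 0]) (simp only: Itg_cmult | intro C_intros C_facts; simp)+
  also have "\<dots> \<le> 15 * M 3 2"
    using bound_sg2[OF n] bound_w[of n] n M_mono[of 2 3 1 2] by simp
  finally show ?thesis .
qed

text \<open>A Caccioppoli argument: the Jacobi inequality is tested with the square of the next
  cutoff, and the resulting gradient term of \<open>b\<close> is absorbed on the left.\<close>

lemma bound_gr_b:
  assumes n: "n \<le> 3" shows "Itg (\<lambda>x. cut n x * a x (gr b x) (gr b x)) \<le> 1620 * M 5 2"
proof -
  let ?n = "Suc n" let ?h = "cut (Suc n)" and ?ab = "\<lambda>x. a x (gr b x) (gr b x)"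
  have n': "n \<le> 6" "?n \<le> 6" "?n \<le> 4" using n by auto
  let ?X = "Itg (\<lambda>x. (?h x * ?h x) * ?ab x)" and ?Y = "Itg (\<lambda>x. a x (gr ?h x) (gr ?h x))"
  note Cs = C_intros C_gr C_qf C_facts Cb C_L[of 0 b]
  have "(1/3) * ?X = Itg (\<lambda>x. (1/3) * ((?h x * ?h x) * ?ab x))" by (simp only: Itg_cmult)
  also have "\<dots> \<le> Itg (\<lambda>x. (?h x * ?h x) * L b x)"
  proof (rule Itg_mono[of 0 _ 0])
    fix x assume x: "x \<in> B8"
    have "(?h x * ?h x) * ((1/3) * ?ab x) \<le> (?h x * ?h x) * L b x"
      by (intro mult_left_mono jacobi_b x) simp
    then show "(1/3) * ((?h x * ?h x) * ?ab x) \<le> (?h x * ?h x) * L b x" by simp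
  qed (intro Cs; simp)+
  also have "\<dots> = Itg (\<lambda>x. - a x (gr (\<lambda>x. ?h x * ?h x) x) (gr b x))"
    by (rule parts_L[OF _ Cb]) (use cut_outside[OF n'(2)] in \<open>auto intro!: C_intros C_cut_le simp del: C_k_on.simps\<close>)
  \<comment> \<open>The Young weight 6 returns 1/6 of the energy, half of the available 1/3.\<close>
  also have "\<dots> \<le> Itg (\<lambda>x. 6 * a x (gr ?h x) (gr ?h x) + (1/6) * ((?h x * ?h x) * ?ab x))"
  proof (rule Itg_mono[of 0 _ 0])
    fix x assume x: "x \<in> B8"
    obtain E l where P: "slag_point c s (A x) E l" using pointE[OF x] by blast
    have g: "gr (\<lambda>x. ?h x * ?h x) x = (\<lambda>i. (2 * ?h x) * gr ?h x i)"
      by (subst gr_mult[OF x C_cut_le C_cut_le]) (auto simp: algebra_simps)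
    show "- a x (gr (\<lambda>x. ?h x * ?h x) x) (gr b x) \<le> 6 * a x (gr ?h x) (gr ?h x) + (1/6) * ((?h x * ?h x) * ?ab x)"
      using qf_lin_young[OF P, of 6 "gr ?h x" "\<lambda>i. ?h x * gr b x i"]
      unfolding g qf_cmult_left qf_cmult_right by (simp add: ac_simps)
  qed (intro Cs; simp)+
  also have "\<dots> = 6 * ?Y + (1/6) * ?X"
    by (subst Itg_add[of 0 _ 0]) (simp only: Itg_cmult | intro Cs; simp)+
  finally have X: "?X \<le> 36 * ?Y" by simp
  have "?Y \<le> Itg (\<lambda>x. (3 * kappa) * (?h x * tra x))"
  proof (rule Itg_mono[of 0 _ 0])
    fix x assume x: "x \<in> B8"
    obtain E l where P: "slag_point c s (A x) E l" using pointE[OF x] by blast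
    have "a x (gr ?h x) (gr ?h x) \<le> tra x * (\<Sum>i\<in>UNIV. (gr ?h x i)\<^sup>2)"
      using qf_lin_upper[OF P] by (simp add: tra_def)
    also have "\<dots> \<le> tra x * (\<Sum>i\<in>(UNIV::3 set). kappa * ?h x)"
      using tra_pos[OF x] cut_bounds(5)[OF n'(2)] by (intro mult_left_mono sum_mono) (auto simp: gr_def)
    finally show "a x (gr ?h x) (gr ?h x) \<le> (3 * kappa) * (?h x * tra x)" by (simp add: ac_simps)
  qed (intro Cs; simp)+
  also have "\<dots> = 3 * (kappa * Itg (\<lambda>x. ?h x * tra x))" by (simp only: Itg_cmult mult.assoc)
  also have "\<dots> \<le> 3 * (kappa * (15 * M 3 2))"
    using bound_tra[OF n'(3)] kappa_ge by (intro mult_left_mono) auto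
  also have "\<dots> = 45 * (kappa * M 3 2)" by simp
  finally have X2: "?X \<le> 1620 * (kappa * M 3 2)" using X by linarith
  have "Itg (\<lambda>x. cut n x * ?ab x) \<le> Itg (\<lambda>x. kappa * ((?h x * ?h x) * ?ab x))"
  proof (rule Itg_mono[of 0 _ 0])
    fix x assume x: "x \<in> B8"
    obtain E l where P: "slag_point c s (A x) E l" using pointE[OF x] by blast
    have "cut n x * ?ab x \<le> kappa * (?h x)\<^sup>2 * ?ab x"
      using cut_bounds(3)[OF n'(1)] qf_lin_nonneg[OF P] by (intro mult_right_mono) auto
    then show "cut n x * ?ab x \<le> kappa * ((?h x * ?h x) * ?ab x)" by (simp add: power2_eq_square mult.assoc)
  qed (intro Cs; simp)+
  also have "\<dots> = kappa * ?X" by (simp only: Itg_cmult)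
  also have "\<dots> \<le> kappa * (1620 * (kappa * M 3 2))" using X2 kappa_ge by (intro mult_left_mono) auto
  also have "\<dots> = 1620 * (kappa * (kappa * M 3 2))" by simp
  also have "\<dots> = 1620 * M 5 2" unfolding kappa_M by (simp add: numeral_eq_Suc)
  finally show ?thesis .
qed

lemma L_const: "L (\<lambda>x. r) x = 0"
proof -
  have "D i (\<lambda>x. r) = (\<lambda>x. 0)" for i :: 3 by (rule ext) simp
  then show ?thesis by (simp add: L_def)
qed

lemma bound_V:
  assumes n: "n \<le> 3" shows "Itg (\<lambda>x. cut n x * V x) \<le> 3000 * M 4 4"
proof -
  have "Itg (\<lambda>x. cut n x * (1 * V x)) \<le> 200 * kappa * N\<^sup>2 * Itg (\<lambda>x. cut (Suc n) x * (1 * tra x))"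
    by (rule energy_estimate) (use n in \<open>auto intro: C_k_on_const simp: L_const simp del: C_k_on.simps\<close>)
  also have "\<dots> = 200 * kappa * N\<^sup>2 * Itg (\<lambda>x. cut (Suc n) x * tra x)" by simp
  also have "\<dots> \<le> 200 * kappa * N\<^sup>2 * (15 * M 3 2)"
    using bound_tra[of "Suc n"] n kappa_ge by (intro mult_left_mono) auto
  also have "\<dots> = 3000 * (N\<^sup>2 * (kappa * M 3 2))" by simp
  also have "\<dots> = 3000 * M 4 4" unfolding kappa_M N2_M by (simp add: numeral_eq_Suc)
  finally show ?thesis by simp
qed

text \<open>The energy of \<open>b\<close> has size N^2 and the volume N^4. Young's inequality with
  weight \<open>N\<^sup>2\<close> balances them: the energy is raised to N^4, and the squared
  gradient of \<open>u\<close> divided by the weight leaves only a constant in front of the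
  volume.\<close>

lemma bound_young:
  assumes n: "n \<le> 3"
  shows "Itg (\<lambda>x. cut n x * (N\<^sup>2 * a x (gr b x) (gr b x) + 3 * V x)) \<le> 10620 * M 5 4"
proof -
  have "Itg (\<lambda>x. cut n x * (N\<^sup>2 * a x (gr b x) (gr b x) + 3 * V x))
     = Itg (\<lambda>x. N\<^sup>2 * (cut n x * a x (gr b x) (gr b x)) + 3 * (cut n x * V x))"
    by (simp add: algebra_simps)
  also have "\<dots> = N\<^sup>2 * Itg (\<lambda>x. cut n x * a x (gr b x) (gr b x)) + 3 * Itg (\<lambda>x. cut n x * V x)"
    by (subst Itg_add[of 0 _ 0]) (simp only: Itg_cmult | intro C_intros C_gr C_qf C_facts Cb; simp)+
  also have "\<dots> \<le> N\<^sup>2 * (1620 * M 5 2) + 3 * (3000 * M 4 4)"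
    using bound_gr_b[OF n] bound_V[OF n] by (intro add_mono mult_left_mono) auto
  also have "\<dots> = 1620 * (N\<^sup>2 * M 5 2) + 9000 * M 4 4" by simp
  also have "\<dots> \<le> 10620 * M 5 4" unfolding N2_M using M_mono[of 4 5 4 4] by (simp add: numeral_eq_Suc)
  finally show ?thesis .
qed

lemma young_weight: 
  assumes x: "x \<in> B8"
  shows "V x / N\<^sup>2 * (\<Sum>i\<in>UNIV. (gr u x i)\<^sup>2) \<le> 3 * V x"
proof -
  have N2: "N\<^sup>2 > 0" using N by simp
  have "V x / N\<^sup>2 * (\<Sum>i\<in>UNIV. (gr u x i)\<^sup>2) \<le> V x / N\<^sup>2 * (3 * N\<^sup>2)"
    using V_pos[OF x] sum_gr_u_sq[OF x] by (intro mult_left_mono) auto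
  also have "\<dots> = 3 * V x" using N2 by simp
  finally show ?thesis .
qed

lemma gr_cut_b:
  assumes x: "x \<in> B8"
  shows "gr (\<lambda>x. cut n x * b x) x = (\<lambda>i. b x * gr (cut n) x i + cut n x * gr b x i)"
  by (rule gr_mult[OF x C_cut_le Cb]) simp

text \<open>Where the derivative falls on the cutoff, \<open>b \<le> w\<close> reduces the term to
  the integral of sigma_1; where it falls on \<open>b\<close>, the balanced Young inequality
  applies.\<close>

lemma bound_b_w:
  assumes n: "n \<le> 3" shows "Itg (\<lambda>x. cut n x * b x * w x) \<le> 11000 * M 5 4"
proof -
  have n': "n \<le> 6" "Suc n \<le> 5" using n by auto
  note Cs = C_intros C_gr C_qf C_facts Cb Cu
  have "Itg (\<lambda>x. cut n x * b x * w x) = Itg (\<lambda>x. - (\<Sum>i\<in>UNIV. gr (\<lambda>x. cut n x * b x) x i * gr u x i))"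
    by (rule parts_w) (use cut_outside[OF n'(1)] in \<open>auto intro!: C_intros C_cut_le Cb simp del: C_k_on.simps\<close>)
  also have "\<dots> \<le> Itg (\<lambda>x. (3 * (kappa * N)) * (cut (Suc n) x * w x) + cut n x * (N\<^sup>2 * a x (gr b x) (gr b x) + 3 * V x))"
  proof (rule Itg_mono[of 0 _ 0])
    fix x assume x: "x \<in> B8"
    obtain E l where P: "slag_point c s (A x) E l" using pointE[OF x] by blast
    have 1: "- (b x * (\<Sum>i\<in>UNIV. gr (cut n) x i * gr u x i)) \<le> w x * (3 * (kappa * cut (Suc n) x) * N)"
    proof -
      have "- (b x * (\<Sum>i\<in>UNIV. gr (cut n) x i * gr u x i)) \<le> b x * \<bar>\<Sum>i\<in>UNIV. gr (cut n) x i * gr u x i\<bar>"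
        using b_nonneg[OF x] by (metis abs_ge_minus_self mult_left_mono mult_minus_right)
      also have "\<dots> \<le> w x * (3 * (kappa * cut (Suc n) x) * N)"
        using b_nonneg[OF x] b_le[OF x] w_ge[OF x] inner_bound_3[OF gr_cut_bound[OF n'(1)] gr_u_bound[OF x]]
        by (intro mult_mono) auto
      finally show ?thesis .
    qed
    have 2: "- (\<Sum>i\<in>UNIV. gr b x i * gr u x i) \<le> N\<^sup>2 * a x (gr b x) (gr b x) + 3 * V x"
      using inner_young[OF P, of "N\<^sup>2" "\<lambda>i. - gr b x i" "gr u x"] young_weight[OF x] N
      by (simp add: sum_negf qf_minus_left qf_cmult_right[of _ _ "-1", simplified] V_def)
    have "- (\<Sum>i\<in>UNIV. gr (\<lambda>x. cut n x * b x) x i * gr u x i)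
      = - (b x * (\<Sum>i\<in>UNIV. gr (cut n) x i * gr u x i)) + cut n x * (- (\<Sum>i\<in>UNIV. gr b x i * gr u x i))"
      unfolding gr_cut_b[OF x] by (simp add: sum.distrib sum_distrib_left algebra_simps)
    also have "\<dots> \<le> w x * (3 * (kappa * cut (Suc n) x) * N) + cut n x * (N\<^sup>2 * a x (gr b x) (gr b x) + 3 * V x)"
      by (intro add_mono mult_left_mono 1 2 cut_nonneg)
    finally show "- (\<Sum>i\<in>UNIV. gr (\<lambda>x. cut n x * b x) x i * gr u x i) \<le> (3 * (kappa * N)) * (cut (Suc n) x * w x) + cut n x * (N\<^sup>2 * a x (gr b x) (gr b x) + 3 * V x)"
      by (simp add: ac_simps)
  qed (intro Cs; simp)+
  also have "\<dots> = 3 * (kappa * N * Itg (\<lambda>x. cut (Suc n) x * w x)) + Itg (\<lambda>x. cut n x * (N\<^sup>2 * a x (gr b x) (gr b x) + 3 * V x))"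
    by (subst Itg_add[of 0 _ 0]) (simp only: Itg_cmult mult.assoc | intro Cs; simp)+
  also have "\<dots> \<le> 3 * (kappa * N * (3 * M 2 1)) + 10620 * M 5 4"
    using bound_w[OF n'(2)] bound_young[OF n] kappa_ge N by (intro add_mono mult_left_mono) auto
  also have "\<dots> = 9 * (kappa * N * M 2 1) + 10620 * M 5 4" by simp
  also have "\<dots> \<le> 11000 * M 5 4" unfolding kappa_N_M using M_mono[of 3 5 2 4] M_nonneg[of 5 4] by (simp add: numeral_eq_Suc)
  finally show ?thesis .
qed

text \<open>The scheme is that for b sigma_1 with \<open>nw\<close> in place of the identity; the
  derivative of the cutoff now produces b sigma_1, already bounded by N^4, and one factor
  \<open>N\<close>.\<close>

lemma bound_b_sg2:
  assumes n: "n \<le> 2" shows "Itg (\<lambda>x. 2 * (cut n x * b x) * sg2 (A x)) \<le> 77000 * M 6 5"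
proof -
  have n': "n \<le> 6" "Suc n \<le> 3" "n \<le> 3" using n by auto
  note Cs = C_intros C_gr C_qf C_facts Cb Cu
  have "Itg (\<lambda>x. 2 * (cut n x * b x) * sg2 (A x)) = Itg (\<lambda>x. - qf (nw (A x)) (gr (\<lambda>x. cut n x * b x) x) (gr u x))"
    by (rule parts_sg2) (use cut_outside[OF n'(1)] in \<open>auto intro!: C_intros C_cut_le Cb simp del: C_k_on.simps\<close>)
  also have "\<dots> \<le> Itg (\<lambda>x. (6 * (kappa * N)) * (cut (Suc n) x * b x * w x) + cut n x * (N\<^sup>2 * a x (gr b x) (gr b x) + 3 * V x))"
  proof (rule Itg_mono[of 0 _ 0])
    fix x assume x: "x \<in> B8"
    obtain E l where P: "slag_point c s (A x) E l" using pointE[OF x] by blast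
    have 1: "- (b x * qf (nw (A x)) (gr (cut n) x) (gr u x)) \<le> b x * (6 * sg1 (A x) * (kappa * cut (Suc n) x) * N)"
    proof -
      have "- (b x * qf (nw (A x)) (gr (cut n) x) (gr u x)) \<le> b x * \<bar>qf (nw (A x)) (gr (cut n) x) (gr u x)\<bar>"
        using b_nonneg[OF x] by (metis abs_ge_minus_self mult_left_mono mult_minus_right)
      also have "\<dots> \<le> b x * (6 * sg1 (A x) * (kappa * cut (Suc n) x) * N)"
        by (intro mult_left_mono b_nonneg x nw_entry_bound[OF P gr_cut_bound[OF n'(1)] gr_u_bound[OF x]])
      finally show ?thesis .
    qed
    have 2: "- qf (nw (A x)) (gr b x) (gr u x) \<le> N\<^sup>2 * a x (gr b x) (gr b x) + 3 * V x"
      using nw_young[OF P, of "N\<^sup>2" "\<lambda>i. - gr b x i" "gr u x"] young_weight[OF x] N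
      by (simp add: qf_minus_left qf_cmult_right[of _ _ "-1", simplified] V_def)
    have "- qf (nw (A x)) (gr (\<lambda>x. cut n x * b x) x) (gr u x)
      = - (b x * qf (nw (A x)) (gr (cut n) x) (gr u x)) + cut n x * (- qf (nw (A x)) (gr b x) (gr u x))"
      unfolding gr_cut_b[OF x] qf_add_left qf_cmult_left by simp
    also have "\<dots> \<le> b x * (6 * sg1 (A x) * (kappa * cut (Suc n) x) * N) + cut n x * (N\<^sup>2 * a x (gr b x) (gr b x) + 3 * V x)"
      by (intro add_mono mult_left_mono 1 2 cut_nonneg)
    finally show "- qf (nw (A x)) (gr (\<lambda>x. cut n x * b x) x) (gr u x) \<le> (6 * (kappa * N)) * (cut (Suc n) x * b x * w x) + cut n x * (N\<^sup>2 * a x (gr b x) (gr b x) + 3 * V x)"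
      by (simp add: w_def ac_simps)
  qed (intro Cs; simp)+
  also have "\<dots> = 6 * (kappa * N * Itg (\<lambda>x. cut (Suc n) x * b x * w x)) + Itg (\<lambda>x. cut n x * (N\<^sup>2 * a x (gr b x) (gr b x) + 3 * V x))"
    by (subst Itg_add[of 0 _ 0]) (simp only: Itg_cmult mult.assoc | intro Cs; simp)+
  also have "\<dots> \<le> 6 * (kappa * N * (11000 * M 5 4)) + 10620 * M 5 4"
    using bound_b_w[OF n'(2)] bound_young[OF n'(3)] kappa_ge N by (intro add_mono mult_left_mono) auto
  also have "\<dots> = 66000 * (kappa * N * M 5 4) + 10620 * M 5 4" by simp
  also have "\<dots> \<le> 77000 * M 6 5" unfolding kappa_N_M using M_mono[of 5 6 4 5] M_nonneg[of 6 5] by (simp add: numeral_eq_Suc)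
  finally show ?thesis .
qed

lemma bound_b_tra:
  assumes n: "n \<le> 2" shows "Itg (\<lambda>x. cut n x * (b x * tra x)) \<le> 61000 * M 6 5"
proof -
  have n': "n \<le> 3" using n by simp
  note Cs = C_intros C_gr C_qf C_facts Cb Cu
  have "Itg (\<lambda>x. cut n x * (b x * tra x)) \<le> Itg (\<lambda>x. (1/2) * (2 * (cut n x * b x) * sg2 (A x)) + 2 * (cut n x * b x * w x))"
  proof (rule Itg_mono[of 0 _ 0])
    fix x assume x: "x \<in> B8"
    show "cut n x * (b x * tra x) \<le> (1/2) * (2 * (cut n x * b x) * sg2 (A x)) + 2 * (cut n x * b x * w x)"
      using mult_left_mono[OF tra_le[OF x] mult_nonneg_nonneg[OF cut_nonneg[of n x] b_nonneg[OF x]]]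
      by (simp add: algebra_simps)
  qed (intro Cs; simp)+
  also have "\<dots> = (1/2) * Itg (\<lambda>x. 2 * (cut n x * b x) * sg2 (A x)) + 2 * Itg (\<lambda>x. cut n x * b x * w x)"
    by (subst Itg_add[of 0 _ 0]) (simp only: Itg_cmult | intro Cs; simp)+
  also have "\<dots> \<le> 61000 * M 6 5"
    using bound_b_sg2[OF n] bound_b_w[OF n'] M_mono[of 5 6 4 5] M_nonneg[of 6 5] by simp
  finally show ?thesis .
qed

lemma L_b_nonneg: "x \<in> B8 \<Longrightarrow> 0 \<le> L b x"
  by (metis jacobi_b pointE qf_lin_nonneg order_trans mult_nonneg_nonneg zero_le_divide_1_iff zero_le_numeral)

lemma bound_b_V: "Itg (\<lambda>x. cut 1 x * (b x * V x)) \<le> 12200000 * M 7 7"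
proof -
  have "Itg (\<lambda>x. cut 1 x * (b x * V x)) \<le> 200 * kappa * N\<^sup>2 * Itg (\<lambda>x. cut (Suc 1) x * (b x * tra x))"
    by (rule energy_estimate[OF _ Cb b_nonneg L_b_nonneg]) auto
  also have "\<dots> \<le> 200 * kappa * N\<^sup>2 * (61000 * M 6 5)"
    using bound_b_tra[of "Suc 1"] kappa_ge by (intro mult_left_mono) auto
  also have "\<dots> = 12200000 * (N\<^sup>2 * (kappa * M 6 5))" by simp
  also have "\<dots> = 12200000 * M 7 7" unfolding kappa_M N2_M by (simp add: numeral_eq_Suc)
  finally show ?thesis .
qed

end

section \<open>The mean value inequality\<close>

text \<open>A regularisation of the Newtonian kernel \<open>1/|X|\<close> of three-space as a function of \<open>t = |X|\<^sup>2\<close>, cut off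
  at \<open>t = 1\<close>, with its first two derivatives.\<close>

definition nk0 :: "real \<Rightarrow> real \<Rightarrow> real" where
  "nk0 e t = max 0 (1 - t) ^ 3 * inverse (sqrt (t + e))"
definition nk1 :: "real \<Rightarrow> real \<Rightarrow> real" where
  "nk1 e t = - 3 * max 0 (1 - t) ^ 2 * inverse (sqrt (t + e)) - max 0 (1 - t) ^ 3 * inverse (sqrt (t + e)) ^ 3 / 2"
definition nk2 :: "real \<Rightarrow> real \<Rightarrow> real" where
  "nk2 e t = 6 * max 0 (1 - t) * inverse (sqrt (t + e)) + 3 * max 0 (1 - t) ^ 2 * inverse (sqrt (t + e)) ^ 3
     + 3/4 * max 0 (1 - t) ^ 3 * inverse (sqrt (t + e)) ^ 5"
text \<open>In three-space, 3 e (|X|^2 + e)^(-5/2) is minus the Laplacian of (|X|^2 + e)^(-1/2), an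
  approximation of a point mass spread over distance sqrt e; here it carries the same cutoff as the
  kernel.\<close>

definition delta_kernel :: "real \<Rightarrow> real \<Rightarrow> real" where
  "delta_kernel e t = 3 * e * max 0 (1 - t) ^ 3 * inverse (sqrt (t + e)) ^ 5"

lemma DERIV_inverse_sqrt_shift:
  assumes "t + e > 0"
  shows "((\<lambda>t. inverse (sqrt (t + e))) has_real_derivative - (inverse (sqrt (t + e)) ^ 3) / 2) (at t)"
proof -
  let ?s = "sqrt (t + e)"
  have s: "?s > 0" using assms by simp
  have "((\<lambda>t. sqrt (t + e)) has_real_derivative (inverse ?s / 2) * 1) (at t)"
    by (rule DERIV_chain2[OF DERIV_real_sqrt]) (use assms in \<open>auto intro!: derivative_eq_intros\<close>)
  from DERIV_inverse'[OF this less_imp_neq[OF s, THEN not_sym]]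
  have H: "((\<lambda>t. inverse (sqrt (t + e))) has_real_derivative - (inverse ?s * (inverse ?s / 2 * 1) * inverse ?s)) (at t)" .
  have gen: "- (q * (q / 2 * 1) * q) = - (q ^ 3) / 2" for q :: real by (simp add: power3_eq_cube)
  show ?thesis using H unfolding gen .
qed

lemma DERIV_max_power_one_minus:
  "((\<lambda>t. max 0 (1 - t) ^ Suc (Suc n)) has_real_derivative - (real (Suc (Suc n)) * max 0 (1 - t) ^ Suc n)) (at t)"
proof -
  have "((\<lambda>t. max 0 (1 - t) ^ Suc (Suc n)) has_real_derivative (real (Suc (Suc n)) * max 0 (1 - t) ^ Suc n) * (- 1)) (at t)"
    by (rule DERIV_chain2[OF DERIV_max_power]) (auto intro!: derivative_eq_intros)
  then show ?thesis by simp
qed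

lemma DERIV_nk0:
  assumes "t + e > 0" shows "(nk0 e has_real_derivative nk1 e t) (at t)"
proof -
  have "((\<lambda>t. max 0 (1 - t) ^ 3) has_real_derivative - (3 * max 0 (1 - t) ^ 2)) (at t)"
    using DERIV_max_power_one_minus[of 1 t] by (simp add: numeral_eq_Suc)
  from DERIV_mult[OF this DERIV_inverse_sqrt_shift[OF assms]] show ?thesis
    unfolding nk0_def[abs_def] nk1_def by (simp add: algebra_simps)
qed

lemma DERIV_nk1:
  assumes "t + e > 0" shows "(nk1 e has_real_derivative nk2 e t) (at t)"
proof -
  let ?S = "\<lambda>t. inverse (sqrt (t + e))"
  have S: "(?S has_real_derivative - (?S t ^ 3) / 2) (at t)" by (rule DERIV_inverse_sqrt_shift[OF assms])
  have S3: "((\<lambda>t. ?S t ^ 3) has_real_derivative 3 * ?S t ^ 2 * (- (?S t ^ 3) / 2)) (at t)"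
    by (rule DERIV_cong[OF DERIV_power[OF S, of 3]]) (simp add: numeral_eq_Suc)
  have m3: "((\<lambda>t. max 0 (1 - t) ^ 3) has_real_derivative - (3 * max 0 (1 - t) ^ 2)) (at t)"
    using DERIV_max_power_one_minus[of 1 t] by (simp add: numeral_eq_Suc)
  have m2: "((\<lambda>t. max 0 (1 - t) ^ 2) has_real_derivative - (2 * max 0 (1 - t))) (at t)"
    using DERIV_max_power_one_minus[of 0 t] by (simp add: numeral_eq_Suc)
  have main: "((\<lambda>t. (- 3) * (max 0 (1 - t) ^ 2 * ?S t) - (1/2) * (max 0 (1 - t) ^ 3 * ?S t ^ 3)) has_real_derivative
     (- 3) * (- (2 * max 0 (1 - t)) * ?S t + (- (?S t ^ 3) / 2) * max 0 (1 - t) ^ 2)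
     - (1/2) * (- (3 * max 0 (1 - t) ^ 2) * ?S t ^ 3 + (3 * ?S t ^ 2 * (- (?S t ^ 3) / 2)) * max 0 (1 - t) ^ 3)) (at t)"
    by (intro DERIV_diff DERIV_cmult DERIV_mult m2 m3 S S3)
  have "(- 3) * (- (2 * m) * q + (- (q ^ 3) / 2) * m ^ 2)
     - (1/2) * (- (3 * m ^ 2) * q ^ 3 + (3 * q ^ 2 * (- (q ^ 3) / 2)) * m ^ 3)
     = 6 * m * q + 3 * m ^ 2 * q ^ 3 + 3/4 * m ^ 3 * q ^ 5" for m q :: real
    by (simp add: numeral_eq_Suc field_simps)
  from this[of "max 0 (1 - t)" "?S t"] have "(- 3) * (- (2 * max 0 (1 - t)) * ?S t + (- (?S t ^ 3) / 2) * max 0 (1 - t) ^ 2)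
     - (1/2) * (- (3 * max 0 (1 - t) ^ 2) * ?S t ^ 3 + (3 * ?S t ^ 2 * (- (?S t ^ 3) / 2)) * max 0 (1 - t) ^ 3) = nk2 e t"
    unfolding nk2_def .
  moreover have "(\<lambda>t. (- 3) * (max 0 (1 - t) ^ 2 * ?S t) - (1/2) * (max 0 (1 - t) ^ 3 * ?S t ^ 3)) = nk1 e"
    unfolding nk1_def[abs_def] by (auto simp: fun_eq_iff)
  ultimately show ?thesis using main by simp
qed

lemma nk2_nonneg: "t + e > 0 \<Longrightarrow> 0 \<le> nk2 e t"
  unfolding nk2_def by (intro add_nonneg_nonneg mult_nonneg_nonneg zero_le_power) auto

lemma nk0_nonneg: "t + e > 0 \<Longrightarrow> 0 \<le> nk0 e t"
  unfolding nk0_def by (intro mult_nonneg_nonneg zero_le_power) auto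

lemma delta_kernel_nonneg: "t + e > 0 \<Longrightarrow> e > 0 \<Longrightarrow> 0 \<le> delta_kernel e t"
  unfolding delta_kernel_def by (intro mult_nonneg_nonneg zero_le_power) auto

text \<open>The left-hand side is the Euclidean Laplacian in three-space of \<open>nk0 e (|X|\<^sup>2)\<close>.\<close>

lemma nk_laplacian:
  assumes e: "e > 0" and t: "t \<ge> 0"
  shows "6 * nk1 e t + 4 * t * nk2 e t \<le> 24 * max 0 (1 - t) - delta_kernel e t"
proof -
  define S where "S = inverse (sqrt (t + e))"
  define m where "m = max 0 (1 - t)"
  have S: "S > 0" using e t by (simp add: S_def)
  have "S\<^sup>2 = inverse (t + e)" using e t by (simp add: S_def power_inverse)
  \<comment> \<open>This relation removes \<open>t\<close> from the terms with S^3 and S^5: their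
    leading parts cancel or turn negative, and the rest carries the factor \<open>e\<close>.\<close>
  then have tS: "t * S\<^sup>2 = 1 - e * S\<^sup>2" using e t by (simp add: field_simps)
  have m: "m \<ge> 0" by (simp add: m_def)
  have tmS: "t * m * S \<le> m"
  proof (cases "t \<le> 1")
    case True
    have "(t * S)\<^sup>2 = t * (t * S\<^sup>2)" by (simp add: power2_eq_square)
    also have "\<dots> \<le> 1 * 1"
    proof (intro mult_mono)
      have "0 \<le> e * S\<^sup>2" using e by simp
      then show "t * S\<^sup>2 \<le> 1" unfolding tS by linarith
    qed (use True t in auto)
    finally have "(t * S)\<^sup>2 \<le> 1\<^sup>2" by simp
    then have "t * S \<le> 1" by (rule power2_le_imp_le) simp
    then show ?thesis using mult_right_mono[of "t * S" 1 m] m by (simp add: ac_simps)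
  next
    case False
    then show ?thesis by (simp add: m_def)
  qed
  have "6 * nk1 e t + 4 * t * nk2 e t = - 18 * m\<^sup>2 * S - 3 * m^3 * S^3 + 24 * (t * m * S)
       + 12 * m\<^sup>2 * S * (t * S\<^sup>2) + 3 * m^3 * S^3 * (t * S\<^sup>2)"
    unfolding nk1_def nk2_def m_def[symmetric] S_def[symmetric] by (simp add: numeral_eq_Suc algebra_simps)
  also have "\<dots> = - 6 * m\<^sup>2 * S + 24 * (t * m * S) - 12 * e * m\<^sup>2 * S ^ 3 - 3 * e * m^3 * S^5"
    unfolding tS by (simp add: numeral_eq_Suc algebra_simps)
  also have "\<dots> \<le> 24 * m - 3 * e * m^3 * S^5"
  proof -
    have "0 \<le> m\<^sup>2 * S" "0 \<le> e * m\<^sup>2 * S ^ 3" using S e m by auto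
    then show ?thesis using tmS by simp
  qed
  finally show ?thesis by (simp add: delta_kernel_def m_def S_def)
qed

text \<open>For t \<le> 2 e the truncation factor is at least 1/8 and (t + e)^(5/2) is at most 18
  e^(5/2). The result is of the order of the inverse volume of a ball of radius sqrt e.\<close>

lemma delta_kernel_lower:
  assumes e: "0 < e" "e \<le> 1/4" and t: "0 \<le> t" "t \<le> 2 * e"
  shows "1 / (48 * sqrt e ^ 3) \<le> delta_kernel e t"
proof -
  define m where "m = max 0 (1 - t)"
  have m: "1/2 \<le> m" using t e by (simp add: m_def)
  have s: "sqrt (t + e) \<le> sqrt 3 * sqrt e"
    using t e by (simp flip: real_sqrt_mult)
  have se: "0 < sqrt e" "0 < sqrt (t + e)" using e t by auto
  have s5: "sqrt (t + e) ^ 5 \<le> (sqrt 3 * sqrt e) ^ 5" using s se by (intro power_mono) auto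
  have "sqrt e ^ 5 = sqrt e ^ 3 * (sqrt e)\<^sup>2" by (simp flip: power_add)
  then have "(sqrt 3 * sqrt e) ^ 5 = sqrt 3 ^ 5 * (sqrt e ^ 3 * e)"
    using e by (simp add: power_mult_distrib)
  moreover have "sqrt 3 ^ 5 = 9 * sqrt (3::real)" by (simp add: numeral_eq_Suc)
  moreover have "sqrt 3 \<le> (2::real)" by (simp add: real_le_lsqrt)
  ultimately have b5: "(sqrt 3 * sqrt e) ^ 5 \<le> 18 * (sqrt e ^ 3 * e)" using e by simp
  have "1 / (48 * sqrt e ^ 3) = (3 * e * (1/8)) * (1 / (18 * (sqrt e ^ 3 * e)))" using e by (simp add: field_simps)
  also have "\<dots> \<le> (3 * e * m ^ 3) * (1 / sqrt (t + e) ^ 5)"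
  proof (intro mult_mono)
    have "(1/2) ^ 3 \<le> m ^ 3" using m by (intro power_mono) auto
    then show "1/8 \<le> m ^ 3" by (simp add: power3_eq_cube)
    show "1 / (18 * (sqrt e ^ 3 * e)) \<le> 1 / sqrt (t + e) ^ 5"
      using order_trans[OF s5 b5] se by (intro divide_left_mono) (auto intro!: mult_pos_pos e)
  qed (use e m in auto)
  also have "\<dots> = delta_kernel e t" by (simp add: delta_kernel_def m_def divide_inverse power_inverse)
  finally show ?thesis .
qed

section \<open>Distance on the gradient graph and the kernel upper bound\<close>

context slag
begin

text \<open>\<open>rho\<close> is the squared distance in six-space between the points of the gradient graph over \<open>x\<close> and \<open>0\<close>;
  \<open>L rho = 6 V\<close> expresses that the graph is minimal.\<close>

definition dev :: "real^3 \<Rightarrow> 3 \<Rightarrow> real" where "dev x k = gr u x k - gr u 0 k"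

definition rho :: "real^3 \<Rightarrow> real" where
  "rho x = (\<Sum>i\<in>UNIV. x $ i * x $ i) + P2 x + (- 2) * (\<Sum>k\<in>UNIV. gr u 0 k * D k u x) + (\<Sum>k\<in>UNIV. (gr u 0 k)\<^sup>2)"

text \<open>The definition is this sum of squares multiplied out, which lets the formulas for
  derivatives of \<open>P2\<close> be reused; sign and size are read off here.\<close>

lemma rho_eq: "rho x = (\<Sum>i\<in>UNIV. (x $ i)\<^sup>2) + (\<Sum>k\<in>UNIV. (dev x k)\<^sup>2)"
  unfolding rho_def P2_def dev_def gr_def sum_3 by (simp add: power2_eq_square algebra_simps)

lemma rho_nonneg: "0 \<le> rho x" unfolding rho_eq by (intro add_nonneg_nonneg sum_nonneg) auto

lemma norm_le_rho: "(norm x)\<^sup>2 \<le> rho x"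
  unfolding rho_eq norm_sq_sum by (simp add: power2_eq_square sum_nonneg)

lemma C_rho: "C_k_on k rho B8"
  unfolding rho_def[abs_def] by (intro C_intros C_k_on_component C_P2 C1)

lemma D_rho:
  assumes x: "x \<in> B8" shows "D i rho x = 2 * (x $ i + app (A x) (dev x) i)"
proof -
  have d: "P2 differentiable at x" "\<And>k. D k u differentiable at x" using C_diff[OF x] C_P2 C1 by blast+
  have "D i rho x = 2 * x $ i + D i P2 x - 2 * (\<Sum>k\<in>UNIV. gr u 0 k * A x i k)"
    unfolding rho_def[abs_def] using d
    by (simp add: D_rules diff_rules A_def if_distrib[of "\<lambda>r. r * _"] if_distrib[of "\<lambda>r. _ * r"] cong: if_cong)
  then show ?thesis
    by (simp add: D_P2[OF x] app_def dev_def sum_subtractf algebra_simps)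
qed

text \<open>|x|^2 contributes \<open>2 * tra x\<close>, \<open>P2\<close> contributes
  \<open>2 * (3 * V x - tra x)\<close>, and the terms linear in Du are annihilated because each
  first derivative of \<open>u\<close> solves the linearised equation.\<close>

lemma L_rho:
  assumes x: "x \<in> B8" shows "L rho x = 6 * V x"
proof -
  have DP: "D i P2 differentiable at x" for i by (rule C_diff[OF x CD[OF C_P2]])
  have DD: "D i (D j rho) x = 2 * kd i j + D i (D j P2) x - 2 * (\<Sum>k\<in>UNIV. gr u 0 k * T x i j k)" for i j
  proof -
    have "D i (D j rho) x = D i (\<lambda>x. 2 * x $ j + D j P2 x - 2 * (\<Sum>k\<in>UNIV. gr u 0 k * A x j k)) x"
    proof (rule D_cong_open[OF open_ball x])
      fix y :: "real^3" assume y: "y \<in> B8"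
      show "D j rho y = 2 * y $ j + D j P2 y - 2 * (\<Sum>k\<in>UNIV. gr u 0 k * A y j k)"
        by (simp add: D_rho[OF y] D_P2[OF y] app_def dev_def sum_subtractf algebra_simps)
    qed
    also have "\<dots> = 2 * kd i j + D i (D j P2) x - 2 * (\<Sum>k\<in>UNIV. gr u 0 k * T x j k i)"
      using DP dA[OF x] by (simp add: D_rules diff_rules DA)
    also have "(\<Sum>k\<in>UNIV. gr u 0 k * T x j k i) = (\<Sum>k\<in>UNIV. gr u 0 k * T x i j k)"
      by (intro sum.cong refl arg_cong2[where f = "(*)"]) (metis T_sym1[OF x] T_sym2[OF x])
    finally show ?thesis .
  qed
  have "L rho x = 2 * tra x + L P2 x - 2 * (\<Sum>i\<in>UNIV. \<Sum>j\<in>UNIV. \<Sum>k\<in>UNIV. gr u 0 k * (lin c s (A x) i j * T x i j k))"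
    by (simp add: L_def DD tra_def algebra_simps sum.distrib sum_subtractf sum_distrib_left if_distrib[of "\<lambda>r. _ * r"] if_distrib[of "\<lambda>r. r * _"] cong: if_cong)
  also have "(\<Sum>i\<in>UNIV. \<Sum>j\<in>UNIV. \<Sum>k\<in>UNIV. gr u 0 k * (lin c s (A x) i j * T x i j k))
    = (\<Sum>i\<in>UNIV. \<Sum>k\<in>UNIV. \<Sum>j\<in>UNIV. gr u 0 k * (lin c s (A x) i j * T x i j k))"
    by (intro sum.cong refl sum.swap)
  also have "\<dots> = (\<Sum>k\<in>UNIV. \<Sum>i\<in>UNIV. \<Sum>j\<in>UNIV. gr u 0 k * (lin c s (A x) i j * T x i j k))"
    by (rule sum.swap)
  also have "\<dots> = (\<Sum>k\<in>UNIV. gr u 0 k * (\<Sum>i\<in>UNIV. \<Sum>j\<in>UNIV. lin c s (A x) i j * T x i j k))"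
    by (simp add: sum_distrib_left)
  finally show ?thesis by (simp add: lin_T[OF x] L_P2[OF x])
qed

lemma gr_rho_bound:
  assumes x: "x \<in> B8" shows "a x (gr rho x) (gr rho x) \<le> 4 * rho x * V x"
proof -
  obtain E l where P: "slag_point c s (A x) E l" using pointE[OF x] by blast
  have g: "gr rho x = (\<lambda>i. 2 * (x $ i + app (A x) (dev x) i))" by (auto simp: gr_def D_rho[OF x])
  show ?thesis
    unfolding g qf_cmult_left qf_cmult_right rho_eq
    using mult_left_mono[OF qf_lin_graph[OF P, of "\<lambda>i. x $ i" "dev x"], of 4] by (simp add: V_def algebra_simps)
qed

definition F :: "real \<Rightarrow> real^3 \<Rightarrow> real" where "F e x = nk0 e (rho x)"

lemma F_facts:
  assumes e: "e > 0"
  shows "C_k_on 2 (F e) B8" "C_k_on 0 (\<lambda>x. delta_kernel e (rho x)) B8"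
    "x \<in> B8 \<Longrightarrow> L (F e) x = nk1 e (rho x) * L rho x + nk2 e (rho x) * a x (gr rho x) (gr rho x)"
proof -
  have pos: "rho x + e > 0" for x using e rho_nonneg[of x] by simp
  have c: "continuous_on B8 rho" using C_rho[of 0] by simp
  have 2: "C_k_on 0 (\<lambda>x. nk2 e (rho x)) B8"
    unfolding nk2_def C_k_on.simps using pos by (intro continuous_intros c) (auto simp: less_imp_neq[THEN not_sym])
  show "C_k_on 0 (\<lambda>x. delta_kernel e (rho x)) B8"
    unfolding delta_kernel_def C_k_on.simps using pos by (intro continuous_intros c) (auto simp: less_imp_neq[THEN not_sym])
  have 1: "C_k_on (Suc 0) (\<lambda>x. nk1 e (rho x)) B8"
    by (rule C_k_on_chain[OF open_ball C_rho 2]) (rule DERIV_nk1[OF pos])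
  have "C_k_on (Suc (Suc 0)) (\<lambda>x. nk0 e (rho x)) B8"
    by (rule C_k_on_chain[OF open_ball C_rho 1]) (rule DERIV_nk0[OF pos])
  then show "C_k_on 2 (F e) B8" by (simp add: F_def[abs_def] numeral_2_eq_2 del: C_k_on.simps)
  show "L (F e) x = nk1 e (rho x) * L rho x + nk2 e (rho x) * a x (gr rho x) (gr rho x)" if x: "x \<in> B8"
  proof -
    have DF: "D j (F e) y = nk1 e (rho y) * D j rho y" if "y \<in> B8" for j y
      unfolding F_def[abs_def] by (rule D_chain[OF C_diff[OF that C_rho] DERIV_nk0[OF pos]])
    have "D i (D j (F e)) x = nk2 e (rho x) * D i rho x * D j rho x + nk1 e (rho x) * D i (D j rho) x" for i j
    proof -
      have "D i (D j (F e)) x = D i (\<lambda>x. nk1 e (rho x) * D j rho x) x"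
        by (rule D_cong_open[OF open_ball x DF])
      also have "\<dots> = D i (\<lambda>x. nk1 e (rho x)) x * D j rho x + nk1 e (rho x) * D i (D j rho) x"
        using 1 by (intro D_mult C_diff[OF x] CD[OF C_rho]) simp
      also have "D i (\<lambda>x. nk1 e (rho x)) x = nk2 e (rho x) * D i rho x"
        by (rule D_chain[OF C_diff[OF x C_rho] DERIV_nk1[OF pos]])
      finally show ?thesis .
    qed
    then show ?thesis
      by (simp add: L_def qf_def gr_def sum.distrib sum_distrib_left algebra_simps)
  qed
qed

text \<open>Since \<open>nk2\<close> is nonnegative, the facts L rho = 6 V and |D rho|^2 \<le> 4 rho
  V (in the form \<open>a\<close>) bound \<open>L (F e)\<close> by V times the Laplacian of the
  kernel in flat three-space. Green's identity against the subharmonic \<open>b\<close> then keeps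
  the concentrated part below the integral of b V over a fixed ball.\<close>

lemma kernel_bound:
  assumes e: "e > 0"
  shows "Itg (\<lambda>x. delta_kernel e (rho x) * (b x * V x)) \<le> 24 * (12200000 * M 7 7)"
proof -
  note CF = F_facts[OF e]
  have CF0: "C_k_on 0 (F e) B8" "C_k_on 0 (L (F e)) B8"
    using C_k_on_mono[OF CF(1), of 0] C_L[of 0 "F e"] CF(1) by (simp_all add: numeral_2_eq_2 del: C_k_on.simps)
  note Cs = C_intros C_facts Cb CF0 CF(2) C_L[of 0 b]
  have pos: "rho x + e > 0" for x using e rho_nonneg[of x] by simp
  have "Itg (\<lambda>x. 0) \<le> Itg (\<lambda>x. F e x * L b x)"
  proof (rule Itg_mono[of 0 _ 0])
    fix x assume x: "x \<in> B8"
    show "0 \<le> F e x * L b x" using nk0_nonneg[OF pos] L_b_nonneg[OF x] by (simp add: F_def)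
  qed (intro Cs; simp)+
  also have "\<dots> = Itg (\<lambda>x. b x * L (F e) x)"
  proof (rule green[OF CF(1) Cb])
    fix x assume "x \<in> B8" "x \<notin> K7"
    then have "1\<^sup>2 \<le> (norm x)\<^sup>2" by (intro power_mono) auto
    then have "1 \<le> rho x" using norm_le_rho[of x] by simp
    then show "F e x = 0" by (simp add: F_def nk0_def)
  qed
  also have "\<dots> \<le> Itg (\<lambda>x. 24 * (cut 1 x * (b x * V x)) - delta_kernel e (rho x) * (b x * V x))"
  proof (rule Itg_mono[of 0 _ 0])
    fix x assume x: "x \<in> B8"
    have bV: "0 \<le> b x * V x" using b_nonneg[OF x] V_pos[OF x] by simp
    have "L (F e) x \<le> nk1 e (rho x) * (6 * V x) + nk2 e (rho x) * (4 * rho x * V x)"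
      unfolding CF(3)[OF x] L_rho[OF x] by (intro add_left_mono mult_left_mono gr_rho_bound x nk2_nonneg pos)
    also have "\<dots> = (6 * nk1 e (rho x) + 4 * rho x * nk2 e (rho x)) * V x" by (simp add: algebra_simps)
    finally have "b x * L (F e) x \<le> b x * ((6 * nk1 e (rho x) + 4 * rho x * nk2 e (rho x)) * V x)"
      by (intro mult_left_mono b_nonneg x)
    also have "\<dots> = (6 * nk1 e (rho x) + 4 * rho x * nk2 e (rho x)) * (b x * V x)" by simp
    also have "\<dots> \<le> (24 * cut 1 x - delta_kernel e (rho x)) * (b x * V x)"
    proof (rule mult_right_mono[OF _ bV])
      have "max 0 (1 - rho x) \<le> cut 1 x"
      proof (cases "rho x < 1")
        case True
        then have "(norm x)\<^sup>2 \<le> 1\<^sup>2" using norm_le_rho[of x] by simp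
        then have "norm x \<le> 1" by (rule power2_le_imp_le) simp
        then have "1 \<le> cut 1 x" by (intro cut_ge_1) simp
        then show ?thesis using rho_nonneg[of x] by simp
      qed (use cut_nonneg in simp)
      then show "6 * nk1 e (rho x) + 4 * rho x * nk2 e (rho x) \<le> 24 * cut 1 x - delta_kernel e (rho x)"
        by (intro order_trans[OF nk_laplacian[OF e rho_nonneg[of x]]]) simp
    qed
    finally show "b x * L (F e) x \<le> 24 * (cut 1 x * (b x * V x)) - delta_kernel e (rho x) * (b x * V x)"
      by (simp add: algebra_simps)
  qed (intro Cs; simp)+
  also have "\<dots> = 24 * Itg (\<lambda>x. cut 1 x * (b x * V x)) - Itg (\<lambda>x. delta_kernel e (rho x) * (b x * V x))"
    by (subst Itg_diff[of 0 _ 0]) (simp only: Itg_cmult | intro Cs; simp)+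
  finally have "Itg (\<lambda>x. delta_kernel e (rho x) * (b x * V x)) \<le> 24 * Itg (\<lambda>x. cut 1 x * (b x * V x))"
    by (simp add: Itg_def)
  then show ?thesis using bound_b_V by linarith
qed

end

section \<open>Lower bound for the kernel integral near the origin\<close>

lemma frechet_derivative_partial:
  fixes f :: "real^'n \<Rightarrow> real"
  assumes "f differentiable at x"
  shows "frechet_derivative f (at x) y = (\<Sum>i\<in>UNIV. y $ i * D i f x)"
proof -
  have lin: "linear (frechet_derivative f (at x))" by (rule linear_frechet_derivative[OF assms])
  have "frechet_derivative f (at x) y = frechet_derivative f (at x) (\<Sum>i\<in>UNIV. (y $ i) *\<^sub>R axis i 1)"
    using basis_expansion[of y] by (simp add: scalar_mult_eq_scaleR)
  then show ?thesis by (simp add: linear_sum[OF lin] linear_cmul[OF lin] partial_deriv_def)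
qed

lemma differentiable_expansion_at_0:
  fixes f :: "real^'n \<Rightarrow> real"
  assumes "f differentiable at 0" "e > 0"
  shows "\<exists>d>0. \<forall>x. norm x < d \<longrightarrow> \<bar>f x - f 0 - (\<Sum>i\<in>UNIV. x $ i * D i f 0)\<bar> \<le> e * norm x"
  using D_has[OF assms(1)] assms(2) unfolding has_derivative_at_alt frechet_derivative_partial[OF assms(1)]
  by auto

lemma measure_lborel_linear_image_ball:
  fixes B :: "real^3^3"
  assumes "r \<ge> 0"
  shows "measure lborel ((*v) B ` cball 0 r) = \<bar>det B\<bar> * (unit_ball_vol 3 * r ^ 3)"
proof -
  have "compact ((*v) B ` cball 0 r)"
    by (intro compact_continuous_image matrix_vector_mult_linear_continuous_on) auto
  then have "(*v) B ` cball 0 r \<in> sets lborel" by (simp add: borel_compact)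
  then have "measure lborel ((*v) B ` cball 0 r) = measure lebesgue ((*v) B ` cball 0 r)"
    by (simp add: measure_completion)
  also have "\<dots> = \<bar>det (matrix ((*v) B))\<bar> * measure lebesgue (cball (0::real^3) r)"
    by (rule measure_linear_image) auto
  also have "measure lebesgue (cball (0::real^3) r) = unit_ball_vol 3 * r ^ 3"
    using content_cball[OF assms, of "0::real^3"] by (simp add: measure_completion)
  finally show ?thesis by simp
qed

text \<open>28108800000 = 96 * 24 * 12200000: the factors come from the lower kernel bound, the
  upper kernel bound and the bound for the integral of b V. The integral is the volume of the ball
  of radius 7.\<close>

definition K0 :: real where
  "K0 = 28108800000 * kappa ^ 7 * Itg (\<lambda>x. 1) / unit_ball_vol 3"

context slag
begin

text \<open>The metric I + A^2 induced on the graph, frozen at the origin.\<close>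

definition quad :: "real^3 \<Rightarrow> real" where
  "quad x = (\<Sum>i\<in>UNIV. (x $ i)\<^sup>2) + (\<Sum>k\<in>UNIV. (app (A 0) (\<lambda>i. x $ i) k)\<^sup>2)"

text \<open>Near 0 the deviation of Du is the Hessian at 0 applied to \<open>x\<close>, up to an
  error of at most |x|/4 in each component. Squaring turns the three errors into 3/8 |x|^2, which
  the factor 2 absorbs.\<close>

lemma rho_near_0: "\<exists>d>0. \<forall>x. norm x < d \<longrightarrow> rho x \<le> 2 * quad x"
proof -
  have z: "(0::real^3) \<in> B8" by simp
  have "\<exists>d>0. \<forall>x. norm x < d \<longrightarrow> \<bar>dev x k - app (A 0) (\<lambda>i. x $ i) k\<bar> \<le> (1/4) * norm x" for k
  proof -
    have "app (A 0) (\<lambda>i. x $ i) k = (\<Sum>i\<in>UNIV. x $ i * D i (D k u) 0)" for x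
      unfolding app_def using A_sym[OF z, of k] by (simp add: A_def mult.commute)
    then show ?thesis
      using differentiable_expansion_at_0[OF C_diff[OF z C1[of 1 k]], of "1/4"]
      by (simp add: dev_def gr_def)
  qed
  then obtain d where d: "\<And>k. d k > 0" "\<And>k x. norm x < d k \<Longrightarrow> \<bar>dev x k - app (A 0) (\<lambda>i. x $ i) k\<bar> \<le> (1/4) * norm x"
    by metis
  define d0 where "d0 = Min (range d)"
  have d0: "d0 > 0" "\<And>k. d0 \<le> d k" using d(1) by (auto simp: d0_def)
  have "rho x \<le> 2 * quad x" if x: "norm x < d0" for x
  proof -
    have "(dev x k)\<^sup>2 \<le> 2 * (app (A 0) (\<lambda>i. x $ i) k)\<^sup>2 + (1/8) * (norm x)\<^sup>2" for k
    proof -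
      let ?p = "app (A 0) (\<lambda>i. x $ i) k" let ?e = "dev x k - ?p"
      have "\<bar>?e\<bar> \<le> (1/4) * norm x" using d(2)[of x k] d0(2)[of k] x by linarith
      then have "\<bar>?e\<bar>\<^sup>2 \<le> ((1/4) * norm x)\<^sup>2" by (intro power_mono) auto
      then have "?e\<^sup>2 \<le> (1/16) * (norm x)\<^sup>2" by (simp add: power_mult_distrib power2_eq_square)
      moreover have "(dev x k)\<^sup>2 + (?p - ?e)\<^sup>2 = 2 * ?p\<^sup>2 + 2 * ?e\<^sup>2" by (simp add: power2_eq_square algebra_simps)
      ultimately show ?thesis using zero_le_power2[of "?p - ?e"] by linarith
    qed
    then have "(\<Sum>k\<in>UNIV. (dev x k)\<^sup>2) \<le> (\<Sum>k\<in>(UNIV::3 set). 2 * (app (A 0) (\<lambda>i. x $ i) k)\<^sup>2 + (1/8) * (norm x)\<^sup>2)"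
      by (intro sum_mono)
    also have "\<dots> = 2 * (\<Sum>k\<in>UNIV. (app (A 0) (\<lambda>i. x $ i) k)\<^sup>2) + (3/8) * (norm x)\<^sup>2"
      by (simp add: sum.distrib sum_distrib_left)
    finally have le: "(\<Sum>k\<in>UNIV. (dev x k)\<^sup>2) \<le> 2 * (\<Sum>k\<in>UNIV. (app (A 0) (\<lambda>i. x $ i) k)\<^sup>2) + (3/8) * (norm x)\<^sup>2" .
    have nx: "(norm x)\<^sup>2 = (\<Sum>i\<in>UNIV. (x $ i)\<^sup>2)" unfolding norm_sq_sum by (simp add: power2_eq_square)
    have "0 \<le> (\<Sum>i\<in>UNIV. (x $ i)\<^sup>2)" by (intro sum_nonneg) simp
    moreover have "s + t \<le> 2 * (s + p)" if "0 \<le> s" "t \<le> 2 * p + (3/8) * s" for s t p :: real using that by simp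
    ultimately show ?thesis using le unfolding rho_eq quad_def nx by blast
  qed
  with d0(1) show ?thesis by blast
qed

text \<open>The ellipsoid \<open>quad \<le> \<epsilon>\<close> therefore has the volume of a Euclidean ball with respect to the constant
  density \<open>V 0\<close>, which keeps the constant in the mean value inequality independent of \<open>u\<close>.\<close>

lemma ellipsoid_map:
  obtains B :: "real^3^3" where "\<bar>det B\<bar> = 1 / V 0" "\<And>y. quad (B *v y) = (norm y)\<^sup>2"
proof -
  obtain E l where P: "slag_point c s (A 0) E l" using pointE[of 0] by auto
  note E = slag_E[OF P]
  define wt where "wt a = sqrt (1 + (l a)\<^sup>2)" for a
  have wt: "wt a > 0" "(wt a)\<^sup>2 = 1 + (l a)\<^sup>2" for a by (simp_all add: wt_def add_pos_nonneg)
  \<comment> \<open>\<open>Q\<close> has the eigenvectors as columns and \<open>W\<close> the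
    inverse square roots of the eigenvalues of I + A(0)^2, so their product maps the unit ball onto
    the ellipsoid \<open>quad\<close> \<le> 1.\<close>
  define Q :: "real^3^3" where "Q = (\<chi> i a. E a i)"
  define W :: "real^3^3" where "W = (\<chi> i j. if i = j then 1 / wt i else 0)"
  have "transpose Q ** Q = mat 1"
    by (simp add: Q_def transpose_def matrix_matrix_mult_def mat_def orthoframeD[OF E] vec_eq_iff)
  then have "orthogonal_matrix Q" by (simp add: orthogonal_matrix)
  then have dQ: "\<bar>det Q\<bar> = 1" using det_orthogonal_matrix[of Q] by auto
  have dW: "det W = 1 / (wt 1 * wt 2 * wt 3)"
    by (simp add: det_3 W_def)
  have V0: "V 0 = wt 1 * wt 2 * wt 3"
  proof (rule power2_eq_imp_eq)
    show "(V 0)\<^sup>2 = (wt 1 * wt 2 * wt 3)\<^sup>2"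
      using slag_V2[OF P] by (simp add: V_def power_mult_distrib wt)
  qed (use wt V_pos[of 0] in \<open>auto simp: less_imp_le\<close>)
  show ?thesis
  proof (rule that[of "Q ** W"])
    show "\<bar>det (Q ** W)\<bar> = 1 / V 0"
      unfolding det_mul abs_mult dQ dW V0 using wt(1) by (simp add: less_imp_le)
    fix y :: "real^3"
    have QW: "(Q ** W) $ i $ a = E a i / wt a" for i a
      by (simp add: matrix_matrix_mult_def Q_def W_def if_distrib[of "\<lambda>r. _ * r"] cong: if_cong)
    have comp: "((Q ** W) *v y) $ i = (\<Sum>a\<in>UNIV. E a i * (y $ a / wt a))" for i
      by (simp add: matrix_vector_mult_def QW)
    have co: "coord E (\<lambda>i. ((Q ** W) *v y) $ i) b = y $ b / wt b" for b
    proof -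
      have "coord E (\<lambda>i. ((Q ** W) *v y) $ i) b = (\<Sum>a\<in>UNIV. y $ a / wt a * coord E (\<lambda>i. E a i) b)"
        unfolding comp coord_sum
      proof (intro sum.cong refl)
        fix a
        have "coord E (\<lambda>i. E a i * (y $ a / wt a)) b = coord E (\<lambda>i. (y $ a / wt a) * E a i) b"
          by (simp only: mult.commute)
        then show "coord E (\<lambda>i. E a i * (y $ a / wt a)) b = y $ a / wt a * coord E (\<lambda>i. E a i) b"
          by (simp only: coord_mult)
      qed
      also have "\<dots> = (\<Sum>a\<in>UNIV. y $ a / wt a * kd b a)"
        by (simp add: coord_def[of E "E _"] orthoframeD[OF E])
      also have "\<dots> = y $ b / wt b" by (simp add: if_distrib[of "\<lambda>r. _ * r"] cong: if_cong)
      finally show ?thesis .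
    qed
    have "quad ((Q ** W) *v y) = (\<Sum>a\<in>UNIV. (y $ a / wt a)\<^sup>2) + (\<Sum>a\<in>UNIV. (l a * (y $ a / wt a))\<^sup>2)"
      unfolding quad_def parseval_sq[OF E, of "\<lambda>i. ((Q ** W) *v y) $ i"]
        parseval_sq[OF E, of "app (A 0) (\<lambda>i. ((Q ** W) *v y) $ i)"]
      unfolding slag_H[OF P] coord_app[OF E] co ..
    also have "\<dots> = (\<Sum>a\<in>UNIV. (y $ a)\<^sup>2)"
    proof -
      have "(y $ a / wt a)\<^sup>2 + (l a * (y $ a / wt a))\<^sup>2 = (y $ a)\<^sup>2" for a
      proof -
        have "(y $ a / wt a)\<^sup>2 + (l a * (y $ a / wt a))\<^sup>2 = (y $ a)\<^sup>2 * (1 + (l a)\<^sup>2) / (wt a)\<^sup>2"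
          by (simp add: power_mult_distrib power_divide add_divide_distrib distrib_left mult.commute)
        then show ?thesis using wt(1)[of a] unfolding wt(2)[symmetric] by simp
      qed
      then show ?thesis by (simp flip: sum.distrib)
    qed
    finally show "quad ((Q ** W) *v y) = (norm y)\<^sup>2" unfolding norm_sq_sum by (simp add: power2_eq_square)
  qed
qed

text \<open>On an ellipsoid of volume \<open>unit_ball_vol 3 * r ^ 3 / V 0\<close> the kernel is at
  least 1 / (48 r^3) and b V at least half its value at 0. Both \<open>r\<close> and
  \<open>V 0\<close> cancel, so although \<open>e\<close> depends on \<open>u\<close> the bound does
  not, and one sufficiently small \<open>e\<close> replaces a limit.\<close>

lemma kernel_lower:
  "\<exists>e>0. b 0 * unit_ball_vol 3 / 96 \<le> Itg (\<lambda>x. delta_kernel e (rho x) * (b x * V x))"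
proof -
  have z: "(0::real^3) \<in> B8" by simp
  have b0: "0 \<le> b 0" and V0: "0 < V 0" using b_nonneg[OF z] V_pos[OF z] by auto
  let ?f = "\<lambda>x. b x * V x"
  obtain d1 where d1: "d1 > 0" "\<And>x. norm x < d1 \<Longrightarrow> rho x \<le> 2 * quad x" using rho_near_0 by blast
  obtain d2 where d2: "d2 > 0" "\<And>x. norm x < d2 \<Longrightarrow> x \<in> B8 \<Longrightarrow> ?f 0 / 2 \<le> ?f x"
  \<comment> \<open>Continuity with tolerance b(0) V(0) / 2 requires a positive value; in the other
    case the claim is the sign of \<open>b\<close> and \<open>V\<close>.\<close>
  proof (cases "b 0 = 0")
    case True
    show ?thesis by (rule that[of 1]) (use True b_nonneg V_pos in \<open>auto simp: less_imp_le\<close>)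
  next
    case False
    then have f0: "?f 0 > 0" using b0 V0 by simp
    have "continuous_on B8 ?f" using C_intros(3)[OF Cb[of 0] C_V[of 0]] by simp
    then have "isCont ?f 0" by (simp add: continuous_on_eq_continuous_at)
    then obtain d where "d > 0" "\<And>x. dist x 0 < d \<Longrightarrow> dist (?f x) (?f 0) < ?f 0 / 2"
      using f0 unfolding continuous_at_eps_delta by (meson half_gt_zero)
    note d = this
    have "?f 0 / 2 \<le> ?f x" if "norm x < d" for x
    proof -
      have "\<bar>?f x - ?f 0\<bar> < ?f 0 / 2" using d(2)[of x] that by (simp add: dist_real_def)
      then show ?thesis by linarith
    qed
    with d(1) show ?thesis by (intro that[of d])
  qed
  define r where "r = min (1/2) (min d1 d2 / 2)"
  have r: "0 < r" "r \<le> 1/2" "r < d1" "r < d2" using d1 d2 by (auto simp: r_def)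
  define e where "e = r\<^sup>2"
  have "e \<le> (1/2)\<^sup>2" unfolding e_def using r by (intro power_mono) auto
  then have e: "0 < e" "e \<le> 1/4" "sqrt e = r" using r by (simp_all add: e_def power2_eq_square)
  obtain B where B: "\<bar>det B\<bar> = 1 / V 0" "\<And>y. quad (B *v y) = (norm y)\<^sup>2" using ellipsoid_map by blast
  define E where "E = (*v) B ` cball 0 r"
  have Ecomp: "compact E" unfolding E_def
    by (intro compact_continuous_image matrix_vector_mult_linear_continuous_on) auto
  have mE: "measure lborel E = (1 / V 0) * (unit_ball_vol 3 * r ^ 3)"
    unfolding E_def using r B(1) by (subst measure_lborel_linear_image_ball) auto
  have inE: "norm x \<le> r \<and> rho x \<le> 2 * e" if xE: "x \<in> E" for x
  proof -
    obtain y where y: "x = B *v y" "norm y \<le> r" using xE by (auto simp: E_def)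
    have q: "quad x \<le> r\<^sup>2" unfolding y(1) B(2) using y(2) by (intro power_mono) auto
    have "(norm x)\<^sup>2 \<le> quad x" unfolding quad_def norm_sq_sum by (simp add: power2_eq_square sum_nonneg)
    then have nx: "norm x \<le> r" using q r by (meson order_trans power2_le_imp_le less_imp_le)
    then have "rho x \<le> 2 * quad x" using d1(2) r by simp
    then show ?thesis using q nx by (simp add: e_def)
  qed
  define h where "h x = delta_kernel e (rho x) * ?f x" for x
  have hC: "C_k_on 0 h B8" unfolding h_def[abs_def]
    by (intro C_intros F_facts(2)[OF e(1)] Cb C_V)
  have h0: "0 \<le> h x" if "x \<in> B8" for x
    unfolding h_def using b_nonneg[OF that] V_pos[OF that] delta_kernel_nonneg[of "rho x" e] rho_nonneg[of x] e
    by (intro mult_nonneg_nonneg) auto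
  define q where "q = 1 / (48 * r ^ 3) * (?f 0 / 2)"
  have hE: "q \<le> h x" if "x \<in> E" for x
  proof -
    have x: "norm x \<le> r" "rho x \<le> 2 * e" using inE[OF that] by auto
    then have xB: "x \<in> B8" using r by simp
    show ?thesis unfolding h_def q_def
    proof (rule mult_mono)
      show "1 / (48 * r ^ 3) \<le> delta_kernel e (rho x)"
        using delta_kernel_lower[OF e(1,2) rho_nonneg x(2)] by (simp add: e(3))
      show "?f 0 / 2 \<le> ?f x" using d2(2)[OF _ xB] x(1) r by simp
      show "0 \<le> delta_kernel e (rho x)" using delta_kernel_nonneg[of "rho x" e] rho_nonneg[of x] e by simp
    qed (use b0 V0 in auto)
  qed
  have "q * measure lborel E = (LINT x|lborel. indicator E x *\<^sub>R q)"
    using Ecomp by (simp add: borel_compact emeasure_compact_finite)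
  also have "\<dots> \<le> (LINT x|lborel. indicator K7 x *\<^sub>R h x)"
  proof (rule integral_mono)
    show "integrable lborel (\<lambda>x. indicator E x *\<^sub>R q)" by (rule borel_integrable_compact[OF Ecomp]) auto
    show "integrable lborel (\<lambda>x. indicator K7 x *\<^sub>R h x)" using K7_integrable[OF hC] by (simp add: set_integrable_def)
    fix x :: "real^3"
    have "x \<in> K7" if "x \<in> E" using inE[OF that] r by simp
    then show "indicator E x *\<^sub>R q \<le> indicator K7 x *\<^sub>R h x"
      using hE[of x] h0[of x] by (auto simp: indicator_def)
  qed
  also have "\<dots> = Itg h" by (simp add: Itg_def set_lebesgue_integral_def)
  finally have "q * measure lborel E \<le> Itg h" .
  moreover have "q * measure lborel E = b 0 * unit_ball_vol 3 / 96"
    unfolding mE q_def using r V0 by (simp add: field_simps)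
  ultimately show ?thesis using e(1) unfolding h_def[abs_def] by auto
qed

theorem b_bound: "b 0 \<le> K0 * N ^ 7"
proof -
  obtain e where e: "e > 0" "b 0 * unit_ball_vol 3 / 96 \<le> Itg (\<lambda>x. delta_kernel e (rho x) * (b x * V x))"
    using kernel_lower by blast
  have "b 0 * unit_ball_vol 3 / 96 \<le> 24 * (12200000 * M 7 7)" using e(2) kernel_bound[OF e(1)] by linarith
  then have "b 0 * unit_ball_vol 3 \<le> 28108800000 * M 7 7" by simp
  moreover have "unit_ball_vol 3 > 0" by (rule unit_ball_vol_pos) simp
  ultimately have "b 0 \<le> 28108800000 * M 7 7 / unit_ball_vol 3" by (simp add: pos_le_divide_eq)
  then show ?thesis by (simp add: K0_def M_def ac_simps)
qed

lemma norm_hessian_le: "norm (hessian u 0) \<le> exp (K0 * N ^ 7)"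
proof -
  have z: "(0::real^3) \<in> B8" by simp
  obtain E l where P: "slag_point c s (A 0) E l" using pointE[OF z] by blast
  have "(norm (hessian u 0))\<^sup>2 = (\<Sum>i\<in>UNIV. \<Sum>j\<in>UNIV. A 0 i j * A 0 i j)"
    by (simp add: power2_norm_eq_inner inner_vec_def hessian_def A_def)
  also have "\<dots> = (\<Sum>i\<in>UNIV. sq (A 0) i i)"
    unfolding sq_def by (intro sum.cong refl) (metis A_sym[OF z])
  also have "\<dots> = (w 0)\<^sup>2 - 2 * sg2 (A 0)" by (simp add: sg2_def w_def field_simps)
  also have "\<dots> \<le> (w 0)\<^sup>2" using slag_sg2[OF P] by simp
  finally have "norm (hessian u 0) \<le> w 0" by (rule power2_le_imp_le) (use w_ge[OF z] in simp)
  also have "\<dots> = exp (b 0)" using w_ge[OF z] by (simp add: b_def)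
  also have "\<dots> \<le> exp (K0 * N ^ 7)" using b_bound by simp
  finally show ?thesis .
qed

end

section \<open>Scaling\<close>

lemma D_scale:
  fixes f :: "real^'n \<Rightarrow> real"
  assumes "f differentiable at (r *\<^sub>R x)"
  shows "D i (\<lambda>x. k * f (r *\<^sub>R x)) x = k * r * D i f (r *\<^sub>R x)"
    and "(\<lambda>x. k * f (r *\<^sub>R x)) differentiable at x"
proof -
  let ?F = "frechet_derivative f (at (r *\<^sub>R x))"
  have "((\<lambda>x. r *\<^sub>R x) has_derivative (\<lambda>y. r *\<^sub>R y)) (at x)"
    by (auto intro!: derivative_eq_intros)
  from has_derivative_compose[OF this D_has[OF assms]]
  have d: "((\<lambda>x. k * f (r *\<^sub>R x)) has_derivative (\<lambda>y. k * ?F (r *\<^sub>R y))) (at x)"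
    by (rule has_derivative_mult_right)
  from D_eqI[OF d] show "D i (\<lambda>x. k * f (r *\<^sub>R x)) x = k * r * D i f (r *\<^sub>R x)"
    using linear_frechet_derivative[OF assms] by (simp add: partial_deriv_def linear_cmul)
  show "(\<lambda>x. k * f (r *\<^sub>R x)) differentiable at x" using d by (auto simp: differentiable_def)
qed

lemma C_k_on_scale:
  fixes f :: "real^'n \<Rightarrow> real"
  assumes S: "open S" "open S'" "\<And>x. x \<in> S' \<Longrightarrow> r *\<^sub>R x \<in> S" and f: "C_k_on n f S"
  shows "C_k_on n (\<lambda>x. k * f (r *\<^sub>R x)) S'"
  using f
proof (induction n arbitrary: f k)
  case 0
  then have "continuous_on ((\<lambda>x. r *\<^sub>R x) ` S') f" using S(3) by (auto intro: continuous_on_subset)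
  then have "continuous_on S' (\<lambda>x. f (r *\<^sub>R x))"
    by (intro continuous_on_compose2[of _ f _ "\<lambda>x. r *\<^sub>R x"]) (auto intro!: continuous_intros)
  then show ?case by (auto intro!: continuous_intros)
next
  case (Suc n)
  have d: "f differentiable at (r *\<^sub>R x)" if "x \<in> S'" for x
    using C_k_on_differentiable[OF Suc.prems S(1) S(3)[OF that]] .
  have "C_k_on n (D i (\<lambda>x. k * f (r *\<^sub>R x))) S'" for i
  proof (rule C_k_on_cong[OF S(2)])
    show "k * r * D i f (r *\<^sub>R x) = D i (\<lambda>x. k * f (r *\<^sub>R x)) x" if "x \<in> S'" for x
      using D_scale(1)[OF d[OF that]] by simp
    show "C_k_on n (\<lambda>x. k * r * D i f (r *\<^sub>R x)) S'" using Suc.prems by (intro Suc.IH) simp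
  qed
  moreover have "(\<lambda>x. k * f (r *\<^sub>R x)) differentiable_on S'"
    using D_scale(2)[OF d] S(2) by (auto simp: differentiable_on_eq_differentiable_at)
  ultimately show ?case by simp
qed

lemma gradient_component_le: "\<bar>D i u x\<bar> \<le> norm (gradient u x)"
  using component_le_norm_cart[of "gradient u x" i] by (simp add: gradient_def)

text \<open>The function v(x) = \<sigma> u(r x) / r^2 with r = R / 8 lives on the ball of radius 8,
  has Hessian \<sigma> D^2u(r x) and gradient bound 8 G / R; the sign \<sigma> makes the phase
  nonnegative. \<open>G\<close> may be any gradient bound, so that roots of suprema of different
  powers can be inserted later.\<close>

lemma hessian_bound:
  fixes u :: "real^3 \<Rightarrow> real"
  assumes R: "R > 0" and \<Theta>: "\<bar>\<Theta>\<bar> \<ge> pi / 2" and smooth: "smooth_on u (ball 0 R)"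
    and sl: "special_lagrangian_on \<Theta> u (ball 0 R)"
    and G: "\<And>x. x \<in> ball 0 R \<Longrightarrow> norm (gradient u x) \<le> G"
  shows "norm (hessian u 0) \<le> exp (K0 * (1 + 8 * (G / R)) ^ 7)" and "\<bar>\<Theta>\<bar> < 3 * pi / 2"
proof -
  define \<sigma> where "\<sigma> = (if \<Theta> \<ge> 0 then 1 else -1 :: real)"
  have \<sigma>: "\<sigma> * \<Theta> = \<bar>\<Theta>\<bar>" "\<bar>\<sigma>\<bar> = 1" "\<sigma> = 1 \<or> \<sigma> = -1" by (auto simp: \<sigma>_def)
  define r where "r = R / 8"
  have r: "r > 0" using R by (simp add: r_def)
  define v where "v x = (\<sigma> / r\<^sup>2) * u (r *\<^sub>R x)" for x
  have inR: "r *\<^sub>R x \<in> ball 0 R" if "x \<in> B8" for x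
    using that R by (simp add: r_def)
  have Cu: "C_k_on k u (ball 0 R)" for k using smooth by (simp add: smooth_on_def)
  have du: "u differentiable at y" "\<And>j. D j u differentiable at y" if "y \<in> ball 0 R" for y
    using C_k_on_differentiable[OF Cu[of 1, unfolded One_nat_def] open_ball that]
      C_k_on_differentiable[of 0 "D _ u", OF _ open_ball that] Cu[of 2] by (auto simp: numeral_2_eq_2)
  have Dv: "D j v x = (\<sigma> / r) * D j u (r *\<^sub>R x)" if "x \<in> B8" for j x
  proof -
    have "D j v x = \<sigma> / r\<^sup>2 * r * D j u (r *\<^sub>R x)"
      unfolding v_def[abs_def] by (rule D_scale(1)[OF du(1)[OF inR[OF that]]])
    then show ?thesis using r by (simp add: power2_eq_square)
  qed
  have DDv: "D i (D j v) x = \<sigma> * D i (D j u) (r *\<^sub>R x)" if "x \<in> B8" for i j x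
  proof -
    have "D i (D j v) x = D i (\<lambda>x. (\<sigma> / r) * D j u (r *\<^sub>R x)) x"
      by (rule D_cong_open[OF open_ball that Dv])
    also have "\<dots> = \<sigma> / r * r * D i (D j u) (r *\<^sub>R x)"
      by (rule D_scale(1)[OF du(2)[OF inR[OF that]]])
    also have "\<dots> = \<sigma> * D i (D j u) (r *\<^sub>R x)" using r by simp
    finally show ?thesis .
  qed
  have frame: "\<exists>E l. orthoframe E \<and> (\<lambda>i j. D i (D j v) x) = spectral E l \<and> arctan (l 1) + arctan (l 2) + arctan (l 3) = \<bar>\<Theta>\<bar>"
    if x: "x \<in> B8" for x
  proof -
    let ?y = "r *\<^sub>R x"
    have "transpose (hessian u ?y) = hessian u ?y"
      using clairaut[OF open_ball Cu inR[OF x]] by (simp add: hessian_def transpose_def vec_eq_iff)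
    then obtain E l where E: "orthoframe E" "(\<lambda>i j. hessian u ?y $ i $ j) = spectral E l" "eigenvalues (hessian u ?y) = {#l 1, l 2, l 3#}"
      by (rule symmetric_spectral)
    have "D i (D j v) x = spectral E (\<lambda>a. \<sigma> * l a) i j" for i j
      unfolding DDv[OF x] spectral_cmult using fun_cong[OF fun_cong[OF E(2)], of i j] by (simp add: hessian_def)
    moreover have "(\<Sum>l\<in>#eigenvalues (hessian u ?y). arctan l) = \<Theta>"
      using sl inR[OF x] unfolding special_lagrangian_on_def by blast
    then have "arctan (l 1) + arctan (l 2) + arctan (l 3) = \<Theta>" by (simp add: E(3))
    then have "arctan (\<sigma> * l 1) + arctan (\<sigma> * l 2) + arctan (\<sigma> * l 3) = \<sigma> * \<Theta>"
      using \<sigma>(3) by (auto simp: arctan_minus)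
    ultimately show ?thesis using E(1) \<sigma>(1) by auto
  qed
  have G0: "0 \<le> G" using G[of 0] R by (metis centre_in_ball norm_ge_zero order_trans)
  define N where "N = 1 + 8 * (G / R)"
  interpret slag v "cos \<bar>\<Theta>\<bar>" "sin \<bar>\<Theta>\<bar>" N
  proof
    show "smooth_on v B8" unfolding smooth_on_def v_def
      using C_k_on_scale[OF open_ball open_ball inR Cu] by blast
    show "1 \<le> N" using G0 R by (simp add: N_def)
    show "\<exists>E l. slag_point (cos \<bar>\<Theta>\<bar>) (sin \<bar>\<Theta>\<bar>) (\<lambda>i j. D i (D j v) x) E l" if "x \<in> B8" for x
      using frame[OF that] slag_pointI \<Theta> by blast
    show "\<bar>D i v x\<bar> \<le> N" if "x \<in> B8" for x i
    proof -
      have "\<bar>D i v x\<bar> = \<bar>D i u (r *\<^sub>R x)\<bar> / r" using r \<sigma>(2) by (simp add: Dv[OF that] abs_mult)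
      also have "\<dots> \<le> G / r"
        using order_trans[OF gradient_component_le G[OF inR[OF that]]] r by (simp add: divide_right_mono)
      also have "\<dots> \<le> N" by (simp add: N_def r_def mult.commute)
      finally show ?thesis .
    qed
  qed
  have "hessian v 0 = \<sigma> *\<^sub>R hessian u 0" by (simp add: hessian_def DDv vec_eq_iff)
  then have "norm (hessian u 0) = norm (hessian v 0)" using \<sigma>(2) by simp
  then show "norm (hessian u 0) \<le> exp (K0 * (1 + 8 * (G / R)) ^ 7)" using norm_hessian_le by (simp add: N_def)
  show "\<bar>\<Theta>\<bar> < 3 * pi / 2"
  proof -
    obtain E l where "arctan (l 1) + arctan (l (2::3)) + arctan (l 3) = \<bar>\<Theta>\<bar>" using frame[of 0] by auto
    then show ?thesis using arctan_ubound[of "l 1"] arctan_ubound[of "l 2"] arctan_ubound[of "l 3"] by linarith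
  qed
qed

section \<open>From the polynomial exponent to the two stated estimates\<close>

lemma K0_nonneg: "0 \<le> K0"
proof -
  have "Itg (\<lambda>x. 0) \<le> Itg (\<lambda>x. 1)" by (rule Itg_mono[of 0 _ 0]) (auto intro: C_k_on_const)
  then have "0 \<le> Itg (\<lambda>x. 1)" by (simp add: Itg_def)
  then show ?thesis using kappa_ge unit_ball_vol_pos[of 3] by (simp add: K0_def)
qed

lemma power7_bound:
  fixes g :: real assumes "0 \<le> g" shows "(1 + 8 * g) ^ 7 \<le> 128 + 128 * 8 ^ 7 * g ^ 7"
proof -
  have "(1 + 8 * g) ^ 7 \<le> (2 * max 1 (8 * g)) ^ 7" using assms by (intro power_mono) auto
  also have "\<dots> = 128 * max 1 (8 * g) ^ 7" by (simp add: power_mult_distrib)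
  also have "max 1 (8 * g) ^ 7 \<le> 1 + (8 * g) ^ 7" using assms by (auto simp: max_def)
  finally show ?thesis by (simp add: power_mult_distrib)
qed

text \<open>From g \<le> 1 + g^3 follows 1 + 8 g \<le> 9 (1 + g^3) \<le> 9 exp (g^3). A polynomial
  exponent is thus stronger than the double exponential.\<close>

lemma power7_exp_bound:
  fixes g :: real assumes "0 \<le> g" shows "(1 + 8 * g) ^ 7 \<le> 9 ^ 7 * exp (7 * g ^ 3)"
proof -
  have g: "g \<le> 1 + g ^ 3"
  proof (cases "g \<le> 1")
    case True then show ?thesis using assms by (simp add: add_increasing2)
  next
    case False
    then have "g ^ 1 \<le> g ^ 3" by (intro power_increasing) auto
    then show ?thesis by simp
  qed
  have "1 + 8 * a \<le> 9 * (1 + t)" if "a \<le> 1 + t" "0 \<le> t" for a t :: real using that by simp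
  from this[OF g zero_le_power[OF assms]] have "1 + 8 * g \<le> 9 * (1 + g ^ 3)" .
  also have "\<dots> \<le> 9 * exp (g ^ 3)" by (intro mult_left_mono exp_ge_add_one_self) simp
  finally have "(1 + 8 * g) ^ 7 \<le> (9 * exp (g ^ 3)) ^ 7" using assms by (intro power_mono) auto
  also have "\<dots> = 9 ^ 7 * exp (7 * g ^ 3)" by (simp add: power_mult_distrib exp_of_nat_mult[symmetric])
  finally show ?thesis .
qed

text \<open>The range of the angle corresponds to phases strictly between pi/2 and 3 pi/2; at its
  right end the cotangent squared is 1/3, and the cotangent decreases.\<close>

lemma cot_sq_ge:
  fixes \<phi> :: real assumes "0 < \<phi>" "\<phi> < pi / 3" shows "1/3 \<le> (cot \<phi>)\<^sup>2"
proof -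
  have "cos (pi/3) \<le> cos \<phi>" using assms by (intro cos_monotone_0_pi_le) auto
  then have c: "1/2 \<le> cos \<phi>" by (simp add: cos_60)
  then have "(1/2)\<^sup>2 \<le> (cos \<phi>)\<^sup>2" by (intro power_mono) auto
  then have c2: "1/4 \<le> (cos \<phi>)\<^sup>2" by (simp add: power2_eq_square)
  have "sin \<phi> > 0" using assms pi_gt_zero by (intro sin_gt_zero) linarith+
  then have s: "(sin \<phi>)\<^sup>2 > 0" by simp
  have "(sin \<phi>)\<^sup>2 \<le> 3 * (cos \<phi>)\<^sup>2" using c2 sin_cos_squared_add[of \<phi>] by linarith
  then show ?thesis using s by (simp add: cot_def power_divide field_simps)
qed

theorem theorem1p1:
  shows "\<exists>C::real. C > 0 \<and>
    (\<forall>(R::real) (\<Theta>::real) (u :: real ^ 3 \<Rightarrow> real).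
      R > 0 \<longrightarrow> \<bar>\<Theta>\<bar> \<ge> pi / 2 \<longrightarrow>
      smooth_on u (ball 0 R) \<longrightarrow> special_lagrangian_on \<Theta> u (ball 0 R) \<longrightarrow>
      bdd_above ((\<lambda>x. norm (gradient u x)) ` ball 0 R) \<longrightarrow>
      (\<bar>\<Theta>\<bar> > pi / 2 \<longrightarrow>
        norm (hessian u 0) \<le>
          C * exp (C * (cot ((\<bar>\<Theta>\<bar> - pi / 2) / 3))\<^sup>2
                     * ((SUP x\<in>ball 0 R. norm (gradient u x) ^ 7) / R ^ 7))) \<and>
      norm (hessian u 0) \<le>
        C * exp (C * exp (C * ((SUP x\<in>ball 0 R. norm (gradient u x) ^ 3) / R ^ 3))))"
proof -
  \<comment> \<open>7 serves the factor in exp (7 X), exp (128 K0) the constant part of the exponent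
    as a prefactor, 384 = 3 * 128 pays for inserting the squared cotangent, which is at least 1/3,
    and 9^7 K0 is the outer factor of the double exponential.\<close>
  define C where "C = 7 + exp (128 * K0) + 384 * 8 ^ 7 * K0 + 9 ^ 7 * K0"
  have "0 \<le> 384 * 8 ^ 7 * K0" "0 \<le> 9 ^ 7 * K0" using K0_nonneg by simp_all
  moreover have "0 < 7 + x + p + q \<and> 1 \<le> 7 + x + p + q \<and> 7 \<le> 7 + x + p + q \<and> x \<le> 7 + x + p + q
    \<and> p \<le> 7 + x + p + q \<and> q \<le> 7 + x + p + q" if "0 < x" "0 \<le> p" "0 \<le> q" for x p q :: real
    using that by simp
  ultimately have C: "C > 0" "1 \<le> C" "7 \<le> C" "exp (128 * K0) \<le> C" "384 * 8 ^ 7 * K0 \<le> C" "9 ^ 7 * K0 \<le> C"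
    unfolding C_def using exp_gt_zero[of "128 * K0"] by blast+
  show ?thesis
  proof (intro exI[of _ C] conjI allI impI C(1))
    fix R \<Theta> :: real and u :: "real^3 \<Rightarrow> real"
    assume R: "0 < R" and \<Theta>: "pi / 2 \<le> \<bar>\<Theta>\<bar>" and sm: "smooth_on u (ball 0 R)"
      and sl: "special_lagrangian_on \<Theta> u (ball 0 R)"
      and bdd: "bdd_above ((\<lambda>x. norm (gradient u x)) ` ball 0 R)"
    let ?S = "\<lambda>n. SUP x\<in>ball 0 R. norm (gradient u x) ^ n"
    have le_S: "norm (gradient u x) ^ n \<le> ?S n" if "x \<in> ball 0 R" for x n
    proof (rule cSUP_upper[OF that])
      obtain B where "\<forall>y\<in>(\<lambda>x. norm (gradient u x)) ` ball 0 R. y \<le> B"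
        using bdd unfolding bdd_above_def by blast
      then have "norm (gradient u x) \<le> B" if "x \<in> ball 0 R" for x using that by blast
      then show "bdd_above ((\<lambda>x. norm (gradient u x) ^ n) ` ball 0 R)"
        by (intro bdd_aboveI2[of _ _ "B ^ n"] power_mono) auto
    qed
    have S0: "0 \<le> ?S n" for n
      using le_S[of 0 n] R by (meson centre_in_ball norm_ge_zero order_trans zero_le_power)
    \<comment> \<open>The suprema are taken over powers of the gradient norm; the n-th root of such
      a supremum is itself a gradient bound, and its n-th power gives the supremum back.\<close>
    have bound: "norm (hessian u 0) \<le> exp (K0 * (1 + 8 * (root n (?S n) / R)) ^ 7)" if "n > 0" for n
    proof (rule hessian_bound(1)[OF R \<Theta> sm sl])
      show "norm (gradient u x) \<le> root n (?S n)" if "x \<in> ball 0 R" for x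
        using real_root_le_mono[OF \<open>n > 0\<close> le_S[OF that, of n]] \<open>n > 0\<close> by (simp add: real_root_power_cancel)
    qed
    have pw: "(root n (?S n) / R) ^ n = ?S n / R ^ n" "0 \<le> root n (?S n) / R" if "n > 0" for n
      using that S0 R by (simp_all add: power_divide real_root_pow_pos2 real_root_ge_zero)
    show "norm (hessian u 0) \<le> C * exp (C * (cot ((\<bar>\<Theta>\<bar> - pi / 2) / 3))\<^sup>2 * (?S 7 / R ^ 7))"
      if "pi / 2 < \<bar>\<Theta>\<bar>"
    proof -
      define X where "X = ?S 7 / R ^ 7"
      define k where "k = (cot ((\<bar>\<Theta>\<bar> - pi / 2) / 3))\<^sup>2"
      have X: "0 \<le> X" using S0 R by (simp add: X_def)
      have "\<bar>\<Theta>\<bar> < 3 * pi / 2"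
        by (rule hessian_bound(2)[OF R \<Theta> sm sl, of "root 7 (?S 7)"])
          (use real_root_le_mono[OF _ le_S, of 7 _ 7] in \<open>simp add: real_root_power_cancel\<close>)
      then have k: "1/3 \<le> k" unfolding k_def using that by (intro cot_sq_ge) auto
      have "K0 * (1 + 8 * (root 7 (?S 7) / R)) ^ 7 \<le> K0 * (128 + 128 * 8 ^ 7 * X)"
        using power7_bound[OF pw(2)[of 7]] pw(1)[of 7] K0_nonneg by (intro mult_left_mono) (auto simp: X_def)
      also have "\<dots> = 128 * K0 + (384 * 8 ^ 7 * K0) * (1/3) * X" by (simp add: algebra_simps)
      also have "\<dots> \<le> 128 * K0 + C * k * X"
        using C k X K0_nonneg by (intro add_left_mono mult_right_mono mult_mono) auto
      finally have "norm (hessian u 0) \<le> exp (128 * K0 + C * k * X)"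
        using bound[of 7] by (meson exp_le_cancel_iff order_trans zero_less_numeral)
      also have "\<dots> = exp (128 * K0) * exp (C * k * X)" by (rule exp_add)
      also have "\<dots> \<le> C * exp (C * k * X)" using C by (intro mult_right_mono) auto
      finally show ?thesis by (simp add: X_def k_def)
    qed
    show "norm (hessian u 0) \<le> C * exp (C * exp (C * (?S 3 / R ^ 3)))"
    proof -
      define X where "X = ?S 3 / R ^ 3"
      have X: "0 \<le> X" using S0 R by (simp add: X_def)
      have "K0 * (1 + 8 * (root 3 (?S 3) / R)) ^ 7 \<le> K0 * (9 ^ 7 * exp (7 * X))"
        using power7_exp_bound[OF pw(2)[of 3]] pw(1)[of 3] K0_nonneg by (intro mult_left_mono) (auto simp: X_def)
      also have "\<dots> = (9 ^ 7 * K0) * exp (7 * X)" by simp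
      also have "\<dots> \<le> C * exp (C * X)"
        using C X by (intro mult_mono) (auto intro: mult_right_mono)
      finally have "norm (hessian u 0) \<le> exp (C * exp (C * X))"
        using bound[of 3] by (meson exp_le_cancel_iff order_trans zero_less_numeral)
      also have "\<dots> \<le> C * exp (C * exp (C * X))" using C by simp
      finally show ?thesis by (simp add: X_def)
    qed
  qed
qed

end
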